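(* Let $L$ be an SPS lattice and let $S=\{o,a_l,a_r,i\}$ be a tight square of $L$. Then $L[S]$ has exactly one join-irreducible congruence that is not of the form $\overline{\boldsymbol\alpha}$ for a join-irreducible congruence $\boldsymbol\alpha$ of $L$, and this congruence is $\boldsymbol\gamma(S)=\mathrm{con}_{L[S]}(t,i)$.
   Context: All lattices are finite. An SPS lattice is a slim, planar, semimodular lattice (slim: it contains no sublattice isomorphic to the five-element modular nondistributive lattice $M_3$); fix a planar diagram of $L$. $\prec$ denotes the covering relation. A covering square of $L$ is a four-element set $S=\{o,a_l,a_r,i\}$ with $a_l\ne a_r$, $o=a_l\wedge a_r$, $i=a_l\vee a_r$, $o\prec a_l\prec i$, $o\prec a_r\prec i$; $a_l$ is taken to be to the left of $a_r$. $S$ is tight if $i$ covers exactly two elements of $L$, namely $a_l$ and $a_r$; otherwise $S$ is wide. Fork extension $L[S]$. Put $x_{l,1}=a_l$, $y_{l,1}=o$. Given $y_{l,k}\prec x_{l,k}$, if there is an element $x_{l,k+1}$ of $L$ such that, with $y_{l,k+1}=x_{l,k+1}\wedge y_{l,k}$, the set $\{y_{l,k+1},x_{l,k+1},y_{l,k},x_{l,k}=x_{l,k+1}\vee y_{l,k}\}$ is a covering square of $L$ (such an element is unique), then continue with $x_{l,k+1},y_{l,k+1}$; otherwise stop and put $n=k$. Symmetrically on the right, starting with $x_{r,1}=a_r$, $y_{r,1}=o$, one gets $x_{r,k},y_{r,k}$ for $1\le k\le m$. Then $L[S]=L\cup\{t,z_{l,1},\dots,z_{l,n},z_{r,1},\dots,z_{r,m}\}$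 with new pairwise distinct elements, ordered by the smallest partial order extending that of $L$ with $y_{l,k}<z_{l,k}<x_{l,k}$ ($1\le k\le n$), $z_{l,k+1}<z_{l,k}$ ($1\le k<n$), $y_{r,k}<z_{r,k}<x_{r,k}$ ($1\le k\le m$), $z_{r,k+1}<z_{r,k}$ ($1\le k<m$), and $z_{l,1}<t$, $z_{r,1}<t$, $t<i$. $L[S]$ is an SPS lattice containing $L$ as a sublattice. For a lattice $K$, $\mathrm{con}_K(u,v)$ is the smallest congruence of $K$ collapsing $u$ and $v$. For a congruence $\boldsymbol\alpha$ of $L$, $\overline{\boldsymbol\alpha}$ denotes the smallest congruence of $L[S]$ containing $\boldsymbol\alpha$ (the minimal extension of $\boldsymbol\alpha$). A join-irreducible congruence of a lattice $K$ is a join-irreducible element of the congruence lattice $\mathrm{Con}\,K$. *)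

theory Defs
  imports "HOL-Algebra.Lattice" "HOL-Analysis.Analysis"
begin

definition covers :: "'a gorder \<Rightarrow> 'a \<Rightarrow> 'a \<Rightarrow> bool" (infix \<open>\<prec>\<index>\<close> 50)
  where "a \<prec>\<^bsub>L\<^esub> b \<longleftrightarrow> a \<in> carrier L \<and> b \<in> carrier L \<and> a \<sqsubset>\<^bsub>L\<^esub> b \<and>
    \<not> (\<exists>c\<in>carrier L. a \<sqsubset>\<^bsub>L\<^esub> c \<and> c \<sqsubset>\<^bsub>L\<^esub> b)"

definition semimodular :: "'a gorder \<Rightarrow> bool"
  where "semimodular L \<longleftrightarrow> (\<forall>a b. \<forall>c\<in>carrier L. a \<prec>\<^bsub>L\<^esub> b \<longrightarrow>
    a \<squnion>\<^bsub>L\<^esub> c = b \<squnion>\<^bsub>L\<^esub> c \<or> a \<squnion>\<^bsub>L\<^esub> c \<prec>\<^bsub>L\<^esub> b \<squnion>\<^bsub>L\<^esub> c)"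

definition sublattice :: "'a set \<Rightarrow> 'a gorder \<Rightarrow> bool"
  where "sublattice H L \<longleftrightarrow> H \<noteq> {} \<and> H \<subseteq> carrier L \<and>
    (\<forall>x\<in>H. \<forall>y\<in>H. x \<squnion>\<^bsub>L\<^esub> y \<in> H \<and> x \<sqinter>\<^bsub>L\<^esub> y \<in> H)"

definition order_iso :: "('a \<Rightarrow> 'b) \<Rightarrow> 'a gorder \<Rightarrow> 'b gorder \<Rightarrow> bool"
  where "order_iso f K L \<longleftrightarrow> bij_betw f (carrier K) (carrier L) \<and>
    (\<forall>x\<in>carrier K. \<forall>y\<in>carrier K. x \<sqsubseteq>\<^bsub>K\<^esub> y \<longleftrightarrow> f x \<sqsubseteq>\<^bsub>L\<^esub> f y)"

datatype m3 = M3_bot | M3_a | M3_b | M3_c | M3_top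

definition M3 :: "m3 gorder"
  where "M3 = \<lparr>carrier = UNIV, eq = (=), le = (\<lambda>x y. x = y \<or> x = M3_bot \<or> y = M3_top)\<rparr>"

definition slim :: "'a gorder \<Rightarrow> bool"
  where "slim L \<longleftrightarrow> \<not> (\<exists>H f. sublattice H L \<and> order_iso f M3 (L\<lparr>carrier := H\<rparr>))"

text \<open>A planar diagram is a Hasse diagram in the plane whose edges are straight line
  segments, going upwards, that meet only at common endpoints.\<close>

definition planar_diagram :: "'a gorder \<Rightarrow> ('a \<Rightarrow> real \<times> real) \<Rightarrow> bool"
  where "planar_diagram L pos \<longleftrightarrow>
    inj_on pos (carrier L) \<and>
    (\<forall>a b. a \<prec>\<^bsub>L\<^esub> b \<longrightarrow> snd (pos a) < snd (pos b)) \<and>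
    (\<forall>a b. \<forall>c\<in>carrier L. a \<prec>\<^bsub>L\<^esub> b \<and> pos c \<in> closed_segment (pos a) (pos b) \<longrightarrow> c \<in> {a, b}) \<and>
    (\<forall>a b c d. a \<prec>\<^bsub>L\<^esub> b \<and> c \<prec>\<^bsub>L\<^esub> d \<and> (a, b) \<noteq> (c, d) \<longrightarrow>
      closed_segment (pos a) (pos b) \<inter> closed_segment (pos c) (pos d) \<subseteq> pos ` ({a, b} \<inter> {c, d}))"

definition planar :: "'a gorder \<Rightarrow> bool"
  where "planar L \<longleftrightarrow> (\<exists>pos. planar_diagram L pos)"

definition sps_lattice :: "'a gorder \<Rightarrow> bool"
  where "sps_lattice L \<longleftrightarrow> lattice L \<and> finite (carrier L) \<and> slim L \<and> planar L \<and> semimodular L"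

text \<open>For two upper covers \<open>a\<close>, \<open>b\<close> of \<open>v\<close>, the vertex \<open>a\<close> is to the left of \<open>b\<close> iff the edge
  from \<open>v\<close> to \<open>a\<close> is to the left of the edge from \<open>v\<close> to \<open>b\<close>.  Both denominators are
  positive in a planar diagram.\<close>

definition left_above :: "('a \<Rightarrow> real \<times> real) \<Rightarrow> 'a \<Rightarrow> 'a \<Rightarrow> 'a \<Rightarrow> bool"
  where "left_above pos v a b \<longleftrightarrow>
    (fst (pos a) - fst (pos v)) / (snd (pos a) - snd (pos v)) <
    (fst (pos b) - fst (pos v)) / (snd (pos b) - snd (pos v))"

definition covering_square :: "'a gorder \<Rightarrow> 'a \<Rightarrow> 'a \<Rightarrow> 'a \<Rightarrow> 'a \<Rightarrow> bool"
  where "covering_square L v a b i \<longleftrightarrow> a \<noteq> b \<and> v = a \<sqinter>\<^bsub>L\<^esub> b \<and> i = a \<squnion>\<^bsub>L\<^esub> b \<and>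
    v \<prec>\<^bsub>L\<^esub> a \<and> a \<prec>\<^bsub>L\<^esub> i \<and> v \<prec>\<^bsub>L\<^esub> b \<and> b \<prec>\<^bsub>L\<^esub> i"

definition tight_square :: "'a gorder \<Rightarrow> 'a \<Rightarrow> 'a \<Rightarrow> 'a \<Rightarrow> 'a \<Rightarrow> bool"
  where "tight_square L v a b i \<longleftrightarrow> covering_square L v a b i \<and> {x. x \<prec>\<^bsub>L\<^esub> i} = {a, b}"

text \<open>\<open>fork_side L a v k x y\<close> says that the sequences descending from \<open>x\<^sub>1 = a\<close>, \<open>y\<^sub>1 = v\<close> reach
  index \<open>k\<close>, with \<open>x\<^sub>k = x\<close> and \<open>y\<^sub>k = y\<close>.  In a slim planar semimodular lattice, started at an
  edge of a covering square, each step is unique, so \<open>x\<close> and \<open>y\<close> are determined by \<open>k\<close>.\<close>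

inductive fork_side :: "'a gorder \<Rightarrow> 'a \<Rightarrow> 'a \<Rightarrow> nat \<Rightarrow> 'a \<Rightarrow> 'a \<Rightarrow> bool"
  for L :: "'a gorder" and a v :: 'a
  where
    start: "fork_side L a v 1 a v"
  | step: "fork_side L a v k x y \<Longrightarrow> x' \<in> carrier L \<Longrightarrow> covering_square L (x' \<sqinter>\<^bsub>L\<^esub> y) x' y x \<Longrightarrow>
      fork_side L a v (Suc k) x' (x' \<sqinter>\<^bsub>L\<^esub> y)"

datatype 'a fork_elem = Old 'a | New_t | New_zl nat | New_zr nat

definition fork_carrier :: "'a gorder \<Rightarrow> 'a \<Rightarrow> 'a \<Rightarrow> 'a \<Rightarrow> 'a fork_elem set"
  where "fork_carrier L v al ar =
    Old ` carrier L \<union> {New_t} \<union>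
    {New_zl k |k. \<exists>x y. fork_side L al v k x y} \<union>
    {New_zr k |k. \<exists>x y. fork_side L ar v k x y}"

definition fork_gens :: "'a gorder \<Rightarrow> 'a \<Rightarrow> 'a \<Rightarrow> 'a \<Rightarrow> 'a \<Rightarrow> 'a fork_elem rel"
  where "fork_gens L v al ar i =
    {(Old x, Old y) |x y. x \<in> carrier L \<and> y \<in> carrier L \<and> x \<sqsubseteq>\<^bsub>L\<^esub> y} \<union>
    {(Old y, New_zl k) |k x y. fork_side L al v k x y} \<union>
    {(New_zl k, Old x) |k x y. fork_side L al v k x y} \<union>
    {(New_zl (Suc k), New_zl k) |k x y x' y'. fork_side L al v k x y \<and> fork_side L al v (Suc k) x' y'} \<union>
    {(Old y, New_zr k) |k x y. fork_side L ar v k x y} \<union>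
    {(New_zr k, Old x) |k x y. fork_side L ar v k x y} \<union>
    {(New_zr (Suc k), New_zr k) |k x y x' y'. fork_side L ar v k x y \<and> fork_side L ar v (Suc k) x' y'} \<union>
    {(New_zl 1, New_t), (New_zr 1, New_t), (New_t, Old i)}"

definition fork_order :: "'a gorder \<Rightarrow> 'a \<Rightarrow> 'a \<Rightarrow> 'a \<Rightarrow> 'a \<Rightarrow> 'a fork_elem rel"
  where "fork_order L v al ar i =
    \<Inter> {R. partial_order_on (fork_carrier L v al ar) R \<and> fork_gens L v al ar i \<subseteq> R}"

definition fork :: "'a gorder \<Rightarrow> 'a \<Rightarrow> 'a \<Rightarrow> 'a \<Rightarrow> 'a \<Rightarrow> 'a fork_elem gorder"
  where "fork L v al ar i =
    \<lparr>carrier = fork_carrier L v al ar, eq = (=), le = (\<lambda>x y. (x, y) \<in> fork_order L v al ar i)\<rparr>"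

definition congruence :: "'a gorder \<Rightarrow> 'a rel \<Rightarrow> bool"
  where "congruence K \<theta> \<longleftrightarrow> equiv (carrier K) \<theta> \<and>
    (\<forall>a b c d. (a, b) \<in> \<theta> \<and> (c, d) \<in> \<theta> \<longrightarrow>
      (a \<squnion>\<^bsub>K\<^esub> c, b \<squnion>\<^bsub>K\<^esub> d) \<in> \<theta> \<and> (a \<sqinter>\<^bsub>K\<^esub> c, b \<sqinter>\<^bsub>K\<^esub> d) \<in> \<theta>)"

definition congruence_gen :: "'a gorder \<Rightarrow> 'a rel \<Rightarrow> 'a rel"
  where "congruence_gen K R = \<Inter> {\<theta>. congruence K \<theta> \<and> R \<subseteq> \<theta>}"

definition con :: "'a gorder \<Rightarrow> 'a \<Rightarrow> 'a \<Rightarrow> 'a rel"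
  where "con K u v = congruence_gen K {(u, v)}"

definition Con :: "'a gorder \<Rightarrow> 'a rel gorder"
  where "Con K = \<lparr>carrier = {\<theta>. congruence K \<theta>}, eq = (=), le = (\<subseteq>)\<rparr>"

text \<open>The zero of a lattice does not count as join-irreducible.\<close>

definition join_irreducible :: "'a gorder \<Rightarrow> 'a \<Rightarrow> bool"
  where "join_irreducible K p \<longleftrightarrow> p \<in> carrier K \<and> \<not> least K p (carrier K) \<and>
    (\<forall>a\<in>carrier K. \<forall>b\<in>carrier K. p = a \<squnion>\<^bsub>K\<^esub> b \<longrightarrow> p = a \<or> p = b)"

definition minimal_extension ::
    "'a gorder \<Rightarrow> 'a \<Rightarrow> 'a \<Rightarrow> 'a \<Rightarrow> 'a \<Rightarrow> 'a rel \<Rightarrow> 'a fork_elem rel"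
  where "minimal_extension L v al ar i \<alpha> =
    congruence_gen (fork L v al ar i) (map_prod Old Old ` \<alpha>)"

end

theory Submission
  imports Defs
begin

text \<open>Planarity gives a left-right relation on incomparable elements.  In a slim semimodular lattice
  it forces every join-irreducible element to have all its incomparable elements on one side, so the
  join-irreducible elements form two chains.  Counting those below \<open>x\<close> embeds the lattice into a
  product \<open>\<nat> \<times> \<nat>\<close> as a meet-subsemilattice.  After doubling these coordinates \<open>(l, r)\<close>, the fork
  extension is the meet-subsemilattice of the grid in which \<open>t = (2 l v + 1, 2 r v + 1)\<close>, and every
  \<open>z\<^sub>k\<close> shares one odd coordinate with \<open>t\<close> and the other coordinate with \<open>x\<^sub>k\<close>.

  A congruence of the fork is generated by its pairs of old elements together with \<open>(t, i)\<close>, if it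
  contains that pair; hence a join-irreducible congruence is \<open>con(t, i)\<close> or a minimal extension.
  Conversely, since \<open>a\<^sub>l\<close> and \<open>a\<^sub>r\<close> are the only lower covers of \<open>i\<close>, they generate prime ideals of
  the ideal of \<open>i\<close>.  The largest congruence contained in the partition of that ideal into the four
  resulting cells contains \<open>(t, i)\<close>, and splitting the cell \<open>{t, i}\<close> does not affect the pairs of
  old elements.  So the old pairs in \<open>con(t, i)\<close> generate a congruence without \<open>(t, i)\<close>.\<close>

text \<open>The fork is specified by the smallest order containing certain pairs, and its side
  sequences by recursion; coordinates turn both into comparisons of numbers. The crucial fact about
  the descending sequences is that they stop only when nothing is left to reach, so that old and new
  points together are closed under coordinatewise minima. Joins are the obstacle: the grid embedding
  preserves meets only, and no coordinate formula computes a join. They are controlled through the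
  least old element above each new one, namely \<open>x_k\<close> for \<open>z_k\<close> and
  \<open>i\<close> for \<open>t\<close>. The same asymmetry shapes the separating congruences, which
  are defined by testing all joins, while their compatibility with meets is read off from
  coordinates. Two such congruences are needed because con(t, i) is never computed: the coarser one
  bounds it from above, the finer one contains the old pairs of the coarser one. The cell split
  between them consists of \<open>t\<close> and \<open>i\<close> alone because the square is tight,
  and old elements do not notice the splitting because those below \<open>t\<close> lie below
  \<open>v\<close>, hence below both lower covers of \<open>i\<close>.\<close>

no_notation lesspoll (infixl \<open>\<prec>\<close> 50)

section \<open>Planar diagrams\<close>

text \<open>The polygonal line through the given points, as a function of the height.\<close>

fun polyline :: "(real \<times> real) list \<Rightarrow> real \<Rightarrow> real" where
  "polyline [] h = 0"
| "polyline [p] h = fst p"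
| "polyline (p # q # ps) h =
    (if h \<le> snd q then fst p + (h - snd p) / (snd q - snd p) * (fst q - fst p)
     else polyline (q # ps) h)"

abbreviation ascending :: "(real \<times> real) list \<Rightarrow> bool"
  where "ascending \<equiv> sorted_wrt (\<lambda>p q. snd p < snd q)"

lemma polyline_hd: "ascending (p # ps) \<Longrightarrow> polyline (p # ps) (snd p) = fst p"
  by (cases ps) auto

lemma polyline_continuous: "ascending ps \<Longrightarrow> continuous_on UNIV (polyline ps)"
proof (induction ps rule: induct_list012)
  case (3 p q ps)
  have eq: "polyline (p # q # ps) =
      (\<lambda>h. if h \<le> snd q then fst p + (h - snd p) / (snd q - snd p) * (fst q - fst p)
           else polyline (q # ps) h)"
    by auto
  have "continuous_on {h \<in> UNIV. snd q \<le> h} (polyline (q # ps))"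
    using 3 by (auto intro: continuous_on_subset)
  moreover have "snd p < snd q"
    using 3 by auto
  ultimately show ?case
    unfolding eq using polyline_hd[of q ps] 3(3)
    by (intro continuous_on_cases_le) (auto intro!: continuous_intros)
qed auto

lemma polyline_vertex: "ascending ps \<Longrightarrow> p \<in> set ps \<Longrightarrow> polyline ps (snd p) = fst p"
proof (induction ps rule: induct_list012)
  case (3 a q ps)
  consider "p = a" | "p = q" | "p \<in> set ps"
    using 3(4) by auto
  then show ?case
    by cases (use 3 polyline_hd[of q ps] in auto)
qed auto

lemma polyline_edge:
  assumes "ps \<noteq> []" "ascending ps" "snd (hd ps) \<le> h" "h \<le> snd (last ps)" "snd (hd ps) < snd (last ps)"
  shows "\<exists>xs p q ys. ps = xs @ p # q # ys \<and> snd p \<le> h \<and> h \<le> snd q \<and>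
    (polyline ps h, h) \<in> closed_segment p q"
  using assms
proof (induction ps rule: induct_list012)
  case (3 a q ps)
  show ?case
  proof (cases "h \<le> snd q")
    case True
    define u where "u = (h - snd a) / (snd q - snd a)"
    have a: "snd a < snd q"
      using 3 by auto
    then have u: "0 \<le> u" "u \<le> 1" "h = snd a + u * (snd q - snd a)"
      using 3 True by (auto simp: u_def field_simps)
    have "(polyline (a # q # ps) h, h) = (1 - u) *\<^sub>R a + u *\<^sub>R q"
      using True u(3) by (auto simp: prod_eq_iff u_def[symmetric] algebra_simps)
    then have "(polyline (a # q # ps) h, h) \<in> closed_segment a q"
      using u by (auto simp: closed_segment_def)
    then show ?thesis
      using True 3 by (intro exI[of _ "[]"]) auto
  next
    case False
    have "ps \<noteq> []"
      using False 3(6) by auto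
    then have "\<exists>xs p r ys. q # ps = xs @ p # r # ys \<and> snd p \<le> h \<and> h \<le> snd r \<and>
        (polyline (q # ps) h, h) \<in> closed_segment p r"
      using 3 False by (intro 3(2)) auto
    then obtain xs p r ys where "q # ps = xs @ p # r # ys" "snd p \<le> h" "h \<le> snd r"
        "(polyline (q # ps) h, h) \<in> closed_segment p r"
      by blast
    moreover have "polyline (a # q # ps) h = polyline (q # ps) h"
      using False by simp
    ultimately show ?thesis
      by (intro exI[of _ "a # xs"]) auto
  qed
qed auto

section \<open>Covers and saturated chains in finite lattices\<close>

locale finite_lattice = lattice L for L :: "'a gorder" (structure) +
  assumes finite_carrier: "finite (carrier L)"
    and carrier_nonempty: "carrier L \<noteq> {}"
begin

lemma antisym: "x \<sqsubseteq> y \<Longrightarrow> y \<sqsubseteq> x \<Longrightarrow> x \<in> carrier L \<Longrightarrow> y \<in> carrier L \<Longrightarrow> x = y"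
  by (rule le_antisym)

lemma less_iff: "x \<sqsubset> y \<longleftrightarrow> x \<sqsubseteq> y \<and> x \<noteq> y"
  by (simp add: lless_def eq_is_equal)

lemma covers_iff: "x \<prec> y \<longleftrightarrow> x \<in> carrier L \<and> y \<in> carrier L \<and> x \<sqsubseteq> y \<and> x \<noteq> y \<and>
    (\<forall>z\<in>carrier L. x \<sqsubseteq> z \<and> z \<sqsubseteq> y \<longrightarrow> z = x \<or> z = y)"
  unfolding covers_def less_iff by auto

lemma coversD:
  assumes "x \<prec> y"
  shows "x \<in> carrier L" "y \<in> carrier L" "x \<sqsubseteq> y" "x \<noteq> y"
    "\<And>z. z \<in> carrier L \<Longrightarrow> x \<sqsubseteq> z \<Longrightarrow> z \<sqsubseteq> y \<Longrightarrow> z = x \<or> z = y"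
  using assms by (auto simp: covers_iff)

lemma obtain_bot: obtains b where "b \<in> carrier L" "\<And>x. x \<in> carrier L \<Longrightarrow> b \<sqsubseteq> x"
proof
  show "\<Sqinter>carrier L \<in> carrier L"
    using finite_carrier carrier_nonempty by simp
  show "\<Sqinter>carrier L \<sqsubseteq> x" if "x \<in> carrier L" for x
    using finite_inf_greatest[OF finite_carrier subset_refl carrier_nonempty] that
    by (auto simp: greatest_def Lower_def)
qed

lemma obtain_top: obtains b where "b \<in> carrier L" "\<And>x. x \<in> carrier L \<Longrightarrow> x \<sqsubseteq> b"
proof
  show "\<Squnion>carrier L \<in> carrier L"
    using finite_carrier carrier_nonempty by simp
  show "x \<sqsubseteq> \<Squnion>carrier L" if "x \<in> carrier L" for x
    using finite_sup_least[OF finite_carrier subset_refl carrier_nonempty] that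
    by (auto simp: least_def Upper_def)
qed

lemma cover_above:
  assumes "x \<in> carrier L" "y \<in> carrier L" "x \<sqsubseteq> y" "x \<noteq> y"
  obtains z where "x \<prec> z" "z \<sqsubseteq> y"
proof -
  have "\<exists>z. x \<prec> z \<and> z \<sqsubseteq> y"
    using assms(2-)
  proof (induction "card {z \<in> carrier L. x \<sqsubseteq> z \<and> z \<sqsubseteq> y}" arbitrary: y rule: less_induct)
    case less
    show ?case
    proof (cases "x \<prec> y")
      case False
      then obtain z where z: "z \<in> carrier L" "x \<sqsubseteq> z" "z \<sqsubseteq> y" "z \<noteq> x" "z \<noteq> y"
        using less assms(1) by (auto simp: covers_iff)
      have "card {w \<in> carrier L. x \<sqsubseteq> w \<and> w \<sqsubseteq> z} < card {w \<in> carrier L. x \<sqsubseteq> w \<and> w \<sqsubseteq> y}"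
        using finite_carrier z less.prems assms(1) antisym
        by (intro psubset_card_mono) (auto intro: le_trans)
      then obtain c where "x \<prec> c" "c \<sqsubseteq> z"
        using less.hyps z by blast
      then show ?thesis
        using z less.prems by (meson coversD le_trans)
    qed (use less in auto)
  qed
  then show ?thesis
    using that by blast
qed

lemma cover_below:
  assumes "x \<in> carrier L" "y \<in> carrier L" "x \<sqsubseteq> y" "x \<noteq> y"
  obtains z where "x \<sqsubseteq> z" "z \<prec> y"
proof -
  have "\<exists>z. x \<sqsubseteq> z \<and> z \<prec> y"
    using assms
  proof (induction "card {z \<in> carrier L. x \<sqsubseteq> z \<and> z \<sqsubseteq> y}" arbitrary: x rule: less_induct)
    case less
    obtain c where c: "x \<prec> c" "c \<sqsubseteq> y"
      using cover_above less.prems by metis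
    show ?case
    proof (cases "c = y")
      case False
      have "card {w \<in> carrier L. c \<sqsubseteq> w \<and> w \<sqsubseteq> y} < card {w \<in> carrier L. x \<sqsubseteq> w \<and> w \<sqsubseteq> y}"
        using finite_carrier coversD[OF c(1)] less.prems antisym
        by (intro psubset_card_mono) (auto intro: le_trans)
      then obtain z where "c \<sqsubseteq> z" "z \<prec> y"
        using less.hyps c False coversD[OF c(1)] less.prems by blast
      then show ?thesis
        using c by (meson coversD le_trans)
    qed (use c less.prems in blast)
  qed
  then show ?thesis
    using that by blast
qed

text \<open>A list rather than a set, because its image under the diagram becomes the vertex list of
  a polygonal line; every step is a cover, hence an edge of the diagram.\<close>

definition path :: "'a list \<Rightarrow> bool"
  where "path C \<longleftrightarrow> C \<noteq> [] \<and> set C \<subseteq> carrier L \<and> successively (\<prec>) C"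

lemma path_exists:
  assumes "x \<in> carrier L" "y \<in> carrier L" "x \<sqsubseteq> y"
  shows "\<exists>C. path C \<and> hd C = x \<and> last C = y"
  using assms
proof (induction "card {z \<in> carrier L. x \<sqsubseteq> z \<and> z \<sqsubseteq> y}" arbitrary: x rule: less_induct)
  case less
  show ?case
  proof (cases "x = y")
    case True
    then show ?thesis
      using less by (intro exI[of _ "[x]"]) (auto simp: path_def)
  next
    case False
    then obtain c where c: "x \<prec> c" "c \<sqsubseteq> y"
      using cover_above less.prems by metis
    have "card {w \<in> carrier L. c \<sqsubseteq> w \<and> w \<sqsubseteq> y} < card {w \<in> carrier L. x \<sqsubseteq> w \<and> w \<sqsubseteq> y}"
      using finite_carrier coversD[OF c(1)] less.prems antisym
      by (intro psubset_card_mono) (auto intro: le_trans)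
    then obtain C where C: "path C" "hd C = c" "last C = y"
      using less.hyps c coversD[OF c(1)] less.prems by blast
    then show ?thesis
      using c less.prems by (intro exI[of _ "x # C"]) (auto simp: path_def successively_Cons)
  qed
qed

lemma path_append:
  assumes "path C" "path D" "last C = hd D"
  shows "path (C @ tl D)" "hd (C @ tl D) = hd C" "last (C @ tl D) = last D"
    "set C \<subseteq> set (C @ tl D)" "set D \<subseteq> set (C @ tl D)"
proof -
  obtain d D' where D: "D = d # D'"
    using assms by (cases D) (auto simp: path_def)
  show "path (C @ tl D)" "hd (C @ tl D) = hd C" "last (C @ tl D) = last D"
    "set C \<subseteq> set (C @ tl D)" "set D \<subseteq> set (C @ tl D)"
    using assms by (auto simp: D path_def successively_append_iff successively_Cons split: if_splits)
qed

lemma path_sorted: "path C \<Longrightarrow> sorted_wrt (\<sqsubseteq>) C"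
proof (induction C)
  case (Cons a C)
  show ?case
  proof (cases C)
    case (Cons b C')
    then have "path C" "a \<prec> b"
      using Cons.prems by (auto simp: path_def)
    then show ?thesis
      using Cons Cons.IH Cons.prems coversD[of a b]
      by (auto simp: path_def intro: le_trans)
  qed auto
qed auto

end

section \<open>Left and right in a planar diagram\<close>

locale planar_lattice = finite_lattice L for L :: "'a gorder" (structure) +
  fixes pos :: "'a \<Rightarrow> real \<times> real"
  assumes diagram: "planar_diagram L pos"
begin

abbreviation height :: "'a \<Rightarrow> real"
  where "height x \<equiv> snd (pos x)"

lemma height_cover: "a \<prec> b \<Longrightarrow> height a < height b"
  using diagram by (simp add: planar_diagram_def)

lemma path_ascending: "path C \<Longrightarrow> ascending (map pos C)"
proof (induction C)
  case (Cons a C)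
  show ?case
  proof (cases C)
    case (Cons b C')
    then have "path C" "a \<prec> b"
      using Cons.prems by (auto simp: path_def)
    then show ?thesis
      using Cons Cons.IH height_cover[of a b] by (auto simp: path_def)
  qed auto
qed auto

text \<open>Heights increase strictly along a path, so comparing a height with one end of an edge
  decides on which side of that edge a vertex occurs in the list.\<close>

lemma path_split:
  assumes "path (xs @ a # b # ys)" "x \<in> set (xs @ a # b # ys)"
  shows "height x < height b \<Longrightarrow> x \<sqsubseteq> a" "height a < height x \<Longrightarrow> b \<sqsubseteq> x"
proof -
  note 1 = path_sorted[OF assms(1)] path_ascending[OF assms(1)] assms
  have "x = a \<or> x = b \<or> x \<in> set xs \<or> x \<in> set ys"
    using assms by auto
  then show "height x < height b \<Longrightarrow> x \<sqsubseteq> a" "height a < height x \<Longrightarrow> b \<sqsubseteq> x"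
    using 1 by (auto simp: sorted_wrt_append path_def)
qed

lemma path_le:
  assumes "path C" "x \<in> set C" "y \<in> set C"
  shows "height x \<le> height y \<Longrightarrow> x \<sqsubseteq> y" "x \<sqsubseteq> y \<or> y \<sqsubseteq> x"
proof -
  obtain xs ys where C: "C = xs @ x # ys"
    using assms by (meson split_list)
  note 1 = path_sorted[OF assms(1)] path_ascending[OF assms(1)] assms
  have "y = x \<or> y \<in> set xs \<or> y \<in> set ys"
    using assms C by auto
  then show "height x \<le> height y \<Longrightarrow> x \<sqsubseteq> y" "x \<sqsubseteq> y \<or> y \<sqsubseteq> x"
    using 1 by (auto simp: C sorted_wrt_append path_def)
qed

text \<open>Running from the least to the greatest element makes the polygonal line meet every
  height that occurs in the diagram, so that it separates left from right.\<close>

definition bounding :: "'a list \<Rightarrow> bool"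
  where "bounding C \<longleftrightarrow> path C \<and> (\<forall>x\<in>carrier L. hd C \<sqsubseteq> x \<and> x \<sqsubseteq> last C)"

lemma bounding_through:
  assumes "x \<in> carrier L" "y \<in> carrier L" "x \<sqsubseteq> y"
  shows "\<exists>C. bounding C \<and> x \<in> set C \<and> y \<in> set C"
proof -
  obtain b where b: "b \<in> carrier L" "\<And>x. x \<in> carrier L \<Longrightarrow> b \<sqsubseteq> x"
    using obtain_bot by blast
  obtain t where t: "t \<in> carrier L" "\<And>x. x \<in> carrier L \<Longrightarrow> x \<sqsubseteq> t"
    using obtain_top by blast
  obtain C where C: "path C" "hd C = b" "last C = x"
    using path_exists assms b by blast
  obtain D where D: "path D" "hd D = x" "last D = y"
    using path_exists assms b by blast
  obtain E where E: "path E" "hd E = y" "last E = t"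
    using path_exists assms t by blast
  note CD = path_append[OF C(1) D(1)]
  have "last (C @ tl D) = hd E"
    using CD C D E by auto
  note CDE = path_append[OF CD(1) E(1) this]
  have "x \<in> set D" "y \<in> set D"
    using D by (auto simp: path_def)
  then show ?thesis
    using CDE CD C D E b t by (intro exI[of _ "(C @ tl D) @ tl E"]) (auto simp: bounding_def)
qed

definition xpos :: "'a list \<Rightarrow> real \<Rightarrow> real"
  where "xpos C = polyline (map pos C)"

lemma xpos_vertex: "path C \<Longrightarrow> x \<in> set C \<Longrightarrow> xpos C (height x) = fst (pos x)"
  unfolding xpos_def by (intro polyline_vertex path_ascending) auto

lemma height_mono: "x \<in> carrier L \<Longrightarrow> y \<in> carrier L \<Longrightarrow> x \<sqsubseteq> y \<Longrightarrow> height x \<le> height y"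
proof -
  assume a: "x \<in> carrier L" "y \<in> carrier L" "x \<sqsubseteq> y"
  then obtain C where C: "path C" "x \<in> set C" "y \<in> set C"
    using bounding_through bounding_def by blast
  show ?thesis
    using path_le(1)[OF C(1,3,2)] antisym[of x y] a by fastforce
qed

text \<open>The strict inequality \<open>height x < height y\<close> ensures that \<open>C\<close>
  has at least one edge; by \<open>height_mono\<close> its ends enclose all heights in
  question.\<close>

lemma xpos_edge:
  assumes "bounding C" "x \<in> carrier L" "y \<in> carrier L" "height x \<le> h" "h \<le> height y" "height x < height y"
  shows "\<exists>xs a b ys. C = xs @ a # b # ys \<and> a \<prec> b \<and> height a \<le> h \<and> h \<le> height b \<and>
    (xpos C h, h) \<in> closed_segment (pos a) (pos b)"
proof -
  have C: "path C" "C \<noteq> []" "hd C \<in> carrier L" "last C \<in> carrier L"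
    using assms by (auto simp: bounding_def path_def)
  have le: "height (hd C) \<le> height x" "height y \<le> height (last C)"
    using assms C by (auto simp: bounding_def intro!: height_mono)
  have "\<exists>xs p q ys. map pos C = xs @ p # q # ys \<and> snd p \<le> h \<and> h \<le> snd q \<and>
    (polyline (map pos C) h, h) \<in> closed_segment p q"
    using C le assms by (intro polyline_edge path_ascending) (auto simp: hd_map last_map)
  then obtain xs p q ys where 1: "map pos C = xs @ p # q # ys" "snd p \<le> h" "h \<le> snd q"
    "(xpos C h, h) \<in> closed_segment p q"
    unfolding xpos_def by blast
  from 1(1) obtain xs' a b ys' where 2: "C = xs' @ a # b # ys'" "p = pos a" "q = pos b"
    by (auto simp: map_eq_append_conv map_eq_Cons_conv)
  then have "a \<prec> b"
    using C by (auto simp: path_def successively_append_iff)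
  then show ?thesis
    using 1 2 by blast
qed

text \<open>The intermediate value theorem yields a common point of the two chains; planarity turns it
  into a common vertex or a common edge.\<close>

lemma crossing:
  assumes "bounding C" "bounding D"
    and "x \<in> carrier L" "y \<in> carrier L" "height x < height y"
    and "xpos C (height x) < xpos D (height x)" "xpos D (height y) < xpos C (height y)"
  obtains a b where "a \<in> set C" "b \<in> set C" "a \<in> set D" "b \<in> set D" "a \<sqsubseteq> b"
    "x \<in> set C \<union> set D \<Longrightarrow> x \<sqsubseteq> a" "y \<in> set C \<union> set D \<Longrightarrow> b \<sqsubseteq> y"
proof -
  have p: "path C" "path D"
    using assms by (auto simp: bounding_def)
  have "continuous_on UNIV (xpos C)" "continuous_on UNIV (xpos D)"
    using assms by (auto simp: bounding_def xpos_def intro!: polyline_continuous path_ascending)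
  then have "continuous_on {height x..height y} (\<lambda>h. xpos C h - xpos D h)"
    by (intro continuous_intros) (auto intro: continuous_on_subset)
  then obtain h where h: "height x \<le> h" "h \<le> height y" "xpos C h - xpos D h = 0"
    using IVT'[of "\<lambda>h. xpos C h - xpos D h" "height x" 0 "height y"] assms by auto
  \<comment> \<open>At either end of the interval the difference is nonzero by assumption.\<close>
  have h': "height x < h" "h < height y"
    using h assms by (auto simp: less_le)
  obtain xs a b ys where 1: "C = xs @ a # b # ys" "a \<prec> b" "height a \<le> h" "h \<le> height b"
      "(xpos C h, h) \<in> closed_segment (pos a) (pos b)"
    using xpos_edge assms h by metis
  obtain xs' c d ys' where 2: "D = xs' @ c # d # ys'" "c \<prec> d" "height c \<le> h" "h \<le> height d"
      "(xpos D h, h) \<in> closed_segment (pos c) (pos d)"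
    using xpos_edge assms h by metis
  show ?thesis
  proof (cases "(a, b) = (c, d)")
    case True
    show ?thesis
    proof (rule that[of a b])
      show "a \<sqsubseteq> b"
        using 1 coversD by auto
      show "x \<sqsubseteq> a" if "x \<in> set C \<union> set D"
        using that path_split(1)[of xs a b ys x] path_split(1)[of xs' a b ys' x] 1 2 p True h' by auto
      show "b \<sqsubseteq> y" if "y \<in> set C \<union> set D"
        using that path_split(2)[of xs a b ys y] path_split(2)[of xs' a b ys' y] 1 2 p True h' by auto
    qed (use 1 2 True in auto)
  next
    case False
    then have "closed_segment (pos a) (pos b) \<inter> closed_segment (pos c) (pos d) \<subseteq>
        pos ` ({a, b} \<inter> {c, d})"
      using diagram 1 2 unfolding planar_diagram_def by blast
    moreover have "xpos C h = xpos D h"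
      using h by simp
    then have "(xpos C h, h) \<in> closed_segment (pos a) (pos b) \<inter> closed_segment (pos c) (pos d)"
      using 1(5) 2(5) by simp
    ultimately have "(xpos C h, h) \<in> pos ` ({a, b} \<inter> {c, d})"
      by blast
    then obtain e where e: "e \<in> {a, b} \<inter> {c, d}" "pos e = (xpos C h, h)"
      by (metis imageE)
    then have e': "e \<in> set C" "e \<in> set D" "height e = h"
      using 1 2 by auto
    show ?thesis
    proof (rule that[of e e])
      show "x \<sqsubseteq> e" if "x \<in> set C \<union> set D"
        using that path_le(1)[of C x e] path_le(1)[of D x e] e' p h' by auto
      show "e \<sqsubseteq> y" if "y \<in> set C \<union> set D"
        using that path_le(1)[of C e y] path_le(1)[of D e y] e' p h' by auto
    qed (use e' 1 p in \<open>auto simp: path_def\<close>)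
  qed
qed

text \<open>Any maximal chain through \<open>y\<close> can serve as the dividing line; one is fixed
  for each \<open>y\<close>.\<close>

definition chain_through :: "'a \<Rightarrow> 'a list"
  where "chain_through y = (SOME C. bounding C \<and> y \<in> set C)"

lemma chain_through:
  assumes "y \<in> carrier L"
  shows "bounding (chain_through y)" "y \<in> set (chain_through y)"
  using someI_ex[of "\<lambda>C. bounding C \<and> y \<in> set C"] bounding_through[of y y] assms
  by (auto simp: chain_through_def)

text \<open>Meant for incomparable elements: for these \<open>not_on_chain\<close> excludes
  equality, so the negation says that \<open>x\<close> is strictly to the right of the
  chain.\<close>

definition left_of :: "'a \<Rightarrow> 'a \<Rightarrow> bool"
  where "left_of x y \<longleftrightarrow> fst (pos x) < xpos (chain_through y) (height x)"

text \<open>A point of the polygonal line lies on an edge of \<open>C\<close>, and a vertex on an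
  edge is an end of it. So \<open>x\<close> would belong to \<open>C\<close> and be comparable with
  \<open>y\<close>.\<close>

lemma not_on_chain:
  assumes "x \<in> carrier L" "bounding C" "y \<in> set C" "\<not> x \<sqsubseteq> y" "\<not> y \<sqsubseteq> x"
  shows "fst (pos x) \<noteq> xpos C (height x)"
proof
  assume eq: "fst (pos x) = xpos C (height x)"
  have C: "path C" "C \<noteq> []" "hd C \<in> carrier L" "last C \<in> carrier L" "y \<in> carrier L"
    using assms by (auto simp: bounding_def path_def)
  have "hd C \<in> set C" "last C \<in> set C"
    using C by auto
  then have no: "x \<notin> set C"
    using path_le C assms by blast
  have le: "hd C \<sqsubseteq> x" "x \<sqsubseteq> last C"
    using assms by (auto simp: bounding_def)
  have "height (hd C) \<le> height x" "height x \<le> height (last C)"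
    using assms C by (auto simp: bounding_def intro!: height_mono)
  moreover have "height (hd C) < height (last C)"
    using path_le(1)[OF C(1), of "last C" "hd C"] C assms le no \<open>hd C \<in> set C\<close> \<open>last C \<in> set C\<close> antisym
    by (metis le_trans linorder_not_less)
  ultimately obtain xs a b ys where 1: "C = xs @ a # b # ys" "a \<prec> b"
      "(xpos C (height x), height x) \<in> closed_segment (pos a) (pos b)"
    using xpos_edge[OF assms(2) C(3,4)] by blast
  moreover have "(xpos C (height x), height x) = pos x"
    by (simp add: prod_eq_iff eq)
  ultimately have "pos x \<in> closed_segment (pos a) (pos b)"
    by simp
  then have "x \<in> {a, b}"
    using diagram 1(2) assms(1) unfolding planar_diagram_def by blast
  then show False
    using no 1 by auto
qed

text \<open>If both or neither relation held, the chains through \<open>x\<close> and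
  \<open>y\<close> would change sides between the two heights. Their common vertices
  \<open>a \<sqsubseteq> b\<close> from \<open>crossing\<close> would give
  \<open>x \<sqsubseteq> a \<sqsubseteq> b \<sqsubseteq> y\<close>. At equal heights both relations
  compare the same two abscissae.\<close>

lemma left_of_antisym:
  assumes "x \<in> carrier L" "y \<in> carrier L" "\<not> x \<sqsubseteq> y" "\<not> y \<sqsubseteq> x"
  shows "left_of x y \<noteq> left_of y x"
proof -
  have main: "(left_of x y \<noteq> left_of y x)"
    if x: "x \<in> carrier L" "y \<in> carrier L" "\<not> x \<sqsubseteq> y" "\<not> y \<sqsubseteq> x" "height x \<le> height y" for x y
  proof -
    let ?C = "chain_through y" and ?D = "chain_through x"
    note C = chain_through[OF x(2)] and D = chain_through[OF x(1)]
    have n: "fst (pos x) \<noteq> xpos ?C (height x)" "fst (pos y) \<noteq> xpos ?D (height y)"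
      using not_on_chain x C D by blast+
    have p: "xpos ?D (height x) = fst (pos x)" "xpos ?C (height y) = fst (pos y)"
      using C D xpos_vertex by (auto simp: bounding_def)
    show ?thesis
    proof (cases "height x = height y")
      case False
      then have lt: "height x < height y"
        using x by simp
      have mem: "x \<in> set ?C \<union> set ?D" "y \<in> set ?C \<union> set ?D"
        "x \<in> set ?D \<union> set ?C" "y \<in> set ?D \<union> set ?C"
        using C D by auto
      have car: "set ?C \<subseteq> carrier L"
        using C by (auto simp: bounding_def path_def)
      have "\<not> (xpos ?D (height x) < xpos ?C (height x) \<and> xpos ?C (height y) < xpos ?D (height y))"
        using crossing[OF D(1) C(1) x(1,2) lt] mem x car by (metis le_trans subsetD)
      moreover have "\<not> (xpos ?C (height x) < xpos ?D (height x) \<and> xpos ?D (height y) < xpos ?C (height y))"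
        using crossing[OF C(1) D(1) x(1,2) lt] mem x car by (metis le_trans subsetD)
      ultimately show ?thesis
        using n p unfolding left_of_def by auto
    qed (use p n in \<open>auto simp: left_of_def\<close>)
  qed
  show ?thesis
    using main[of x y] main[of y x] assms by linarith
qed

text \<open>If \<open>x\<close> and \<open>x'\<close> were on different sides, a chain through both
  would meet the chain of \<open>y\<close> in some \<open>a\<close> between \<open>x\<close> and
  \<open>x'\<close>. Since \<open>a\<close> is comparable with \<open>y\<close>, either
  \<open>x \<sqsubseteq> y\<close> or \<open>y \<sqsubseteq> x'\<close> would follow.\<close>

lemma left_of_mono:
  assumes "x \<in> carrier L" "x' \<in> carrier L" "y \<in> carrier L" "x \<sqsubseteq> x'"
    and "\<not> x \<sqsubseteq> y" "\<not> y \<sqsubseteq> x'"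
  shows "left_of x y \<longleftrightarrow> left_of x' y"
proof (cases "x = x'")
  case False
  have inc: "\<not> y \<sqsubseteq> x" "\<not> x' \<sqsubseteq> y"
    using assms le_trans by blast+
  let ?C = "chain_through y"
  note C = chain_through[OF assms(3)]
  obtain D where D: "bounding D" "x \<in> set D" "x' \<in> set D"
    using bounding_through assms by blast
  have n: "fst (pos x) \<noteq> xpos ?C (height x)" "fst (pos x') \<noteq> xpos ?C (height x')"
    using not_on_chain assms inc C by blast+
  have p: "xpos D (height x) = fst (pos x)" "xpos D (height x') = fst (pos x')"
    using D xpos_vertex by (auto simp: bounding_def)
  have car: "set ?C \<subseteq> carrier L"
    using C by (auto simp: bounding_def path_def)
  have pD: "path D" "path ?C"
    using D C by (auto simp: bounding_def)
  have lt: "height x < height x'"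
    using path_le(1)[OF pD(1) D(3,2)] height_mono assms False antisym by fastforce
  have mem: "x \<in> set ?C \<union> set D" "x' \<in> set ?C \<union> set D" "x \<in> set D \<union> set ?C" "x' \<in> set D \<union> set ?C"
    using D by auto
  have no: False if ab: "a \<in> set ?C" "b \<in> set ?C" "a \<sqsubseteq> b" "x \<sqsubseteq> a" "b \<sqsubseteq> x'" for a b
  proof -
    have "a \<in> carrier L" "b \<in> carrier L"
      using ab car by auto
    moreover have "a \<sqsubseteq> y \<or> y \<sqsubseteq> a"
      using path_le(2)[OF pD(2) ab(1) C(2)] .
    ultimately show False
      using ab assms le_trans by meson
  qed
  have "\<not> (xpos D (height x) < xpos ?C (height x) \<and> xpos ?C (height x') < xpos D (height x'))"
    using crossing[OF D(1) C(1) assms(1,2) lt] mem no by metis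
  moreover have "\<not> (xpos ?C (height x) < xpos D (height x) \<and> xpos D (height x') < xpos ?C (height x'))"
    using crossing[OF C(1) D(1) assms(1,2) lt] mem no by metis
  ultimately show ?thesis
    using n p unfolding left_of_def by auto
qed auto

end

section \<open>Coordinates\<close>

context finite_lattice
begin

lemma join_absorb:
  assumes "x \<in> carrier L" "y \<in> carrier L" "x \<sqsubseteq> y"
  shows "x \<squnion> y = y" "y \<squnion> x = y"
  using assms le_iff_meet by (auto simp: join_comm[of L y x])

lemma meet_absorb:
  assumes "x \<in> carrier L" "y \<in> carrier L" "x \<sqsubseteq> y"
  shows "x \<sqinter> y = x" "y \<sqinter> x = x"
  using assms le_iff_join by (auto simp: meet_comm[of L y x])

end

locale semimodular_lattice = finite_lattice L for L :: "'a gorder" (structure) +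
  assumes semimodular: "semimodular L"
begin

lemma cover_join:
  assumes "s \<prec> c" "s \<sqsubseteq> u" "u \<in> carrier L" "\<not> c \<sqsubseteq> u"
  shows "u \<prec> c \<squnion> u"
proof -
  have c: "s \<in> carrier L" "c \<in> carrier L"
    using assms coversD by auto
  have "s \<squnion> u = u"
    using assms c join_absorb by blast
  moreover have "u \<noteq> c \<squnion> u"
    using assms c join_left by metis
  ultimately show ?thesis
    using semimodular assms c unfolding semimodular_def by metis
qed

lemma covers_incomparable:
  assumes "v \<prec> a" "v \<prec> b" "a \<noteq> b"
  shows "\<not> a \<sqsubseteq> b" "a \<sqinter> b = v"
proof -
  note D = coversD[OF assms(1)] coversD[OF assms(2)]
  show "\<not> a \<sqsubseteq> b"
    using D assms by blast
  then have "a \<sqinter> b \<noteq> a"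
    using D meet_right by metis
  then show "a \<sqinter> b = v"
    using D by (meson meet_closed meet_le meet_left)
qed

end

text \<open>Nothing is assumed about joins: the coordinatewise maximum of two elements need not be
  the point of any element.\<close>

locale grid_lattice = finite_lattice L for L :: "'a gorder" (structure) +
  fixes l r :: "'a \<Rightarrow> nat"
  assumes le_iff: "x \<in> carrier L \<Longrightarrow> y \<in> carrier L \<Longrightarrow> x \<sqsubseteq> y \<longleftrightarrow> l x \<le> l y \<and> r x \<le> r y"
    and l_meet: "x \<in> carrier L \<Longrightarrow> y \<in> carrier L \<Longrightarrow> l (x \<sqinter> y) = min (l x) (l y)"
    and r_meet: "x \<in> carrier L \<Longrightarrow> y \<in> carrier L \<Longrightarrow> r (x \<sqinter> y) = min (r x) (r y)"
begin

lemma grid_swap: "grid_lattice L r l"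
  by unfold_locales (auto simp: le_iff l_meet r_meet)

lemma eqI: "x \<in> carrier L \<Longrightarrow> y \<in> carrier L \<Longrightarrow> l x = l y \<Longrightarrow> r x = r y \<Longrightarrow> x = y"
  by (intro antisym) (auto simp: le_iff)

end

context finite_lattice
begin

definition rank_in :: "'a set \<Rightarrow> 'a \<Rightarrow> nat"
  where "rank_in C x = card {c \<in> C. c \<sqsubseteq> x}"

lemma rank_in_mono:
  assumes "C \<subseteq> carrier L" "x \<in> carrier L" "y \<in> carrier L" "x \<sqsubseteq> y"
  shows "rank_in C x \<le> rank_in C y"
  unfolding rank_in_def using assms finite_carrier
  by (intro card_mono) (auto intro: le_trans finite_subset)

lemma chain_segments:
  assumes "C \<subseteq> carrier L" "\<And>a b. a \<in> C \<Longrightarrow> b \<in> C \<Longrightarrow> a \<sqsubseteq> b \<or> b \<sqsubseteq> a"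
    and "x \<in> carrier L" "y \<in> carrier L"
  shows "{c \<in> C. c \<sqsubseteq> x} \<subseteq> {c \<in> C. c \<sqsubseteq> y} \<or> {c \<in> C. c \<sqsubseteq> y} \<subseteq> {c \<in> C. c \<sqsubseteq> x}"
proof (rule ccontr)
  assume "\<not> ?thesis"
  then obtain a b where "a \<in> C" "b \<in> C" "a \<sqsubseteq> x" "\<not> a \<sqsubseteq> y" "b \<sqsubseteq> y" "\<not> b \<sqsubseteq> x"
    by blast
  then show False
    using assms le_trans by (meson subsetD)
qed

lemma rank_in_le:
  assumes "C \<subseteq> carrier L" "\<And>a b. a \<in> C \<Longrightarrow> b \<in> C \<Longrightarrow> a \<sqsubseteq> b \<or> b \<sqsubseteq> a"
    and "x \<in> carrier L" "y \<in> carrier L" "rank_in C x \<le> rank_in C y"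
  shows "{c \<in> C. c \<sqsubseteq> x} \<subseteq> {c \<in> C. c \<sqsubseteq> y}"
proof -
  have "finite {c \<in> C. c \<sqsubseteq> x}"
    using assms finite_carrier by (auto intro: finite_subset)
  then show ?thesis
    using chain_segments[OF assms(1-4)] assms(5)
      card_seteq[of "{c \<in> C. c \<sqsubseteq> x}" "{c \<in> C. c \<sqsubseteq> y}"] by (auto simp: rank_in_def)
qed

text \<open>The parts of a chain below \<open>x\<close> and below \<open>y\<close> are nested
  initial segments, and the part below the meet is their intersection, that is, the smaller
  one.\<close>

lemma rank_in_meet:
  assumes "C \<subseteq> carrier L" "\<And>a b. a \<in> C \<Longrightarrow> b \<in> C \<Longrightarrow> a \<sqsubseteq> b \<or> b \<sqsubseteq> a"
    and "x \<in> carrier L" "y \<in> carrier L"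
  shows "rank_in C (x \<sqinter> y) = min (rank_in C x) (rank_in C y)"
proof -
  have "c \<sqsubseteq> x \<sqinter> y \<longleftrightarrow> c \<sqsubseteq> x \<and> c \<sqsubseteq> y" if "c \<in> C" for c
    using that assms meet_le[of c x y] meet_left meet_right le_trans by (meson meet_closed subsetD)
  then have eq: "{c \<in> C. c \<sqsubseteq> x \<sqinter> y} = {c \<in> C. c \<sqsubseteq> x} \<inter> {c \<in> C. c \<sqsubseteq> y}"
    by blast
  have fin: "finite {c \<in> C. c \<sqsubseteq> x}" "finite {c \<in> C. c \<sqsubseteq> y}"
    using assms finite_carrier by (auto intro: finite_subset)
  from chain_segments[OF assms] show ?thesis
  proof
    assume "{c \<in> C. c \<sqsubseteq> x} \<subseteq> {c \<in> C. c \<sqsubseteq> y}"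
    then show ?thesis
      using card_mono[OF fin(2)] unfolding rank_in_def eq by (simp add: Int_absorb2 min_def)
  next
    assume "{c \<in> C. c \<sqsubseteq> y} \<subseteq> {c \<in> C. c \<sqsubseteq> x}"
    then show ?thesis
      using card_mono[OF fin(1), of "{c \<in> C. c \<sqsubseteq> y}"]
      unfolding rank_in_def eq by (simp add: Int_absorb1 min_def)
  qed
qed

text \<open>The witness \<open>b'\<close> is the unique lower cover of \<open>b\<close>; requiring
  it excludes the least element.\<close>

definition irreducibles :: "'a set"
  where "irreducibles =
    {b \<in> carrier L. \<exists>b'\<in>carrier L. b' \<sqsubset> b \<and> (\<forall>x\<in>carrier L. x \<sqsubset> b \<longrightarrow> x \<sqsubseteq> b')}"

text \<open>Descend from \<open>x\<close> as long as possible without getting below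
  \<open>y\<close>. At the end every proper lower element is below \<open>y\<close>, so the meet
  with \<open>y\<close> is the greatest of them.\<close>

lemma irreducible_separating:
  assumes "x \<in> carrier L" "y \<in> carrier L" "\<not> x \<sqsubseteq> y"
  obtains c where "c \<in> irreducibles" "c \<sqsubseteq> x" "\<not> c \<sqsubseteq> y"
proof -
  have "\<exists>c. c \<in> irreducibles \<and> c \<sqsubseteq> x \<and> \<not> c \<sqsubseteq> y"
    using assms
  proof (induction "card {z \<in> carrier L. z \<sqsubseteq> x}" arbitrary: x rule: less_induct)
    case less
    show ?case
    proof (cases "\<exists>z\<in>carrier L. z \<sqsubset> x \<and> \<not> z \<sqsubseteq> y")
      case True
      then obtain z where z: "z \<in> carrier L" "z \<sqsubseteq> x" "z \<noteq> x" "\<not> z \<sqsubseteq> y"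
        by (auto simp: less_iff)
      have "card {w \<in> carrier L. w \<sqsubseteq> z} < card {w \<in> carrier L. w \<sqsubseteq> x}"
        using finite_carrier z less.prems antisym
        by (intro psubset_card_mono) (auto intro: le_trans)
      then show ?thesis
        using less.hyps[of z] z less.prems unfolding irreducibles_def by (blast intro: le_trans)
    next
      case False
      have "x \<sqinter> y \<sqsubset> x"
        using less.prems meet_left meet_right by (metis less_iff)
      moreover have "z \<sqsubseteq> x \<sqinter> y" if "z \<in> carrier L" "z \<sqsubset> x" for z
        using False that less.prems by (auto intro!: meet_le simp: less_iff)
      ultimately have "x \<in> irreducibles"
        using less.prems by (auto simp: irreducibles_def)
      then show ?thesis
        using less.prems by auto
    qed
  qed
  then show ?thesis
    using that by blast
qed

text \<open>A failure of \<open>x \<sqsubseteq> y\<close> is witnessed by a join-irreducible element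
  below \<open>x\<close> and not below \<open>y\<close>; it lies in one of the chains, and the rank
  in that chain detects it.\<close>

lemma grid_of_two_chains:
  assumes "irreducibles = C \<union> D"
    and C: "\<And>a b. a \<in> C \<Longrightarrow> b \<in> C \<Longrightarrow> a \<sqsubseteq> b \<or> b \<sqsubseteq> a"
    and D: "\<And>a b. a \<in> D \<Longrightarrow> b \<in> D \<Longrightarrow> a \<sqsubseteq> b \<or> b \<sqsubseteq> a"
  shows "grid_lattice L (rank_in C) (rank_in D)"
proof
  have CD: "C \<subseteq> carrier L" "D \<subseteq> carrier L"
    using assms(1) by (auto simp: irreducibles_def)
  fix x y
  assume xy: "x \<in> carrier L" "y \<in> carrier L"
  show "rank_in C (x \<sqinter> y) = min (rank_in C x) (rank_in C y)"
    "rank_in D (x \<sqinter> y) = min (rank_in D x) (rank_in D y)"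
    using rank_in_meet CD C D xy by blast+
  show "x \<sqsubseteq> y \<longleftrightarrow> rank_in C x \<le> rank_in C y \<and> rank_in D x \<le> rank_in D y"
  proof
    assume le: "rank_in C x \<le> rank_in C y \<and> rank_in D x \<le> rank_in D y"
    have sub: "{c \<in> C. c \<sqsubseteq> x} \<subseteq> {c \<in> C. c \<sqsubseteq> y}" "{c \<in> D. c \<sqsubseteq> x} \<subseteq> {c \<in> D. c \<sqsubseteq> y}"
      using rank_in_le[OF CD(1) C xy] rank_in_le[OF CD(2) D xy] le by blast+
    show "x \<sqsubseteq> y"
    proof (rule ccontr)
      assume "\<not> x \<sqsubseteq> y"
      then obtain c where "c \<in> irreducibles" "c \<sqsubseteq> x" "\<not> c \<sqsubseteq> y"
        using irreducible_separating[OF xy] by metis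
      then show False
        using sub assms(1) by auto
    qed
  next
    assume "x \<sqsubseteq> y"
    then show "rank_in C x \<le> rank_in C y \<and> rank_in D x \<le> rank_in D y"
      using rank_in_mono[OF CD(1) xy] rank_in_mono[OF CD(2) xy] by simp
  qed
qed

end

locale sps = planar_lattice L pos + semimodular_lattice L
  for L :: "'a gorder" (structure) and pos +
  assumes slim: "slim L"
begin

text \<open>Otherwise \<open>a \<squnion> c\<close> would be incomparable with \<open>b\<close> and,
  by \<open>left_of_mono\<close>, on the same side of \<open>b\<close> as \<open>a\<close> and as
  \<open>c\<close>, which are on opposite sides.\<close>

lemma between_le_join:
  assumes "a \<in> carrier L" "b \<in> carrier L" "c \<in> carrier L" "\<not> a \<sqsubseteq> b" "\<not> c \<sqsubseteq> b"
    and "left_of a b" "left_of b c" "\<not> b \<sqsubseteq> c"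
  shows "b \<sqsubseteq> a \<squnion> c"
proof (rule ccontr)
  assume b: "\<not> b \<sqsubseteq> a \<squnion> c"
  have "left_of (a \<squnion> c) b"
    using left_of_mono[of a "a \<squnion> c" b] b assms join_left by auto
  moreover have "left_of c b \<longleftrightarrow> left_of (a \<squnion> c) b"
    using left_of_mono[of c "a \<squnion> c" b] b assms join_right by auto
  moreover have "left_of b c \<noteq> left_of c b"
    using left_of_antisym assms by blast
  ultimately show False
    using assms by blast
qed

text \<open>Semimodularity makes \<open>a \<squnion> c\<close> a cover of \<open>a\<close> and of
  \<open>c\<close>. Once \<open>b\<close> lies below it, all three pairwise joins coincide, and with
  \<open>v\<close> these elements form a copy of \<open>M3\<close>.\<close>

lemma no_M3:
  assumes "v \<prec> a" "v \<prec> b" "v \<prec> c" "a \<noteq> b" "b \<noteq> c" "a \<noteq> c" "b \<sqsubseteq> a \<squnion> c"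
  shows False
proof -
  note inc = covers_incomparable[OF assms(1,2,4)] covers_incomparable[OF assms(2,3,5)]
    covers_incomparable[OF assms(1,3,6)] covers_incomparable[OF assms(2,1)]
    covers_incomparable[OF assms(3,2)] covers_incomparable[OF assms(3,1)]
  note D = coversD[OF assms(1)] coversD[OF assms(2)] coversD[OF assms(3)]
  let ?i = "a \<squnion> c"
  have i: "?i \<in> carrier L" "a \<sqsubseteq> ?i" "c \<sqsubseteq> ?i"
    using D join_left join_right by auto
  have ca: "a \<prec> c \<squnion> a" "c \<prec> a \<squnion> c"
    using cover_join[OF assms(3) D(3)] cover_join[OF assms(1)] inc D assms by auto
  \<comment> \<open>\<open>a \<squnion> b\<close> lies strictly above \<open>a\<close> and below
    \<open>?i\<close>, which covers \<open>a\<close>; likewise \<open>b \<squnion> c\<close> above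
    \<open>c\<close>.\<close>
  have "a \<squnion> b \<sqsubseteq> ?i" "b \<squnion> c \<sqsubseteq> ?i"
    using i assms D by (auto intro!: join_le)
  moreover have "a \<squnion> b \<noteq> a" "b \<squnion> c \<noteq> c"
    using D inc assms(4-6) join_left[of b c] join_right[of a b] by metis+
  moreover have "a \<sqsubseteq> a \<squnion> b" "c \<sqsubseteq> b \<squnion> c" "a \<squnion> b \<in> carrier L" "b \<squnion> c \<in> carrier L"
    using D join_left join_right by auto
  ultimately have ab: "a \<squnion> b = ?i" and bc: "b \<squnion> c = ?i"
    using coversD(5)[OF ca(1), of "a \<squnion> b"] coversD(5)[OF ca(2), of "b \<squnion> c"]
    by (auto simp: join_comm[of L c a])
  have v: "v \<sqsubseteq> ?i" "v \<noteq> ?i" "a \<noteq> ?i" "b \<noteq> ?i" "c \<noteq> ?i"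
    using i D inc le_trans assms antisym by metis+
  define f where "f = case_m3 v a b c ?i"
  let ?H = "{v, a, b, c, ?i}"
  have le: "v \<sqsubseteq> v" "a \<sqsubseteq> a" "b \<sqsubseteq> b" "c \<sqsubseteq> c" "?i \<sqsubseteq> ?i" "\<not> a \<sqsubseteq> v" "\<not> b \<sqsubseteq> v" "\<not> c \<sqsubseteq> v"
    "\<not> ?i \<sqsubseteq> v" "\<not> ?i \<sqsubseteq> a" "\<not> ?i \<sqsubseteq> b" "\<not> ?i \<sqsubseteq> c"
    using D i v assms antisym by auto
  have vle: "v \<sqsubseteq> a" "v \<sqsubseteq> b" "v \<sqsubseteq> c"
    using D by auto
  have ba: "b \<squnion> a = ?i" and cb: "c \<squnion> b = ?i" and ca': "c \<squnion> a = ?i"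
    using ab bc join_comm[of L] by auto
  have ninc: "\<not> a \<sqsubseteq> b" "\<not> b \<sqsubseteq> c" "\<not> a \<sqsubseteq> c" "\<not> b \<sqsubseteq> a" "\<not> c \<sqsubseteq> b" "\<not> c \<sqsubseteq> a"
    using inc assms(4-6) by blast+
  have atoms: "x \<in> {a, b, c}" "y \<in> {a, b, c}" "x \<noteq> y"
    if "x \<in> ?H" "y \<in> ?H" "\<not> x \<sqsubseteq> y" "\<not> y \<sqsubseteq> x" for x y
  proof -
    have "v \<sqsubseteq> z \<and> z \<sqsubseteq> ?i" if "z \<in> ?H" for z
      using that vle i(2,3) v(1) assms(7) le(1,5) by blast
    then show "x \<in> {a, b, c}" "y \<in> {a, b, c}" "x \<noteq> y"
      using that le(1-5) by blast+
  qed
  have car: "?H \<subseteq> carrier L"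
    using D i by blast
  have joins: "x \<squnion> y = (if x \<sqsubseteq> y then y else if y \<sqsubseteq> x then x else ?i)" if "x \<in> ?H" "y \<in> ?H" for x y
  proof -
    have car: "x \<in> carrier L" "y \<in> carrier L"
      using that car by blast+
    have "x \<squnion> y = y" if "x \<sqsubseteq> y"
      using car that join_absorb by blast
    moreover have "x \<squnion> y = x" if "y \<sqsubseteq> x"
      using car that join_absorb by blast
    moreover have "x \<squnion> y = ?i" if "\<not> x \<sqsubseteq> y" "\<not> y \<sqsubseteq> x"
      using atoms[OF \<open>x \<in> ?H\<close> \<open>y \<in> ?H\<close> that] ab bc ba cb ca' by auto
    ultimately show ?thesis
      by auto
  qed
  have meets: "x \<sqinter> y = (if x \<sqsubseteq> y then x else if y \<sqsubseteq> x then y else v)" if "x \<in> ?H" "y \<in> ?H" for x y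
  proof -
    have car: "x \<in> carrier L" "y \<in> carrier L"
      using that car by blast+
    have "x \<sqinter> y = x" if "x \<sqsubseteq> y"
      using car that meet_absorb by blast
    moreover have "x \<sqinter> y = y" if "y \<sqsubseteq> x"
      using car that meet_absorb by blast
    moreover have "x \<sqinter> y = v" if "\<not> x \<sqsubseteq> y" "\<not> y \<sqsubseteq> x"
      using atoms[OF \<open>x \<in> ?H\<close> \<open>y \<in> ?H\<close> that] inc assms(4-6) by auto
    ultimately show ?thesis
      by auto
  qed
  have "sublattice ?H L"
    unfolding sublattice_def
  proof (intro conjI ballI)
    fix x y
    assume "x \<in> ?H" "y \<in> ?H"
    then show "x \<squnion> y \<in> ?H" "x \<sqinter> y \<in> ?H"
      by (simp_all only: joins meets) auto
  qed (use car in auto)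
  moreover have "order_iso f M3 (L\<lparr>carrier := ?H\<rparr>)"
    unfolding order_iso_def
  proof (intro conjI ballI)
    have "v \<noteq> a" "v \<noteq> b" "v \<noteq> c"
      using D by auto
    then have inj: "inj f"
      using v assms(4-6) by (intro injI) (auto simp: f_def split: m3.splits)
    have "range f = ?H"
    proof
      show "?H \<subseteq> range f"
        using rangeI[of f M3_bot] rangeI[of f M3_a] rangeI[of f M3_b] rangeI[of f M3_c]
          rangeI[of f M3_top] by (simp add: f_def)
    qed (auto simp: f_def split: m3.splits)
    then show "bij_betw f (carrier M3) (carrier (L\<lparr>carrier := ?H\<rparr>))"
      using inj by (simp add: bij_betw_def M3_def)
    show "x \<sqsubseteq>\<^bsub>M3\<^esub> y \<longleftrightarrow> f x \<sqsubseteq>\<^bsub>L\<lparr>carrier := ?H\<rparr>\<^esub> f y" for x y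
      by (cases x; cases y) (simp_all add: f_def M3_def le vle i v(1) ninc assms(7))
  qed
  ultimately show False
    using slim unfolding slim_def by blast
qed

text \<open>On three covers \<open>left_of\<close> is a tournament, and every tournament on three
  vertices has a directed path through all of them; its middle vertex is then below the join of the
  outer two.\<close>

lemma at_most_two_covers:
  assumes "v \<prec> a" "v \<prec> b" "v \<prec> c" "a \<noteq> b" "b \<noteq> c" "a \<noteq> c"
  shows False
proof -
  note cov = assms(1-3)
  have middle: False if "v \<prec> x" "v \<prec> y" "v \<prec> z" "x \<noteq> y" "y \<noteq> z" "x \<noteq> z" "left_of x y" "left_of y z"
    for x y z
    using that no_M3 between_le_join[of x y z] covers_incomparable(1) coversD by metis
  have "left_of x y \<noteq> left_of y x" if "v \<prec> x" "v \<prec> y" "x \<noteq> y" for x y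
    using left_of_antisym covers_incomparable(1) that coversD by metis
  then have "left_of a b \<noteq> left_of b a" "left_of b c \<noteq> left_of c b" "left_of a c \<noteq> left_of c a"
    using assms by blast+
  then show False
    using middle assms by metis
qed

text \<open>A cover \<open>c1\<close> of \<open>b' \<sqinter> c\<close> below \<open>c\<close> gives the cover \<open>c1 \<squnion> b'\<close> of \<open>b'\<close> on the same side of
  \<open>b\<close> as \<open>c\<close>.  Elements on both sides of \<open>b\<close> would thus yield three covers of \<open>b'\<close>.\<close>

lemma irreducible_side:
  assumes "b \<in> irreducibles" "c \<in> carrier L" "\<not> c \<sqsubseteq> b" "\<not> b \<sqsubseteq> c"
    and "d \<in> carrier L" "\<not> d \<sqsubseteq> b" "\<not> b \<sqsubseteq> d"
  shows "left_of c b \<longleftrightarrow> left_of d b"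
proof -
  obtain b' where b: "b \<in> carrier L" "b' \<in> carrier L" "b' \<sqsubseteq> b" "b' \<noteq> b"
    "\<And>x. x \<in> carrier L \<Longrightarrow> x \<sqsubseteq> b \<Longrightarrow> x \<noteq> b \<Longrightarrow> x \<sqsubseteq> b'"
    using assms by (auto simp: irreducibles_def less_iff)
  have cov: "b' \<prec> b"
    using b antisym unfolding covers_iff by blast
  have side: "\<exists>w. b' \<prec> w \<and> w \<noteq> b \<and> (left_of c b \<longleftrightarrow> left_of w b)"
    if c: "c \<in> carrier L" "\<not> c \<sqsubseteq> b" "\<not> b \<sqsubseteq> c" for c
  proof -
    have m: "b' \<sqinter> c \<in> carrier L" "b' \<sqinter> c \<sqsubseteq> c" "b' \<sqinter> c \<sqsubseteq> b'"
      using b c meet_left meet_right by auto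
    then have "b' \<sqinter> c \<noteq> c"
      using b c le_trans by metis
    then obtain c1 where c1: "b' \<sqinter> c \<prec> c1" "c1 \<sqsubseteq> c"
      using cover_above[OF m(1) c(1) m(2)] by blast
    note D = coversD[OF c1(1)]
    \<comment> \<open>Below \<open>b'\<close> the element \<open>c1\<close> would lie below
      \<open>b' \<sqinter> c\<close>, which it covers.\<close>
    have n1: "\<not> c1 \<sqsubseteq> b'"
      using D c c1 b m meet_le antisym by metis
    have n2: "\<not> c1 \<sqsubseteq> b"
      using n1 D c1 b c by metis
    have w: "b' \<prec> c1 \<squnion> b'"
      using cover_join[OF c1(1) m(3)] b n1 by blast
    have le: "c1 \<sqsubseteq> c1 \<squnion> b'"
      using join_left D b by blast
    have wb: "c1 \<squnion> b' \<noteq> b"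
      using le n2 by metis
    have "\<not> b \<sqsubseteq> c1 \<squnion> b'"
      using covers_incomparable(1)[OF cov w] wb by metis
    then have "left_of c1 b \<longleftrightarrow> left_of (c1 \<squnion> b') b"
      using left_of_mono[of c1 "c1 \<squnion> b'" b] le n2 D b by auto
    moreover have "left_of c1 b \<longleftrightarrow> left_of c b"
      using left_of_mono[of c1 c b] n2 D c c1 b by auto
    ultimately show ?thesis
      using w wb by blast
  qed
  obtain w w' where "b' \<prec> w" "w \<noteq> b" "left_of c b \<longleftrightarrow> left_of w b"
      "b' \<prec> w'" "w' \<noteq> b" "left_of d b \<longleftrightarrow> left_of w' b"
    using side assms by metis
  moreover have "w = w'"
    using at_most_two_covers cov calculation by metis
  ultimately show ?thesis
    by blast
qed

lemma coordinates: "\<exists>l r. grid_lattice L l r"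
proof -
  define C where "C = {b \<in> irreducibles. \<forall>x\<in>carrier L. \<not> x \<sqsubseteq> b \<longrightarrow> \<not> b \<sqsubseteq> x \<longrightarrow> left_of x b}"
  define D where "D = {b \<in> irreducibles. \<forall>x\<in>carrier L. \<not> x \<sqsubseteq> b \<longrightarrow> \<not> b \<sqsubseteq> x \<longrightarrow> \<not> left_of x b}"
  have car: "irreducibles \<subseteq> carrier L"
    by (auto simp: irreducibles_def)
  have "irreducibles = C \<union> D"
  proof (intro equalityI subsetI)
    fix b
    assume b: "b \<in> irreducibles"
    show "b \<in> C \<union> D"
    proof (rule ccontr)
      assume "b \<notin> C \<union> D"
      then obtain x y where "x \<in> carrier L" "\<not> x \<sqsubseteq> b" "\<not> b \<sqsubseteq> x" "\<not> left_of x b"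
          "y \<in> carrier L" "\<not> y \<sqsubseteq> b" "\<not> b \<sqsubseteq> y" "left_of y b"
        using b by (auto simp: C_def D_def)
      then show False
        using irreducible_side[OF b, of x y] by simp
    qed
  qed (auto simp: C_def D_def)
  \<comment> \<open>Two incomparable members of \<open>C\<close> would each be to the left of the
    other; in \<open>D\<close>, neither would be.\<close>
  moreover have "a \<sqsubseteq> b \<or> b \<sqsubseteq> a" if "a \<in> C" "b \<in> C" for a b
  proof (rule ccontr)
    assume "\<not> ?thesis"
    moreover have "a \<in> carrier L" "b \<in> carrier L"
      using that car by (auto simp: C_def)
    ultimately show False
      using that left_of_antisym[of a b] by (auto simp: C_def)
  qed
  moreover have "a \<sqsubseteq> b \<or> b \<sqsubseteq> a" if "a \<in> D" "b \<in> D" for a b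
  proof (rule ccontr)
    assume "\<not> ?thesis"
    moreover have "a \<in> carrier L" "b \<in> carrier L"
      using that car by (auto simp: D_def)
    ultimately show False
      using that left_of_antisym[of a b] by (auto simp: D_def)
  qed
  ultimately show ?thesis
    using grid_of_two_chains by blast
qed

end

section \<open>The fork extension in coordinates\<close>

locale semimodular_grid = grid_lattice L l r + semimodular_lattice L
  for L :: "'a gorder" (structure) and l r

lemma (in semimodular_grid) swap: "semimodular_grid L r l"
  by (intro semimodular_grid.intro grid_swap semimodular_lattice_axioms)

definition fork_index :: "'a gorder \<Rightarrow> 'a \<Rightarrow> 'a \<Rightarrow> nat set"
  where "fork_index L a v = {k. \<exists>x y. fork_side L a v k x y}"

definition fork_x :: "'a gorder \<Rightarrow> 'a \<Rightarrow> 'a \<Rightarrow> nat \<Rightarrow> 'a"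
  where "fork_x L a v k = (THE x. \<exists>y. fork_side L a v k x y)"

definition fork_y :: "'a gorder \<Rightarrow> 'a \<Rightarrow> 'a \<Rightarrow> nat \<Rightarrow> 'a"
  where "fork_y L a v k = (THE y. \<exists>x. fork_side L a v k x y)"

text \<open>The descending sequence on the side where \<open>l\<close> is large: \<open>y\<^sub>k\<close> stays in the column of \<open>v\<close>.\<close>

locale descent = semimodular_grid L l r
  for L :: "'a gorder" (structure) and l r and a v :: 'a +
  assumes va: "v \<prec> a" and r_va: "r v = r a"
begin

lemma covers_lr:
  assumes "y \<prec> x"
  shows "l y \<le> l x" "r y \<le> r x" "l y < l x \<or> r y < r x"
  using coversD[OF assms] le_iff[of y x] eqI[of y x] by fastforce+

text \<open>A step satisfies \<open>r x' \<le> r x = r y\<close> and not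
  \<open>x' \<sqsubseteq> y\<close>, so \<open>l x'\<close> exceeds \<open>l y = l v\<close>. The
  minimum formulas for \<open>x' \<sqinter> y\<close> then keep the column \<open>l v\<close> and
  give it the row of \<open>x'\<close>.\<close>

lemma fork_side_props:
  assumes "fork_side L a v k x y"
  shows "1 \<le> k \<and> y \<prec> x \<and> l y = l v \<and> r y = r x \<and> l v < l x \<and> x \<sqsubseteq> a \<and> y \<sqsubseteq> v"
  using assms
proof induction
  case start
  then show ?case
    using va r_va covers_lr[OF va] coversD[OF va] by auto
next
  case (step k x y x')
  have sq: "x' \<noteq> y" "x' \<sqinter> y \<prec> x'" "x' \<prec> x" "x' \<sqinter> y \<prec> y" "y \<prec> x"
    using step by (auto simp: covering_square_def)
  have car: "x \<in> carrier L" "y \<in> carrier L" "x' \<in> carrier L" "a \<in> carrier L" "v \<in> carrier L"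
    using sq coversD va by blast+
  have "\<not> x' \<sqsubseteq> y"
    using sq meet_absorb(1)[of x' y] car coversD(4) by metis
  then have lt: "l y < l x'"
    using car le_iff covers_lr[OF sq(3)] step by auto
  moreover have "x' \<sqsubseteq> a"
    using step coversD(3)[OF sq(3)] car le_trans by meson
  moreover have "x' \<sqinter> y \<sqsubseteq> v"
    using step coversD(1,3)[OF sq(4)] car le_trans by meson
  ultimately show ?case
    using sq step car l_meet[of x' y] r_meet[of x' y] covers_lr[OF sq(3)] by auto
qed

lemma fork_side_step:
  assumes "fork_side L a v k x y" "covering_square L (x' \<sqinter> y) x' y x"
  shows "fork_side L a v (Suc k) x' (x' \<sqinter> y)"
proof -
  have "x' \<in> carrier L"
    using assms(2) coversD(2) unfolding covering_square_def by blast
  then show ?thesis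
    using fork_side.step assms by metis
qed

lemma fork_side_mono:
  assumes "fork_side L a v k x y" "covering_square L (x' \<sqinter> y) x' y x"
  shows "x' \<sqsubseteq> x" "r x' < r x"
proof -
  note s = fork_side_step[OF assms]
  have sq: "x' \<noteq> y" "x' \<prec> x" "x' \<sqinter> y \<prec> y"
    using assms by (auto simp: covering_square_def)
  show "x' \<sqsubseteq> x"
    using sq coversD by blast
  show "r x' < r x"
    using fork_side_props[OF s] fork_side_props[OF assms(1)] covers_lr[OF sq(3)] by auto
qed

text \<open>The two meets with \<open>y\<close> lie in one column, hence are comparable, and both
  are lower covers of \<open>y\<close>, hence equal. Now \<open>x'\<close> and \<open>x''\<close>
  share a row, and the same argument applies to them as lower covers of \<open>x\<close>.\<close>

lemma step_unique:
  assumes "fork_side L a v k x y" "covering_square L (x' \<sqinter> y) x' y x"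
    and "covering_square L (x'' \<sqinter> y) x'' y x"
  shows "x' = x''"
proof -
  note s = fork_side_step[OF assms(1,2)] fork_side_step[OF assms(1,3)]
  note p = fork_side_props[OF s(1)] fork_side_props[OF s(2)]
  have sq: "x' \<prec> x" "x'' \<prec> x" "x' \<sqinter> y \<prec> y" "x'' \<sqinter> y \<prec> y"
    using assms by (auto simp: covering_square_def)
  have car: "x' \<in> carrier L" "x'' \<in> carrier L" "x' \<sqinter> y \<in> carrier L" "x'' \<sqinter> y \<in> carrier L"
    "y \<in> carrier L" "x \<in> carrier L"
    using sq coversD by blast+
  have "x' \<sqinter> y \<sqsubseteq> x'' \<sqinter> y \<or> x'' \<sqinter> y \<sqsubseteq> x' \<sqinter> y"
    using p car le_iff[OF car(3,4)] le_iff[OF car(4,3)] by auto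
  then have "x' \<sqinter> y = x'' \<sqinter> y"
    using coversD(3-5)[OF sq(3)] coversD(3-5)[OF sq(4)] car by metis
  then have "r x' = r x''"
    using p by metis
  then have "x' \<sqsubseteq> x'' \<or> x'' \<sqsubseteq> x'"
    using car le_iff[of x' x''] le_iff[of x'' x'] by auto
  then show ?thesis
    using coversD(3-5)[OF sq(1)] coversD(3-5)[OF sq(2)] car by metis
qed

lemma fork_side_unique:
  "fork_side L a v k x y \<Longrightarrow> fork_side L a v k x' y' \<Longrightarrow> x' = x \<and> y' = y"
proof (induction arbitrary: x' y' rule: fork_side.induct)
  case start
  then show ?case
    \<comment> \<open>The rule \<open>step\<close> would need a predecessor of index 0, but indices
      start at 1.\<close>
    using fork_side_props by (cases rule: fork_side.cases) force+
next
  case (step k x y z)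
  note s = step(1) and sq = step(3) and IH = step(4)
  from step(5) obtain x2 y2 x3 where "fork_side L a v k x2 y2"
      "covering_square L (x3 \<sqinter> y2) x3 y2 x2" "x' = x3" "y' = x3 \<sqinter> y2"
    by (cases rule: fork_side.cases) (use fork_side_props[OF s] in auto)
  moreover from this have "x2 = x" "y2 = y"
    using IH by auto
  ultimately show ?case
    using step_unique[OF s, of z x3] sq by auto
qed

abbreviation "idx \<equiv> fork_index L a v"
abbreviation "xs \<equiv> fork_x L a v"
abbreviation "ys \<equiv> fork_y L a v"

lemma fork_side_iff: "fork_side L a v k x y \<longleftrightarrow> k \<in> idx \<and> x = xs k \<and> y = ys k"
proof
  assume s: "fork_side L a v k x y"
  have "xs k = x" "ys k = y"
    unfolding fork_x_def fork_y_def using s fork_side_unique[OF s] by (blast intro: the_equality)+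
  then show "k \<in> idx \<and> x = xs k \<and> y = ys k"
    using s by (auto simp: fork_index_def)
next
  assume k: "k \<in> idx \<and> x = xs k \<and> y = ys k"
  then obtain x' y' where s: "fork_side L a v k x' y'"
    by (auto simp: fork_index_def)
  have "xs k = x'" "ys k = y'"
    unfolding fork_x_def fork_y_def using s fork_side_unique[OF s] by (blast intro: the_equality)+
  then show "fork_side L a v k x y"
    using s k by simp
qed

lemma start_index: "1 \<in> idx" "xs 1 = a" "ys 1 = v"
  using fork_side.start[of L a v] fork_side_iff[of 1 a v] by metis+

lemma index_props:
  assumes "k \<in> idx"
  shows "1 \<le> k" "ys k \<prec> xs k" "l (ys k) = l v" "r (ys k) = r (xs k)" "l v < l (xs k)"
    "xs k \<sqsubseteq> a" "ys k \<sqsubseteq> v" "xs k \<in> carrier L" "ys k \<in> carrier L"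
  using fork_side_props[of k "xs k" "ys k"] assms coversD unfolding fork_side_iff by blast+

lemma index_bounds:
  assumes "k \<in> idx"
  shows "r (xs k) \<le> r v" "l (xs k) \<le> l a"
  using index_props[OF assms] coversD[OF va] le_iff[of "xs k" a] r_va by auto

lemma index_pred:
  assumes "Suc k \<in> idx" "1 \<le> k"
  shows "k \<in> idx" "xs (Suc k) \<sqsubseteq> xs k" "r (xs (Suc k)) < r (xs k)"
proof -
  have "fork_side L a v (Suc k) (xs (Suc k)) (ys (Suc k))"
    using assms by (simp add: fork_side_iff)
  then obtain x y where s: "fork_side L a v k x y"
      "covering_square L (xs (Suc k) \<sqinter> y) (xs (Suc k)) y x"
    using assms(2) by (cases rule: fork_side.cases) auto
  then show "k \<in> idx" "xs (Suc k) \<sqsubseteq> xs k" "r (xs (Suc k)) < r (xs k)"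
    using fork_side_mono[OF s] unfolding fork_side_iff by auto
qed

lemma index_downward: "j \<in> idx \<Longrightarrow> 1 \<le> k \<Longrightarrow> k \<le> j \<Longrightarrow> k \<in> idx"
proof (induction j)
  case (Suc j)
  show ?case
  proof (cases "k = Suc j")
    case False
    then show ?thesis
      using Suc index_pred(1)[of j] by auto
  qed (use Suc in simp)
qed simp

lemma index_less: "j \<in> idx \<Longrightarrow> 1 \<le> k \<Longrightarrow> k < j \<Longrightarrow> xs j \<sqsubseteq> xs k \<and> r (xs j) < r (xs k)"
proof (induction j)
  case (Suc j)
  have j: "j \<in> idx"
    using Suc.prems by (intro index_downward[OF Suc.prems(1)]) auto
  note p = index_pred[OF Suc.prems(1)] index_props(8)[OF Suc.prems(1)] index_props(8)[OF j]
    index_props(8)[OF index_downward[OF j Suc.prems(2)]]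
  show ?case
  proof (cases "k = j")
    case False
    then have "xs j \<sqsubseteq> xs k \<and> r (xs j) < r (xs k)"
      using Suc j by simp
    then show ?thesis
      using p Suc.prems False le_trans[of "xs (Suc j)" "xs j" "xs k"] by auto
  qed (use p Suc.prems in auto)
qed simp

lemma index_order:
  assumes "j \<in> idx" "k \<in> idx"
  shows "r (xs j) \<le> r (xs k) \<longleftrightarrow> k \<le> j" "k \<le> j \<Longrightarrow> xs j \<sqsubseteq> xs k"
  using index_less[of j k] index_less[of k j] assms
    index_props(1)[OF assms(1)] index_props(1)[OF assms(2)] index_props(8)[OF assms(1)]
  by (cases j k rule: linorder_cases; simp)+

lemma finite_index: "finite idx"
proof (rule finite_imageD)
  have "(\<lambda>k. r (xs k)) ` idx \<subseteq> {..r v}"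
    using index_bounds(1) by blast
  then show "finite ((\<lambda>k. r (xs k)) ` idx)"
    by (rule finite_subset) simp
  show "inj_on (\<lambda>k. r (xs k)) idx"
  proof (rule inj_onI)
    fix j k
    assume "j \<in> idx" "k \<in> idx" "r (xs j) = r (xs k)"
    then show "j = k"
      using index_order(1)[of j k] index_order(1)[of k j] by linarith
  qed
qed

text \<open>The sequence cannot stop while some element beyond the column of \<open>v\<close> lies
  strictly below \<open>xs k\<close>: a covering square is built there, and its new corner reaches
  at least the row of that element.\<close>

lemma continues:
  assumes "k \<in> idx" "q \<in> carrier L" "q \<sqsubseteq> xs k" "q \<noteq> xs k" "l v < l q"
  shows "Suc k \<in> idx" "r q \<le> r (xs (Suc k))"
proof -
  define x y where "x = xs k" "y = ys k"
  have xy: "y \<prec> x" "l y = l v" "r y = r x" "l v < l x"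
    using index_props[OF assms(1)] by (auto simp: x_y_def)
  have car: "x \<in> carrier L" "y \<in> carrier L"
    using xy coversD by blast+
  \<comment> \<open>\<open>p\<close> is only a lower cover of \<open>x\<close>; its meet with
    \<open>y\<close> need not be a lower cover of \<open>y\<close>, so \<open>p\<close> itself may
    fail to be the new corner.\<close>
  obtain p where p: "q \<sqsubseteq> p" "p \<prec> x"
    using cover_below[OF assms(2) car(1)] assms by (auto simp: x_y_def)
  have pc: "p \<in> carrier L" "l v < l p" "r q \<le> r p"
    using p coversD assms le_iff[of q p] by auto
  have npy: "p \<noteq> y"
    using pc xy by auto
  have "\<not> y \<sqsubseteq> p"
    using coversD[OF xy(1)] coversD[OF p(2)] npy by metis
  then have rp: "r p < r y"
    using le_iff car pc xy by auto
  have py: "p \<sqinter> y \<in> carrier L" "l (p \<sqinter> y) = l v" "r (p \<sqinter> y) = r p" "p \<sqinter> y \<sqsubseteq> p"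
    using l_meet[of p y] r_meet[of p y] meet_left pc car xy rp by auto
  \<comment> \<open>The elements of the column of \<open>v\<close> strictly below \<open>y\<close>
    form a chain; its top \<open>u\<close> is a lower cover of \<open>y\<close> and becomes the
    bottom of the square.\<close>
  define U where "U = {u \<in> carrier L. l u = l v \<and> r u < r y}"
  have fU: "finite U" "U \<noteq> {}"
    using finite_carrier py rp by (auto simp: U_def)
  have "Max (r ` U) \<in> r ` U"
    using fU by (intro Max_in) auto
  then obtain u where u: "u \<in> U" "r u = Max (r ` U)"
    by auto
  then have u_max: "r w \<le> r u" if "w \<in> U" for w
    using that fU by simp
  have uc: "u \<in> carrier L" "l u = l v" "r u < r y"
    using u by (auto simp: U_def)
  have cov: "u \<prec> y"
    unfolding covers_iff
  proof (intro conjI ballI impI)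
    fix z
    assume z: "z \<in> carrier L" "u \<sqsubseteq> z \<and> z \<sqsubseteq> y"
    then have "l z = l v" "r u \<le> r z" "r z \<le> r y"
      using le_iff[of u z] le_iff[of z y] uc car xy by auto
    then show "z = u \<or> z = y"
      using u_max[of z] z uc car xy eqI[of z u] eqI[of z y] by (cases "r z = r y") (auto simp: U_def)
  qed (use uc car xy le_iff in auto)
  have pu: "p \<sqinter> y \<sqsubseteq> u"
    using u_max[of "p \<sqinter> y"] py rp uc by (auto simp: U_def le_iff)
  have "p \<sqinter> y \<noteq> p"
    using py pc by auto
  \<comment> \<open>A first step from \<open>p \<sqinter> y\<close> towards \<open>p\<close> leaves
    the ideal of \<open>y\<close>. Semimodularity lifts this cover along the column to the cover
    \<open>c \<squnion> u\<close> of \<open>u\<close>.\<close>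
  then obtain c where c: "p \<sqinter> y \<prec> c" "c \<sqsubseteq> p"
    using cover_above[OF py(1) pc(1) py(4)] by auto
  note cD = coversD[OF c(1)]
  have ncy: "\<not> c \<sqsubseteq> y"
  proof
    assume "c \<sqsubseteq> y"
    then have "c \<sqsubseteq> p \<sqinter> y"
      using c cD pc car by (intro meet_le) auto
    then show False
      using cD antisym by metis
  qed
  have uy: "u \<sqsubseteq> y" "u \<noteq> y"
    using coversD[OF cov] by auto
  have ncu: "\<not> c \<sqsubseteq> u"
    using ncy uy cD uc car le_trans by blast
  define x' where "x' = c \<squnion> u"
  have ux': "u \<prec> x'"
    unfolding x'_def using cover_join[OF c(1) pu uc(1) ncu] .
  note x'D = coversD[OF ux']
  have cx': "c \<sqsubseteq> x'"
    using join_left cD uc by (auto simp: x'_def)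
  have x'x: "x' \<sqsubseteq> x"
    unfolding x'_def
  proof (rule join_le)
    show "c \<sqsubseteq> x"
      using le_trans[OF c(2) coversD(3)[OF p(2)]] cD pc car by blast
    show "u \<sqsubseteq> x"
      using le_trans[OF uy(1) coversD(3)[OF xy(1)]] uc car by blast
  qed (use cD uc car in auto)
  have nyx': "\<not> y \<sqsubseteq> x'"
    using x'D(5)[OF car(2)] uy cx' ncy by metis
  have "x' \<sqinter> y \<noteq> y"
    using nyx' meet_left[of x' y] x'D car by metis
  then have meet: "x' \<sqinter> y = u"
    using coversD(5)[OF cov, of "x' \<sqinter> y"] meet_right[of x' y] meet_le[of u x' y] x'D car uy by auto
  have yj: "y \<prec> x' \<squnion> y"
    using cover_join[OF ux' uy(1) car(2)] ncy cx' x'D cD car le_trans by blast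
  have join: "x' \<squnion> y = x"
    using coversD(5)[OF xy(1), of "x' \<squnion> y"] coversD(2-4)[OF yj]
      join_le[OF x'x coversD(3)[OF xy(1)] x'D(2)] car by auto
  have "x' \<prec> y \<squnion> x'"
    using cover_join[OF cov x'D(3) x'D(2) nyx'] .
  then have x'cov: "x' \<prec> x"
    using join join_comm[of L x' y] by simp
  have "covering_square L (x' \<sqinter> y) x' y x"
    unfolding covering_square_def using meet join ux' x'cov cov xy nyx' x'D by auto
  moreover have "fork_side L a v k x y"
    using assms(1) by (simp add: fork_side_iff x_y_def)
  ultimately have s: "fork_side L a v (Suc k) x' (x' \<sqinter> y)"
    using x'D by (intro fork_side.step)
  then show "Suc k \<in> idx"
    by (simp add: fork_side_iff)
  have "r p \<le> r u"
    using u_max[of "p \<sqinter> y"] py rp by (auto simp: U_def)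
  also have "r u \<le> r x'"
    using covers_lr[OF ux'] by simp
  finally show "r q \<le> r (xs (Suc k))"
    using s pc by (auto simp: fork_side_iff)
qed

text \<open>Take the last \<open>k\<close> whose row is still at least the required minimum. If
  \<open>q \<sqinter> xs k\<close> were strictly below \<open>xs k\<close>, \<open>continues\<close>
  would produce a later such index. This provides the new element that serves as meet of
  \<open>q\<close> with \<open>t\<close> or with some \<open>z\<close>.\<close>

lemma reach:
  assumes "q \<in> carrier L" "l v < l q"
  obtains k where "k \<in> idx" "xs k \<sqsubseteq> q" "r (xs k) = min (r q) (r v)"
proof -
  have va': "a \<in> carrier L" "v \<in> carrier L" "l v < l a"
    using coversD[OF va] covers_lr[OF va] r_va by auto
  define J where "J = {k \<in> idx. min (r q) (r v) \<le> r (xs k)}"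
  have J: "finite J" "J \<noteq> {}"
    using finite_index start_index r_va by (auto simp: J_def)
  define k where "k = Max J"
  have k: "k \<in> idx" "min (r q) (r v) \<le> r (xs k)" "\<And>j. j \<in> J \<Longrightarrow> j \<le> k"
    using Max_in[OF J] Max_ge[OF J(1)] by (auto simp: k_def J_def)
  note p = index_props[OF k(1)] index_bounds[OF k(1)]
  let ?q = "q \<sqinter> xs k"
  have q: "?q \<in> carrier L" "l v < l ?q" "r ?q = min (r q) (r v)" "?q \<sqsubseteq> xs k" "?q \<sqsubseteq> q"
    using assms p k l_meet[of q "xs k"] r_meet[of q "xs k"] meet_left meet_right by auto
  have "?q = xs k"
  proof (rule ccontr)
    assume n: "?q \<noteq> xs k"
    have "Suc k \<in> J"
      using continues[OF k(1) q(1,4) n q(2)] q(3) by (auto simp: J_def)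
    then show False
      using k(3) by fastforce
  qed
  then show ?thesis
    using that k q by metis
qed

text \<open>So \<open>xs k\<close> is the least old element beyond the column of \<open>v\<close>
  and not below row \<open>r (xs k)\<close>, that is, the least one above the new element
  \<open>z_k\<close>.\<close>

lemma above_new:
  assumes "k \<in> idx" "q \<in> carrier L" "l v < l q" "r (xs k) \<le> r q"
  shows "xs k \<sqsubseteq> q"
proof -
  obtain j where j: "j \<in> idx" "xs j \<sqsubseteq> q" "r (xs j) = min (r q) (r v)"
    using reach assms by metis
  have "j \<le> k"
    using index_order(1)[OF assms(1) j(1)] j assms index_bounds[OF assms(1)] by simp
  then show ?thesis
    using index_order(2)[OF assms(1) j(1)] j assms index_props(8) le_trans by meson
qed

end

section \<open>The fork as a lattice given by coordinates\<close>

lemma grid_latticeI: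
  fixes K :: "'b gorder" (structure)
  assumes fin: "finite (carrier K)" and eq: "(.=) = (=)"
    and le: "\<And>x y. x \<in> carrier K \<Longrightarrow> y \<in> carrier K \<Longrightarrow> x \<sqsubseteq> y \<longleftrightarrow> X x \<le> X y \<and> Y x \<le> (Y y :: nat)"
    and inj: "\<And>x y. x \<in> carrier K \<Longrightarrow> y \<in> carrier K \<Longrightarrow> X x = (X y :: nat) \<Longrightarrow> Y x = Y y \<Longrightarrow> x = y"
    and meet: "\<And>x y. x \<in> carrier K \<Longrightarrow> y \<in> carrier K \<Longrightarrow>
      \<exists>m\<in>carrier K. X m = min (X x) (X y) \<and> Y m = min (Y x) (Y y)"
    and top: "c \<in> carrier K" "\<And>x. x \<in> carrier K \<Longrightarrow> x \<sqsubseteq> c"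
  shows "grid_lattice K X Y"
proof -
  interpret partial_order K
    using inj by unfold_locales (auto simp: eq le)
  have glb: "greatest K m (Lower K {x, y})"
    if "x \<in> carrier K" "y \<in> carrier K" "m \<in> carrier K" "X m = min (X x) (X y)" "Y m = min (Y x) (Y y)"
    for x y m
    using that by (auto simp: greatest_def Lower_def le)
  have lub: "\<exists>s. least K s (Upper K {x, y})" if xy: "x \<in> carrier K" "y \<in> carrier K" for x y
  proof -
    define U where "U = Upper K {x, y}"
    have U: "finite U" "U \<noteq> {}"
      using top xy finite_subset[OF _ fin] by (auto simp: U_def Upper_def)
    \<comment> \<open>An upper bound with least coordinate sum is the least upper bound: its meet
      with any other upper bound is an upper bound whose sum cannot be smaller.\<close>
    define s where "s = arg_min_on (\<lambda>u. X u + Y u) U"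
    have s: "s \<in> U" "\<And>u. u \<in> U \<Longrightarrow> X s + Y s \<le> X u + Y u"
      using arg_min_if_finite[OF U, of "\<lambda>u. X u + Y u"] by (auto simp: s_def not_less)
    have "s \<sqsubseteq> u" if u: "u \<in> U" for u
    proof -
      have su: "s \<in> carrier K" "u \<in> carrier K"
        using s u by (auto simp: U_def Upper_def)
      obtain m where m: "m \<in> carrier K" "X m = min (X s) (X u)" "Y m = min (Y s) (Y u)"
        using meet su by blast
      have "m \<in> U"
        using m s(1) u xy by (auto simp: U_def Upper_def le)
      then show ?thesis
        using s(2)[of m] m su by (auto simp: le min_def split: if_splits)
    qed
    then show ?thesis
      using s(1) by (auto simp: least_def U_def Upper_def)
  qed
  interpret lattice K
  proof
    show "\<exists>s. greatest K s (Lower K {x, y})" if "x \<in> carrier K" "y \<in> carrier K" for x y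
      using meet[OF that] glb[OF that] by blast
  qed (use lub in blast)
  show ?thesis
  proof
    fix x y
    assume xy: "x \<in> carrier K" "y \<in> carrier K"
    obtain m where m: "m \<in> carrier K" "X m = min (X x) (X y)" "Y m = min (Y x) (Y y)"
      using meet xy by blast
    have "x \<sqinter> y = m"
      using m xy meet_left[OF xy] meet_right[OF xy] meet_le[of m x y] by (intro le_antisym) (auto simp: le)
    then show "X (x \<sqinter> y) = min (X x) (X y)" "Y (x \<sqinter> y) = min (Y x) (Y y)"
      using m by auto
    show "x \<sqsubseteq> y \<longleftrightarrow> X x \<le> X y \<and> Y x \<le> Y y"
      using le xy .
  qed (use fin top in auto)
qed

text \<open>The two equations fix the orientation: \<open>al\<close> is reached from
  \<open>v\<close> by increasing \<open>l\<close> alone, and \<open>ar\<close> by increasing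
  \<open>r\<close> alone.\<close>

locale forked = semimodular_grid L l r
  for L :: "'a gorder" (structure) and l r and v al ar i :: 'a +
  assumes square: "covering_square L v al ar i"
    and r_v: "r v = r al" and l_v: "l v = l ar"
begin

sublocale left: descent L l r al v
  using square r_v by unfold_locales (auto simp: covering_square_def)

text \<open>Exchanging the coordinates turns the right-hand sequence into an instance of the
  left-hand theory.\<close>

sublocale right: descent L r l ar v
  using square l_v swap by (intro descent.intro descent_axioms.intro) (auto simp: covering_square_def)

abbreviation "K \<equiv> fork L v al ar i"
abbreviation "xl \<equiv> fork_x L al v"
abbreviation "yl \<equiv> fork_y L al v"
abbreviation "xr \<equiv> fork_x L ar v"
abbreviation "yr \<equiv> fork_y L ar v"
abbreviation "Nl \<equiv> fork_index L al v"
abbreviation "Nr \<equiv> fork_index L ar v"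

lemma square_closed: "v \<in> carrier L" "al \<in> carrier L" "ar \<in> carrier L" "i \<in> carrier L"
  using square coversD unfolding covering_square_def by blast+

lemma square_lr: "l v < l al" "r v < r ar" "l al \<le> l i" "r ar \<le> r i" "r al \<le> r i" "l ar \<le> l i"
  using square left.index_props(5)[OF left.start_index(1)] right.index_props(5)[OF right.start_index(1)]
    left.covers_lr[of al i] left.covers_lr[of ar i]
  unfolding covering_square_def left.start_index right.start_index by auto

text \<open>Coordinates are doubled so that the new elements fit between the old ones.\<close>

primrec X :: "'a fork_elem \<Rightarrow> nat" where
  "X (Old x) = 2 * l x"
| "X New_t = 2 * l v + 1"
| "X (New_zl k) = 2 * l v + 1"
| "X (New_zr k) = 2 * l (xr k)"

primrec Y :: "'a fork_elem \<Rightarrow> nat" where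
  "Y (Old x) = 2 * r x"
| "Y New_t = 2 * r v + 1"
| "Y (New_zl k) = 2 * r (xl k)"
| "Y (New_zr k) = 2 * r v + 1"

lemma carrier_K:
  "carrier K = Old ` carrier L \<union> {New_t} \<union> New_zl ` Nl \<union> New_zr ` Nr"
  by (auto simp: fork_def fork_carrier_def fork_index_def image_Collect)

lemma carrier_K_simps [simp]:
  "Old x \<in> carrier K \<longleftrightarrow> x \<in> carrier L" "New_t \<in> carrier K"
  "New_zl k \<in> carrier K \<longleftrightarrow> k \<in> Nl" "New_zr k \<in> carrier K \<longleftrightarrow> k \<in> Nr"
  by (auto simp: carrier_K)

lemma carrier_K_cases [consumes 1, case_names Old t zl zr]:
  assumes "p \<in> carrier K"
  obtains x where "p = Old x" "x \<in> carrier L" | "p = New_t" | k where "p = New_zl k" "k \<in> Nl"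
    | k where "p = New_zr k" "k \<in> Nr"
  using assms by (auto simp: carrier_K)

lemma gens:
  "fork_gens L v al ar i =
    {(Old x, Old y) |x y. x \<in> carrier L \<and> y \<in> carrier L \<and> x \<sqsubseteq> y} \<union>
    {(Old (yl k), New_zl k) |k. k \<in> Nl} \<union> {(New_zl k, Old (xl k)) |k. k \<in> Nl} \<union>
    {(New_zl (Suc k), New_zl k) |k. k \<in> Nl \<and> Suc k \<in> Nl} \<union>
    {(Old (yr k), New_zr k) |k. k \<in> Nr} \<union> {(New_zr k, Old (xr k)) |k. k \<in> Nr} \<union>
    {(New_zr (Suc k), New_zr k) |k. k \<in> Nr \<and> Suc k \<in> Nr} \<union>
    {(New_zl 1, New_t), (New_zr 1, New_t), (New_t, Old i)}"
  unfolding fork_gens_def left.fork_side_iff right.fork_side_iff by auto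

lemma gensI:
  shows "x \<in> carrier L \<Longrightarrow> y \<in> carrier L \<Longrightarrow> x \<sqsubseteq> y \<Longrightarrow> (Old x, Old y) \<in> fork_gens L v al ar i"
    and "k \<in> Nl \<Longrightarrow> (Old (yl k), New_zl k) \<in> fork_gens L v al ar i"
    and "k \<in> Nl \<Longrightarrow> (New_zl k, Old (xl k)) \<in> fork_gens L v al ar i"
    and "k \<in> Nl \<Longrightarrow> Suc k \<in> Nl \<Longrightarrow> (New_zl (Suc k), New_zl k) \<in> fork_gens L v al ar i"
    and "k \<in> Nr \<Longrightarrow> (Old (yr k), New_zr k) \<in> fork_gens L v al ar i"
    and "k \<in> Nr \<Longrightarrow> (New_zr k, Old (xr k)) \<in> fork_gens L v al ar i"
    and "k \<in> Nr \<Longrightarrow> Suc k \<in> Nr \<Longrightarrow> (New_zr (Suc k), New_zr k) \<in> fork_gens L v al ar i"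
    and "(New_zl 1, New_t) \<in> fork_gens L v al ar i" "(New_zr 1, New_t) \<in> fork_gens L v al ar i"
      "(New_t, Old i) \<in> fork_gens L v al ar i"
  by (simp_all add: gens)

text \<open>Beyond \<open>v\<close> in both coordinates an element is above \<open>al = x_1\<close>
  on the left and \<open>ar = x_1\<close> on the right. Hence \<open>i\<close> is the least old
  element above \<open>t\<close>.\<close>

lemma new_below_i:
  assumes "x \<in> carrier L" "l v < l x" "r v < r x"
  shows "i \<sqsubseteq> x"
proof -
  have "al \<sqsubseteq> x"
    using left.above_new[OF left.start_index(1) assms(1,2)] left.start_index(2) r_v assms by simp
  moreover have "ar \<sqsubseteq> x"
    using right.above_new[OF right.start_index(1) assms(1,3)] right.start_index(2) l_v assms by simp
  ultimately show ?thesis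
    using square square_closed assms join_le by (simp add: covering_square_def)
qed

definition grid_order :: "'a fork_elem rel"
  where "grid_order = {(p, q). p \<in> carrier K \<and> q \<in> carrier K \<and> X p \<le> X q \<and> Y p \<le> Y q}"

text \<open>Parity tells the kinds apart: old elements have two even coordinates, \<open>t\<close>
  has two odd ones, each \<open>z\<close> has one of each. Within a side sequence the even
  coordinate determines the index.\<close>

lemma XY_inj:
  assumes "p \<in> carrier K" "q \<in> carrier K" "X p = X q" "Y p = Y q"
  shows "p = q"
proof -
  have l: "j = k" if "j \<in> Nl" "k \<in> Nl" "r (xl j) = r (xl k)" for j k
    using left.index_order(1)[OF that(1,2)] left.index_order(1)[OF that(2,1)] that(3) by simp
  have r: "j = k" if "j \<in> Nr" "k \<in> Nr" "l (xr j) = l (xr k)" for j k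
    using right.index_order(1)[OF that(1,2)] right.index_order(1)[OF that(2,1)] that(3) by simp
  have par: "2 * (a::nat) \<noteq> 2 * b + 1" for a b
    by presburger
  show ?thesis
    using assms(3,4)
    by (cases rule: carrier_K_cases[OF assms(1)]; cases rule: carrier_K_cases[OF assms(2)])
      (use par par[symmetric] l r eqI in \<open>simp_all del: One_nat_def add_2_eq_Suc add_2_eq_Suc'\<close>)
qed

lemma grid_order_po: "partial_order_on (carrier K) grid_order"
  unfolding partial_order_on_def preorder_on_def
  by (auto simp: grid_order_def refl_on_def trans_def antisym_def intro: XY_inj)

lemma gens_grid_order: "fork_gens L v al ar i \<subseteq> grid_order"
  unfolding gens
proof (intro Un_least)
  show "{(Old x, Old y) |x y. x \<in> carrier L \<and> y \<in> carrier L \<and> x \<sqsubseteq> y} \<subseteq> grid_order"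
    by (auto simp: grid_order_def le_iff)
  show "{(Old (yl k), New_zl k) |k. k \<in> Nl} \<subseteq> grid_order"
    using left.index_props by (auto simp: grid_order_def)
  show "{(Old (yr k), New_zr k) |k. k \<in> Nr} \<subseteq> grid_order"
    using right.index_props by (auto simp: grid_order_def)
  have "2 * l v + 1 \<le> 2 * l (xl k)" if "k \<in> Nl" for k
    using left.index_props(5)[OF that] by linarith
  then show "{(New_zl k, Old (xl k)) |k. k \<in> Nl} \<subseteq> grid_order"
    using left.index_props(8) by (auto simp: grid_order_def)
  have "2 * r v + 1 \<le> 2 * r (xr k)" if "k \<in> Nr" for k
    using right.index_props(5)[OF that] by linarith
  then show "{(New_zr k, Old (xr k)) |k. k \<in> Nr} \<subseteq> grid_order"
    using right.index_props(8) by (auto simp: grid_order_def)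
  show "{(New_zl (Suc k), New_zl k) |k. k \<in> Nl \<and> Suc k \<in> Nl} \<subseteq> grid_order"
    using left.index_order(1) by (auto simp: grid_order_def)
  show "{(New_zr (Suc k), New_zr k) |k. k \<in> Nr \<and> Suc k \<in> Nr} \<subseteq> grid_order"
    using right.index_order(1) by (auto simp: grid_order_def)
  have "2 * l v + 1 \<le> 2 * l i" "2 * r v + 1 \<le> 2 * r i" "2 * r v \<le> 2 * r v + 1" "2 * l v \<le> 2 * l v + 1"
    using square_lr by linarith+
  then show "{(New_zl 1, New_t), (New_zr 1, New_t), (New_t, Old i)} \<subseteq> grid_order"
    using left.start_index right.start_index square_closed r_v l_v by (simp add: grid_order_def)
qed

text \<open>Every grid inequality factors through generators: into \<open>z_k\<close> from old
  elements via \<open>y_k\<close>, out of it via \<open>x_k\<close>, into \<open>t\<close> via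
  \<open>z_1\<close>, and out of \<open>t\<close> via \<open>i\<close>. The exits rely on
  \<open>above_new\<close> and \<open>new_below_i\<close>.\<close>

lemma grid_order_least:
  assumes po: "partial_order_on (carrier K) R" and R: "fork_gens L v al ar i \<subseteq> R"
  shows "grid_order \<subseteq> R"
proof -
  have tr: "(p, s) \<in> R" if "(p, q) \<in> R" "(q, s) \<in> R" for p q s
    using po that by (auto simp: partial_order_on_def preorder_on_def trans_def)
  have rf: "(p, p) \<in> R" if "p \<in> carrier K" for p
    using po that by (auto simp: partial_order_on_def preorder_on_def refl_on_def)
  have old: "(Old x, Old y) \<in> R" if "x \<in> carrier L" "y \<in> carrier L" "l x \<le> l y" "r x \<le> r y" for x y
    using R gensI(1)[OF that(1,2)] that le_iff[OF that(1,2)] by blast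
  have gl: "(Old (yl k), New_zl k) \<in> R" "(New_zl k, Old (xl k)) \<in> R" if "k \<in> Nl" for k
    using R gensI(2,3)[OF that] by blast+
  have gr: "(Old (yr k), New_zr k) \<in> R" "(New_zr k, Old (xr k)) \<in> R" if "k \<in> Nr" for k
    using R gensI(5,6)[OF that] by blast+
  have gt: "(New_zl 1, New_t) \<in> R" "(New_zr 1, New_t) \<in> R" "(New_t, Old i) \<in> R"
    using R gensI(8-10) by blast+
  have zl: "(New_zl j, New_zl k) \<in> R" if "j \<in> Nl" "k \<in> Nl" "k \<le> j" for j k
    using that(3,1)
  proof (induction j rule: dec_induct)
    case (step j)
    have j: "j \<in> Nl"
      using left.index_downward[OF step(4)] left.index_props(1)[OF that(2)] step by simp
    then have "(New_zl (Suc j), New_zl j) \<in> R"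
      using R gensI(4) step by blast
    then show ?case
      using tr step j by blast
  qed (use rf that in simp)
  have zr: "(New_zr j, New_zr k) \<in> R" if "j \<in> Nr" "k \<in> Nr" "k \<le> j" for j k
    using that(3,1)
  proof (induction j rule: dec_induct)
    case (step j)
    have j: "j \<in> Nr"
      using right.index_downward[OF step(4)] right.index_props(1)[OF that(2)] step by simp
    then have "(New_zr (Suc j), New_zr j) \<in> R"
      using R gensI(7) step by blast
    then show ?case
      using tr step j by blast
  qed (use rf that in simp)
  have zl_t: "(New_zl k, New_t) \<in> R" if "k \<in> Nl" for k
    using tr zl[OF that left.start_index(1)] gt(1) left.index_props(1)[OF that] by blast
  have zr_t: "(New_zr k, New_t) \<in> R" if "k \<in> Nr" for k
    using tr zr[OF that right.start_index(1)] gt(2) right.index_props(1)[OF that] by blast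
  have old_zl: "(Old x, New_zl k) \<in> R" if "x \<in> carrier L" "k \<in> Nl" "l x \<le> l v" "r x \<le> r (xl k)" for x k
    using old[of x "yl k"] gl(1)[of k] tr that left.index_props[OF that(2)] by auto
  have old_zr: "(Old x, New_zr k) \<in> R" if "x \<in> carrier L" "k \<in> Nr" "l x \<le> l (xr k)" "r x \<le> r v" for x k
    using old[of x "yr k"] gr(1)[of k] tr that right.index_props[OF that(2)] by auto
  have old_t: "(Old x, New_t) \<in> R" if "x \<in> carrier L" "l x \<le> l v" "r x \<le> r v" for x
    using old_zl[OF that(1) left.start_index(1) that(2)] left.start_index(2) that(3) r_v gt(1) tr by simp
  have zl_old: "(New_zl k, Old x) \<in> R" if "x \<in> carrier L" "k \<in> Nl" "l v < l x" "r (xl k) \<le> r x" for x k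
  proof -
    have "xl k \<sqsubseteq> x"
      using left.above_new that by blast
    then show ?thesis
      using old[of "xl k" x] gl(2)[OF that(2)] tr that left.index_props(8)[OF that(2)] le_iff by blast
  qed
  have zr_old: "(New_zr k, Old x) \<in> R" if "x \<in> carrier L" "k \<in> Nr" "r v < r x" "l (xr k) \<le> l x" for x k
  proof -
    have "xr k \<sqsubseteq> x"
      using right.above_new that by blast
    then show ?thesis
      using old[of "xr k" x] gr(2)[OF that(2)] tr that right.index_props(8)[OF that(2)] le_iff by blast
  qed
  have t_old: "(New_t, Old x) \<in> R" if "x \<in> carrier L" "l v < l x" "r v < r x" for x
    using new_below_i[OF that] old[of i x] gt(3) tr that square_closed le_iff by blast
  have half: "2 * (a::nat) \<le> 2 * b + 1 \<longleftrightarrow> a \<le> b" "2 * a + 1 \<le> 2 * b \<longleftrightarrow> a < b" for a b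
    by presburger+
  show ?thesis
  proof safe
    fix p q
    assume "(p, q) \<in> grid_order"
    then have pq: "p \<in> carrier K" "q \<in> carrier K" "X p \<le> X q" "Y p \<le> Y q"
      by (auto simp: grid_order_def)
    have bl: "r (xl k) \<le> r v" if "k \<in> Nl" for k
      using left.index_bounds[OF that] by simp
    have br: "l (xr k) \<le> l v" if "k \<in> Nr" for k
      using right.index_bounds[OF that] by simp
    show "(p, q) \<in> R"
    proof (cases rule: carrier_K_cases[OF pq(1)]; cases rule: carrier_K_cases[OF pq(2)])
      fix j k assume "p = New_zl j" "j \<in> Nl" "q = New_zl k" "k \<in> Nl"
      then show ?thesis
        using pq zl left.index_order(1) by simp
    next
      fix j k assume "p = New_zr j" "j \<in> Nr" "q = New_zr k" "k \<in> Nr"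
      then show ?thesis
        using pq zr right.index_order(1) by simp
    next
      \<comment> \<open>This case and the next three are vacuous: the odd coordinate of the left
        member is too large.\<close>
      fix j k assume "p = New_zl j" "j \<in> Nl" "q = New_zr k" "k \<in> Nr"
      then show ?thesis
        using pq br[of k] by simp
    next
      fix j k assume "p = New_zr j" "j \<in> Nr" "q = New_zl k" "k \<in> Nl"
      then show ?thesis
        using pq bl[of k] by simp
    next
      fix k assume "p = New_t" "q = New_zl k" "k \<in> Nl"
      then show ?thesis
        using pq bl[of k] by simp
    next
      fix k assume "p = New_t" "q = New_zr k" "k \<in> Nr"
      then show ?thesis
        using pq br[of k] by simp
    qed (use pq half old old_zl old_zr old_t zl_old zr_old t_old zl_t zr_t rf in \<open>simp_all del: One_nat_def\<close>)
  qed
qed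

lemma fork_order_eq: "fork_order L v al ar i = grid_order"
proof -
  have "carrier K = fork_carrier L v al ar"
    by (simp add: fork_def)
  then have "fork_order L v al ar i =
      \<Inter> {R. partial_order_on (carrier K) R \<and> fork_gens L v al ar i \<subseteq> R}"
    by (simp add: fork_order_def)
  also have "\<dots> = grid_order"
  proof
    show "\<Inter> {R. partial_order_on (carrier K) R \<and> fork_gens L v al ar i \<subseteq> R} \<subseteq> grid_order"
      by (rule Inter_lower) (simp add: grid_order_po gens_grid_order)
    show "grid_order \<subseteq> \<Inter> {R. partial_order_on (carrier K) R \<and> fork_gens L v al ar i \<subseteq> R}"
      by (rule Inter_greatest) (simp add: grid_order_least)
  qed
  finally show ?thesis .
qed

lemma K_eq: "(.=\<^bsub>K\<^esub>) = (=)"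
  by (simp add: fork_def)

lemma K_le:
  assumes "p \<in> carrier K" "q \<in> carrier K"
  shows "p \<sqsubseteq>\<^bsub>K\<^esub> q \<longleftrightarrow> X p \<le> X q \<and> Y p \<le> Y q"
proof -
  have "p \<sqsubseteq>\<^bsub>K\<^esub> q \<longleftrightarrow> (p, q) \<in> grid_order"
    by (simp add: fork_def fork_order_eq)
  then show ?thesis
    using assms by (simp add: grid_order_def)
qed

text \<open>The critical minima are those of a new element with an old one beyond the column or row
  of \<open>v\<close>. They keep an odd coordinate, so they must be new elements, and
  \<open>reach\<close> supplies them.\<close>

lemma K_meet:
  assumes "p \<in> carrier K" "q \<in> carrier K"
  shows "\<exists>m\<in>carrier K. X m = min (X p) (X q) \<and> Y m = min (Y p) (Y q)"
proof -
  define good where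
    "good p q \<longleftrightarrow> (\<exists>m\<in>carrier K. X m = min (X p) (X q) \<and> Y m = min (Y p) (Y q))" for p q
  have goodI: "good p q" if "m \<in> carrier K" "X m = min (X p) (X q)" "Y m = min (Y p) (Y q)" for m p q
    using that by (auto simp: good_def)
  have comm: "good p q \<longleftrightarrow> good q p" for p q
    by (simp add: good_def min.commute)
  have comparable: "good p q" if "p \<in> carrier K" "X p \<le> X q" "Y p \<le> Y q" for p q
    using that by (intro goodI[of p]) auto
  have old: "good (Old x) (Old y)" if "x \<in> carrier L" "y \<in> carrier L" for x y
    using that by (intro goodI[of "Old (x \<sqinter> y)"]) (auto simp: l_meet r_meet)
  have old_zl: "good (Old q) (New_zl k)" if q: "q \<in> carrier L" "k \<in> Nl" for q k
  proof (cases "l q \<le> l v")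
    case True
    then show ?thesis
      using left.index_props[OF q(2)] q
      by (intro goodI[of "Old (q \<sqinter> yl k)"]) (auto simp: l_meet r_meet)
  next
    case False
    then obtain j where j: "j \<in> Nl" "r (xl j) = min (r q) (r v)"
      using left.reach[OF q(1)] by auto
    show ?thesis
    proof (cases "r q \<le> r (xl k)")
      case True
      then show ?thesis
        using j False q left.index_bounds[OF q(2)] by (intro goodI[of "New_zl j"]) auto
    next
      case f: False
      then show ?thesis
        using False q by (intro goodI[of "New_zl k"]) auto
    qed
  qed
  have old_zr: "good (Old q) (New_zr k)" if q: "q \<in> carrier L" "k \<in> Nr" for q k
  proof (cases "r q \<le> r v")
    case True
    then show ?thesis
      using right.index_props[OF q(2)] q
      by (intro goodI[of "Old (q \<sqinter> yr k)"]) (auto simp: l_meet r_meet)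
  next
    case False
    then obtain j where j: "j \<in> Nr" "l (xr j) = min (l q) (l v)"
      using right.reach[OF q(1)] by auto
    show ?thesis
    proof (cases "l q \<le> l (xr k)")
      case True
      then show ?thesis
        using j False q right.index_bounds[OF q(2)] by (intro goodI[of "New_zr j"]) auto
    next
      case f: False
      then show ?thesis
        using False q by (intro goodI[of "New_zr k"]) auto
    qed
  qed
  have old_t: "good (Old q) New_t" if q: "q \<in> carrier L" for q
  proof -
    consider "l q \<le> l v" "r q \<le> r v" | "l v < l q" | "r v < r q"
      by linarith
    then show ?thesis
    proof cases
      case 1
      then show ?thesis
        using q by (intro comparable) auto
    next
      case 2
      then obtain j where j: "j \<in> Nl" "r (xl j) = min (r q) (r v)"
        using left.reach[OF q] by auto
      show ?thesis
        using 2 j q by (cases "r q \<le> r v"; intro goodI[of "if r q \<le> r v then New_zl j else New_t"]) auto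
    next
      case 3
      then obtain j where j: "j \<in> Nr" "l (xr j) = min (l q) (l v)"
        using right.reach[OF q] by auto
      show ?thesis
        using 3 j q by (cases "l q \<le> l v"; intro goodI[of "if l q \<le> l v then New_zr j else New_t"]) auto
    qed
  qed
  have zl: "good (New_zl j) (New_zl k)" if "j \<in> Nl" "k \<in> Nl" for j k
    using that comparable[of "New_zl j" "New_zl k"] comparable[of "New_zl k" "New_zl j"] comm
    by (cases "r (xl j) \<le> r (xl k)") auto
  have zr: "good (New_zr j) (New_zr k)" if "j \<in> Nr" "k \<in> Nr" for j k
    using that comparable[of "New_zr j" "New_zr k"] comparable[of "New_zr k" "New_zr j"] comm
    by (cases "l (xr j) \<le> l (xr k)") auto
  have zl_t: "good (New_zl j) New_t" if "j \<in> Nl" for j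
    using that left.index_bounds[OF that] by (intro comparable) auto
  have zr_t: "good (New_zr j) New_t" if "j \<in> Nr" for j
    using that right.index_bounds[OF that] by (intro comparable) auto
  \<comment> \<open>\<open>yl j\<close> carries the row of \<open>New_zl j\<close> and
    \<open>yr k\<close> the column of \<open>New_zr k\<close>; taking minima removes both odd
    coordinates.\<close>
  have zl_zr: "good (New_zl j) (New_zr k)" if "j \<in> Nl" "k \<in> Nr" for j k
    using that left.index_bounds[OF that(1)] right.index_bounds[OF that(2)]
      left.index_props[OF that(1)] right.index_props[OF that(2)]
    by (intro goodI[of "Old (yl j \<sqinter> yr k)"]) (auto simp: l_meet r_meet)
  have t: "good New_t New_t"
    by (intro comparable) auto
  have "good p q"
    by (cases rule: carrier_K_cases[OF assms(1)]; cases rule: carrier_K_cases[OF assms(2)])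
      (simp_all add: old old_zl old_zr old_t zl zr zl_t zr_t zl_zr t
        old_zl[THEN comm[THEN iffD1]] old_zr[THEN comm[THEN iffD1]] old_t[THEN comm[THEN iffD1]]
        zl_t[THEN comm[THEN iffD1]] zr_t[THEN comm[THEN iffD1]] zl_zr[THEN comm[THEN iffD1]])
  then show ?thesis
    by (simp add: good_def)
qed

sublocale K: grid_lattice K X Y
proof -
  obtain c where c: "c \<in> carrier L" "\<And>x. x \<in> carrier L \<Longrightarrow> x \<sqsubseteq> c"
    using obtain_top by blast
  have "i \<sqsubseteq> c"
    using c square_closed by auto
  then have ci: "l i \<le> l c" "r i \<le> r c"
    using c square_closed le_iff by auto
  have "p \<sqsubseteq>\<^bsub>K\<^esub> Old c" if p: "p \<in> carrier K" for p
    using p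
  proof (cases rule: carrier_K_cases)
    case (Old x)
    then show ?thesis
      using p c c(2)[of x] by (simp add: K_le le_iff)
  next
    case t
    then show ?thesis
      using p c ci square_lr by (simp add: K_le)
  next
    case (zl k)
    then show ?thesis
      using p c ci square_lr left.index_bounds[of k] by (simp add: K_le)
  next
    case (zr k)
    then show ?thesis
      using p c ci square_lr right.index_bounds[of k] by (simp add: K_le)
  qed
  moreover have "finite (carrier K)"
    using finite_carrier left.finite_index right.finite_index by (simp add: carrier_K)
  ultimately show "grid_lattice K X Y"
    using XY_inj K_le K_meet K_eq c by (intro grid_latticeI[of K X Y "Old c"]) auto
qed

end

section \<open>Congruences of finite lattices\<close>

lemma congruenceD:
  assumes "congruence K \<theta>"
  shows "(a, b) \<in> \<theta> \<Longrightarrow> a \<in> carrier K" "(a, b) \<in> \<theta> \<Longrightarrow> b \<in> carrier K"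
    "a \<in> carrier K \<Longrightarrow> (a, a) \<in> \<theta>" "(a, b) \<in> \<theta> \<Longrightarrow> (b, a) \<in> \<theta>"
    "(a, b) \<in> \<theta> \<Longrightarrow> (b, c) \<in> \<theta> \<Longrightarrow> (a, c) \<in> \<theta>"
    "(a, b) \<in> \<theta> \<Longrightarrow> (c, d) \<in> \<theta> \<Longrightarrow> (a \<squnion>\<^bsub>K\<^esub> c, b \<squnion>\<^bsub>K\<^esub> d) \<in> \<theta>"
    "(a, b) \<in> \<theta> \<Longrightarrow> (c, d) \<in> \<theta> \<Longrightarrow> (a \<sqinter>\<^bsub>K\<^esub> c, b \<sqinter>\<^bsub>K\<^esub> d) \<in> \<theta>"
  using assms unfolding congruence_def equiv_def refl_on_def sym_def trans_def by blast+

lemma congruenceI: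
  assumes "\<theta> \<subseteq> carrier K \<times> carrier K" "\<And>a. a \<in> carrier K \<Longrightarrow> (a, a) \<in> \<theta>"
    and "\<And>a b. (a, b) \<in> \<theta> \<Longrightarrow> (b, a) \<in> \<theta>"
    and trans: "\<And>a b c. (a, b) \<in> \<theta> \<Longrightarrow> (b, c) \<in> \<theta> \<Longrightarrow> (a, c) \<in> \<theta>"
    and join: "\<And>a b c. (a, b) \<in> \<theta> \<Longrightarrow> c \<in> carrier K \<Longrightarrow> (a \<squnion>\<^bsub>K\<^esub> c, b \<squnion>\<^bsub>K\<^esub> c) \<in> \<theta>"
    and meet: "\<And>a b c. (a, b) \<in> \<theta> \<Longrightarrow> c \<in> carrier K \<Longrightarrow> (a \<sqinter>\<^bsub>K\<^esub> c, b \<sqinter>\<^bsub>K\<^esub> c) \<in> \<theta>"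
  shows "congruence K \<theta>"
  unfolding congruence_def
proof (intro conjI allI impI)
  show "equiv (carrier K) \<theta>"
  proof (rule equivI)
    show "refl_on (carrier K) \<theta>"
      using assms(2) by (simp add: refl_on_def)
    show "sym \<theta>"
      by (rule symI) (rule assms(3))
    show "trans \<theta>"
      by (rule transI) (rule trans)
  qed (rule assms(1))
  fix a b c d
  assume *: "(a, b) \<in> \<theta> \<and> (c, d) \<in> \<theta>"
  then have car: "c \<in> carrier K" "b \<in> carrier K"
    using assms(1) by auto
  have "(a \<squnion>\<^bsub>K\<^esub> c, b \<squnion>\<^bsub>K\<^esub> c) \<in> \<theta>" "(b \<squnion>\<^bsub>K\<^esub> c, b \<squnion>\<^bsub>K\<^esub> d) \<in> \<theta>"
    using join[of a b c] join[of c d b] * car by (simp_all add: join_comm[of K b])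
  then show "(a \<squnion>\<^bsub>K\<^esub> c, b \<squnion>\<^bsub>K\<^esub> d) \<in> \<theta>"
    by (rule trans)
  have "(a \<sqinter>\<^bsub>K\<^esub> c, b \<sqinter>\<^bsub>K\<^esub> c) \<in> \<theta>" "(b \<sqinter>\<^bsub>K\<^esub> c, b \<sqinter>\<^bsub>K\<^esub> d) \<in> \<theta>"
    using meet[of a b c] meet[of c d b] * car by (simp_all add: meet_comm[of K b])
  then show "(a \<sqinter>\<^bsub>K\<^esub> c, b \<sqinter>\<^bsub>K\<^esub> d) \<in> \<theta>"
    by (rule trans)
qed

lemma congruence_gen_superset: "R \<subseteq> congruence_gen K R"
  by (auto simp: congruence_gen_def)

lemma congruence_gen_least: "congruence K \<theta> \<Longrightarrow> R \<subseteq> \<theta> \<Longrightarrow> congruence_gen K R \<subseteq> \<theta>"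
  by (auto simp: congruence_gen_def)

lemma con_least: "congruence K \<theta> \<Longrightarrow> (u, w) \<in> \<theta> \<Longrightarrow> con K u w \<subseteq> \<theta>"
  unfolding con_def by (rule congruence_gen_least) auto

lemma con_contains: "(u, w) \<in> con K u w"
  using congruence_gen_superset[of "{(u, w)}" K] by (simp add: con_def)

context finite_lattice
begin

lemma congruence_congruence_gen:
  assumes "R \<subseteq> carrier L \<times> carrier L"
  shows "congruence L (congruence_gen L R)"
proof (rule congruenceI)
  have "congruence L (carrier L \<times> carrier L)"
    by (rule congruenceI) auto
  then show "congruence_gen L R \<subseteq> carrier L \<times> carrier L"
    using assms by (rule congruence_gen_least)
  show "(a, a) \<in> congruence_gen L R" if "a \<in> carrier L" for a
    using that congruenceD(3)[of L] by (simp add: congruence_gen_def)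
  show "(b, a) \<in> congruence_gen L R" if "(a, b) \<in> congruence_gen L R" for a b
    using that congruenceD(4)[of L] by (simp add: congruence_gen_def)
  show "(a, c) \<in> congruence_gen L R"
    if "(a, b) \<in> congruence_gen L R" "(b, c) \<in> congruence_gen L R" for a b c
    using that congruenceD(5)[of L] unfolding congruence_gen_def by blast
  show "(a \<squnion> c, b \<squnion> c) \<in> congruence_gen L R"
    if "(a, b) \<in> congruence_gen L R" "c \<in> carrier L" for a b c
    using that congruenceD(3,6)[of L] by (simp add: congruence_gen_def)
  show "(a \<sqinter> c, b \<sqinter> c) \<in> congruence_gen L R"
    if "(a, b) \<in> congruence_gen L R" "c \<in> carrier L" for a b c
    using that congruenceD(3,7)[of L] by (simp add: congruence_gen_def)
qed

lemma congruence_con: "u \<in> carrier L \<Longrightarrow> w \<in> carrier L \<Longrightarrow> congruence L (con L u w)"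
  unfolding con_def by (rule congruence_congruence_gen) auto

lemma congruence_Id: "congruence L (Id_on (carrier L))"
  by (rule congruenceI) auto

lemma Id_on_subset: "congruence L \<theta> \<Longrightarrow> Id_on (carrier L) \<subseteq> \<theta>"
  by (auto intro: congruenceD(3))

lemma congruence_subset: "congruence L \<theta> \<Longrightarrow> \<theta> \<subseteq> carrier L \<times> carrier L"
  by (auto dest: congruenceD(1,2))

text \<open>The join of an order is a chosen least upper bound, so both the existence and the
  uniqueness of that bound enter.\<close>

lemma Con_join:
  assumes "congruence L \<alpha>" "congruence L \<beta>"
  shows "\<alpha> \<squnion>\<^bsub>Con L\<^esub> \<beta> = congruence_gen L (\<alpha> \<union> \<beta>)"
proof -
  have c: "congruence L (congruence_gen L (\<alpha> \<union> \<beta>))"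
    using congruence_subset assms by (intro congruence_congruence_gen) auto
  have upper: "Upper (Con L) {\<alpha>, \<beta>} = {\<gamma>. congruence L \<gamma> \<and> \<alpha> \<union> \<beta> \<subseteq> \<gamma>}"
    using assms by (auto simp: Upper_def Con_def)
  have lub: "least (Con L) (congruence_gen L (\<alpha> \<union> \<beta>)) (Upper (Con L) {\<alpha>, \<beta>})"
    unfolding least_def upper
  proof (intro conjI ballI)
    show "congruence_gen L (\<alpha> \<union> \<beta>) \<in> {\<gamma>. congruence L \<gamma> \<and> \<alpha> \<union> \<beta> \<subseteq> \<gamma>}"
      using c congruence_gen_superset[of "\<alpha> \<union> \<beta>" L] by simp
    show "congruence_gen L (\<alpha> \<union> \<beta>) \<sqsubseteq>\<^bsub>Con L\<^esub> \<gamma>" if "\<gamma> \<in> {\<gamma>. congruence L \<gamma> \<and> \<alpha> \<union> \<beta> \<subseteq> \<gamma>}" for \<gamma>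
      using that congruence_gen_least[of L \<gamma> "\<alpha> \<union> \<beta>"] by (simp add: Con_def)
  qed (auto simp: Con_def)
  have unique: "\<gamma> = congruence_gen L (\<alpha> \<union> \<beta>)" if "least (Con L) \<gamma> (Upper (Con L) {\<alpha>, \<beta>})" for \<gamma>
  proof (rule subset_antisym)
    show "\<gamma> \<subseteq> congruence_gen L (\<alpha> \<union> \<beta>)" "congruence_gen L (\<alpha> \<union> \<beta>) \<subseteq> \<gamma>"
      using that lub unfolding least_def by (simp_all add: Con_def)
  qed
  show ?thesis
    unfolding join_def sup_def by (rule some_equality) (rule lub, rule unique)
qed

lemma join_irreducible_Con_iff:
  "join_irreducible (Con L) \<pi> \<longleftrightarrow> congruence L \<pi> \<and> \<pi> \<noteq> Id_on (carrier L) \<and>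
    (\<forall>\<alpha> \<beta>. congruence L \<alpha> \<and> congruence L \<beta> \<and> \<pi> = congruence_gen L (\<alpha> \<union> \<beta>) \<longrightarrow> \<pi> = \<alpha> \<or> \<pi> = \<beta>)"
proof -
  have car: "carrier (Con L) = {\<theta>. congruence L \<theta>}"
    by (simp add: Con_def)
  have "least (Con L) \<pi> (carrier (Con L)) \<longleftrightarrow> \<pi> = Id_on (carrier L)" if "congruence L \<pi>"
  proof
    assume "least (Con L) \<pi> (carrier (Con L))"
    then have "\<pi> \<subseteq> Id_on (carrier L)"
      using congruence_Id by (simp add: least_def Con_def)
    then show "\<pi> = Id_on (carrier L)"
      using Id_on_subset[OF that] by (rule subset_antisym)
  qed (use that Id_on_subset in \<open>simp add: least_def Con_def\<close>)
  then have eq1: "congruence L \<pi> \<and> \<not> least (Con L) \<pi> (carrier (Con L)) \<longleftrightarrow>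
      congruence L \<pi> \<and> \<pi> \<noteq> Id_on (carrier L)"
    by blast
  have eq2: "(\<forall>\<alpha>\<in>carrier (Con L). \<forall>\<beta>\<in>carrier (Con L). \<pi> = \<alpha> \<squnion>\<^bsub>Con L\<^esub> \<beta> \<longrightarrow> \<pi> = \<alpha> \<or> \<pi> = \<beta>) \<longleftrightarrow>
    (\<forall>\<alpha> \<beta>. congruence L \<alpha> \<and> congruence L \<beta> \<and> \<pi> = congruence_gen L (\<alpha> \<union> \<beta>) \<longrightarrow> \<pi> = \<alpha> \<or> \<pi> = \<beta>)"
    unfolding car by (metis Con_join mem_Collect_eq)
  have eq3: "\<pi> \<in> carrier (Con L) \<longleftrightarrow> congruence L \<pi>"
    by (simp add: car)
  show ?thesis
    unfolding join_irreducible_def eq2 eq3 using eq1 by argo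
qed

text \<open>The polynomial \<open>(_ \<squnion> x) \<sqinter> y\<close> maps \<open>p\<close> to
  \<open>x\<close> and \<open>q\<close> to \<open>y\<close>.\<close>

lemma congruence_interval:
  assumes "congruence L \<theta>" "(p, q) \<in> \<theta>" "p \<sqsubseteq> x" "x \<sqsubseteq> y" "y \<sqsubseteq> q" "x \<in> carrier L" "y \<in> carrier L"
  shows "(x, y) \<in> \<theta>"
proof -
  note D = congruenceD[OF assms(1)]
  have pq: "p \<in> carrier L" "q \<in> carrier L"
    using D(1,2) assms(2) by auto
  have "((p \<squnion> x) \<sqinter> y, (q \<squnion> x) \<sqinter> y) \<in> \<theta>"
    using D(7)[OF D(6)[OF assms(2) D(3)[OF assms(6)]] D(3)[OF assms(7)]] .
  moreover have "x \<sqsubseteq> q"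
    using assms pq le_trans by blast
  ultimately show ?thesis
    using assms pq by (simp add: join_absorb meet_absorb)
qed

text \<open>A pair is collapsed exactly when the interval from its meet to its join is, so
  comparable pairs determine a congruence.\<close>

lemma congruence_subsetI:
  assumes "congruence L \<theta>" "congruence L \<theta>'"
    and "\<And>p q. (p, q) \<in> \<theta> \<Longrightarrow> p \<sqsubseteq> q \<Longrightarrow> (p, q) \<in> \<theta>'"
  shows "\<theta> \<subseteq> \<theta>'"
proof safe
  fix a b
  assume ab: "(a, b) \<in> \<theta>"
  note D = congruenceD[OF assms(1)] and D' = congruenceD[OF assms(2)]
  have car: "a \<in> carrier L" "b \<in> carrier L"
    using ab D(1,2) by auto
  have "(a \<sqinter> b, b) \<in> \<theta>" "(a \<squnion> b, b) \<in> \<theta>"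
    using D(7)[OF ab D(3)[OF car(2)]] D(6)[OF ab D(3)[OF car(2)]] car
    by (simp_all add: join_absorb meet_absorb)
  then have "(a \<sqinter> b, a \<squnion> b) \<in> \<theta>"
    using D(5)[OF _ D(4)] by blast
  moreover have le: "a \<sqinter> b \<sqsubseteq> a" "a \<sqinter> b \<sqsubseteq> b" "a \<sqsubseteq> a \<squnion> b" "b \<sqsubseteq> a \<squnion> b"
    using car meet_left meet_right join_left join_right by auto
  ultimately have m: "(a \<sqinter> b, a \<squnion> b) \<in> \<theta>'"
    using assms(3) car le_trans[of "a \<sqinter> b" a "a \<squnion> b"] by auto
  have "(a \<sqinter> b, a) \<in> \<theta>'" "(a \<sqinter> b, b) \<in> \<theta>'"
    using congruence_interval[OF assms(2) m, of "a \<sqinter> b" a]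
      congruence_interval[OF assms(2) m, of "a \<sqinter> b" b] le car by auto
  then show "(a, b) \<in> \<theta>'"
    using D'(5)[OF D'(4)] by blast
qed

lemma trancl_congruence:
  assumes "congruence L \<gamma>" "congruence L \<delta>"
  shows "congruence L ((\<gamma> \<union> \<delta>)\<^sup>+)"
proof (rule congruenceI)
  note D = congruenceD[OF assms(1)] and D' = congruenceD[OF assms(2)]
  have "\<gamma> \<union> \<delta> \<subseteq> carrier L \<times> carrier L"
    using congruence_subset assms by auto
  then show sub: "(\<gamma> \<union> \<delta>)\<^sup>+ \<subseteq> carrier L \<times> carrier L"
    by (rule trancl_subset_Sigma)
  show "(a, a) \<in> (\<gamma> \<union> \<delta>)\<^sup>+" if "a \<in> carrier L" for a
    using D(3)[OF that] by auto
  have "sym (\<gamma> \<union> \<delta>)"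
    using D(4) D'(4) by (auto simp: sym_def)
  then show "(b, a) \<in> (\<gamma> \<union> \<delta>)\<^sup>+" if "(a, b) \<in> (\<gamma> \<union> \<delta>)\<^sup>+" for a b
    using that sym_trancl by (metis symD)
  show "(a, c) \<in> (\<gamma> \<union> \<delta>)\<^sup>+" if "(a, b) \<in> (\<gamma> \<union> \<delta>)\<^sup>+" "(b, c) \<in> (\<gamma> \<union> \<delta>)\<^sup>+" for a b c
    using that by (rule trancl_trans)
  have step: "(a \<squnion> c, b \<squnion> c) \<in> \<gamma> \<union> \<delta>" "(a \<sqinter> c, b \<sqinter> c) \<in> \<gamma> \<union> \<delta>"
    if "(a, b) \<in> \<gamma> \<union> \<delta>" "c \<in> carrier L" for a b c
    using that(1) D(6,7)[OF _ D(3)[OF that(2)], of a b] D'(6,7)[OF _ D'(3)[OF that(2)], of a b]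
    by auto
  note step1 = step(1) and step2 = step(2)
  show "(a \<squnion> c, b \<squnion> c) \<in> (\<gamma> \<union> \<delta>)\<^sup>+" if "(a, b) \<in> (\<gamma> \<union> \<delta>)\<^sup>+" "c \<in> carrier L" for a b c
    using that(1)
  proof induction
    case (base y)
    then show ?case
      using step(1) that(2) by blast
  next
    case (step y z)
    then show ?case
      using \<open>c \<in> carrier L\<close> trancl_into_trancl[OF step(3) step1[OF step(2)]] by blast
  qed
  show "(a \<sqinter> c, b \<sqinter> c) \<in> (\<gamma> \<union> \<delta>)\<^sup>+" if "(a, b) \<in> (\<gamma> \<union> \<delta>)\<^sup>+" "c \<in> carrier L" for a b c
    using that(1)
  proof induction
    case (base y)
    then show ?case
      using step(2) that(2) by blast
  next
    case (step y z)
    then show ?case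
      using \<open>c \<in> carrier L\<close> trancl_into_trancl[OF step(3) step2[OF step(2)]] by blast
  qed
qed

text \<open>Along a path from \<open>t\<close> to \<open>i\<close>, the polynomial \<open>(x \<squnion> t) \<sqinter> i\<close> jumps from \<open>t\<close> to \<open>i\<close> in one step.\<close>

lemma prime_in_join:
  assumes "congruence L \<gamma>" "congruence L \<delta>" "t \<prec> i" "(t, i) \<in> congruence_gen L (\<gamma> \<union> \<delta>)"
  shows "(t, i) \<in> \<gamma> \<union> \<delta>"
proof -
  note D = congruenceD[OF assms(1)] and D' = congruenceD[OF assms(2)]
  note ti = coversD[OF assms(3)]
  have "\<gamma> \<union> \<delta> \<subseteq> (\<gamma> \<union> \<delta>)\<^sup>+"
    by auto
  then have path: "(t, i) \<in> (\<gamma> \<union> \<delta>)\<^sup>+"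
    using assms congruence_gen_least[OF trancl_congruence[OF assms(1,2)]] by blast
  define f where "f x = (x \<squnion> t) \<sqinter> i" for x
  have f_step: "(f x, f y) \<in> \<gamma> \<union> \<delta>" if "(x, y) \<in> \<gamma> \<union> \<delta>" for x y
    using that D(6)[of x y t t] D(7)[of "x \<squnion> t" "y \<squnion> t" i i]
      D'(6)[of x y t t] D'(7)[of "x \<squnion> t" "y \<squnion> t" i i] D(3) D'(3) ti(1,2)
    unfolding f_def by auto
  have f_val: "f x = t \<or> f x = i" if "x \<in> carrier L" for x
    using ti(5)[of "f x"] that ti(1-3) unfolding f_def
    by (simp add: meet_right meet_le join_right)
  have ft: "f t = t" and fi: "f i = i"
    using ti by (simp_all add: f_def join_absorb meet_absorb)
  have "f x = i \<Longrightarrow> (t, i) \<in> \<gamma> \<union> \<delta>" if "(t, x) \<in> (\<gamma> \<union> \<delta>)\<^sup>+" for x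
    using that
  proof induction
    case (base y)
    then show ?case
      using f_step ft by metis
  next
    case (step y z)
    have "y \<in> carrier L"
      using step(2) D(1) D'(1) by blast
    then show ?case
      using f_val[of y] f_step[OF step(2)] step by metis
  qed
  then show ?thesis
    using path fi by blast
qed

text \<open>A covering pair in a join of two congruences already lies in one of them, which then
  contains everything the pair generates.\<close>

lemma join_irreducible_con:
  assumes "t \<prec> i"
  shows "join_irreducible (Con L) (con L t i)"
proof -
  note ti = coversD[OF assms]
  have "con L t i \<noteq> Id_on (carrier L)"
    using con_contains[of t i L] ti by auto
  moreover have "con L t i = \<alpha> \<or> con L t i = \<beta>"
    if *: "congruence L \<alpha>" "congruence L \<beta>" "con L t i = congruence_gen L (\<alpha> \<union> \<beta>)" for \<alpha> \<beta>
  proof -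
    have "(t, i) \<in> \<alpha> \<union> \<beta>"
      using prime_in_join[OF *(1,2) assms] con_contains[of t i L] *(3) by simp
    moreover have "\<alpha> \<subseteq> con L t i" "\<beta> \<subseteq> con L t i"
      using congruence_gen_superset[of "\<alpha> \<union> \<beta>" L] *(3) by auto
    ultimately show ?thesis
      using con_least[OF *(1), of t i] con_least[OF *(2), of t i] by auto
  qed
  ultimately show ?thesis
    unfolding join_irreducible_Con_iff using congruence_con[OF ti(1,2)] by blast
qed

end

section \<open>Extension and restriction of congruences\<close>

locale lattice_embedding = L: finite_lattice L + K: finite_lattice K
  for L :: "'a gorder" and K :: "'b gorder" and e :: "'a \<Rightarrow> 'b" +
  assumes e_closed: "x \<in> carrier L \<Longrightarrow> e x \<in> carrier K"
    and e_join: "x \<in> carrier L \<Longrightarrow> y \<in> carrier L \<Longrightarrow> e (x \<squnion>\<^bsub>L\<^esub> y) = e x \<squnion>\<^bsub>K\<^esub> e y"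
    and e_meet: "x \<in> carrier L \<Longrightarrow> y \<in> carrier L \<Longrightarrow> e (x \<sqinter>\<^bsub>L\<^esub> y) = e x \<sqinter>\<^bsub>K\<^esub> e y"
begin

definition restrict :: "'b rel \<Rightarrow> 'a rel"
  where "restrict \<beta> = {(x, y). x \<in> carrier L \<and> y \<in> carrier L \<and> (e x, e y) \<in> \<beta>}"

definition extend :: "'a rel \<Rightarrow> 'b rel"
  where "extend \<alpha> = congruence_gen K (map_prod e e ` \<alpha>)"

lemma congruence_restrict:
  assumes "congruence K \<beta>"
  shows "congruence L (restrict \<beta>)"
proof (rule congruenceI)
  note D = congruenceD[OF assms]
  show "(a, b) \<in> restrict \<beta> \<Longrightarrow> (b, a) \<in> restrict \<beta>" for a b
    using D(4) by (simp add: restrict_def)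
  show "(a, b) \<in> restrict \<beta> \<Longrightarrow> (b, c) \<in> restrict \<beta> \<Longrightarrow> (a, c) \<in> restrict \<beta>" for a b c
    using D(5)[of "e a" "e b" "e c"] by (simp add: restrict_def)
  show "(a, b) \<in> restrict \<beta> \<Longrightarrow> c \<in> carrier L \<Longrightarrow> (a \<squnion>\<^bsub>L\<^esub> c, b \<squnion>\<^bsub>L\<^esub> c) \<in> restrict \<beta>" for a b c
    using D(6)[OF _ D(3)[OF e_closed], of "e a" "e b" c] by (simp add: restrict_def e_join)
  show "(a, b) \<in> restrict \<beta> \<Longrightarrow> c \<in> carrier L \<Longrightarrow> (a \<sqinter>\<^bsub>L\<^esub> c, b \<sqinter>\<^bsub>L\<^esub> c) \<in> restrict \<beta>" for a b c
    using D(7)[OF _ D(3)[OF e_closed], of "e a" "e b" c] by (simp add: restrict_def e_meet)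
  show "(a, a) \<in> restrict \<beta>" if "a \<in> carrier L" for a
    using D(3)[OF e_closed[OF that]] that by (simp add: restrict_def)
qed (auto simp: restrict_def)

lemma congruence_extend:
  assumes "congruence L \<alpha>"
  shows "congruence K (extend \<alpha>)"
  unfolding extend_def
  using L.congruence_subset[OF assms] e_closed by (intro K.congruence_congruence_gen) auto

text \<open>\<open>extend\<close> and \<open>restrict\<close> form a Galois connection; this is why
  \<open>extend\<close> preserves joins in \<open>extend_join\<close>.\<close>

lemma extend_subset_iff:
  assumes "congruence L \<alpha>" "congruence K \<beta>"
  shows "extend \<alpha> \<subseteq> \<beta> \<longleftrightarrow> \<alpha> \<subseteq> restrict \<beta>"
proof
  assume "extend \<alpha> \<subseteq> \<beta>"
  then have "map_prod e e ` \<alpha> \<subseteq> \<beta>"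
    using congruence_gen_superset[of "map_prod e e ` \<alpha>" K] by (auto simp: extend_def)
  then show "\<alpha> \<subseteq> restrict \<beta>"
    using congruenceD(1,2)[OF assms(1)] by (auto simp: restrict_def)
next
  assume "\<alpha> \<subseteq> restrict \<beta>"
  then show "extend \<alpha> \<subseteq> \<beta>"
    unfolding extend_def using assms by (intro congruence_gen_least) (auto simp: restrict_def)
qed

lemma extend_join:
  assumes "congruence L \<alpha>" "congruence L \<beta>"
  shows "extend (congruence_gen L (\<alpha> \<union> \<beta>)) = congruence_gen K (extend \<alpha> \<union> extend \<beta>)"
proof
  have cL: "congruence L (congruence_gen L (\<alpha> \<union> \<beta>))"
    using assms L.congruence_subset by (intro L.congruence_congruence_gen) auto
  have cK: "congruence K (congruence_gen K (extend \<alpha> \<union> extend \<beta>))"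
    using assms K.congruence_subset congruence_extend by (intro K.congruence_congruence_gen) auto
  have "\<alpha> \<union> \<beta> \<subseteq> restrict (congruence_gen K (extend \<alpha> \<union> extend \<beta>))"
    using extend_subset_iff[OF assms(1) cK] extend_subset_iff[OF assms(2) cK]
      congruence_gen_superset[of "extend \<alpha> \<union> extend \<beta>" K] by blast
  then show "extend (congruence_gen L (\<alpha> \<union> \<beta>)) \<subseteq> congruence_gen K (extend \<alpha> \<union> extend \<beta>)"
    unfolding extend_subset_iff[OF cL cK]
    by (rule congruence_gen_least[OF congruence_restrict[OF cK]])
  have "\<alpha> \<union> \<beta> \<subseteq> restrict (extend (congruence_gen L (\<alpha> \<union> \<beta>)))"
    using extend_subset_iff[OF cL congruence_extend[OF cL]]
      congruence_gen_superset[of "\<alpha> \<union> \<beta>" L] by blast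
  then show "congruence_gen K (extend \<alpha> \<union> extend \<beta>) \<subseteq> extend (congruence_gen L (\<alpha> \<union> \<beta>))"
    using extend_subset_iff[OF assms(1) congruence_extend[OF cL]]
      extend_subset_iff[OF assms(2) congruence_extend[OF cL]]
    by (intro congruence_gen_least congruence_extend cL) blast
qed

text \<open>A minimal congruence of \<open>L\<close> with a given join-irreducible extension is join-irreducible.\<close>

lemma join_irreducible_extend:
  assumes "join_irreducible (Con K) (extend \<alpha>)" "congruence L \<alpha>"
  obtains \<alpha>' where "join_irreducible (Con L) \<alpha>'" "extend \<alpha>' = extend \<alpha>"
proof -
  define P where "P \<gamma> \<longleftrightarrow> congruence L \<gamma> \<and> extend \<gamma> = extend \<alpha>" for \<gamma>
  have "P \<alpha>"
    using assms by (simp add: P_def)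
  then obtain \<mu> where \<mu>: "P \<mu>" "\<And>\<gamma>. P \<gamma> \<Longrightarrow> card \<mu> \<le> card \<gamma>"
    using ex_has_least_nat[of P \<alpha> card] by blast
  then have m: "congruence L \<mu>" "extend \<mu> = extend \<alpha>"
    by (auto simp: P_def)
  have fin: "finite \<mu>"
    using L.congruence_subset[OF m(1)] by (rule finite_subset) (simp add: L.finite_carrier)
  have ji: "extend \<mu> \<noteq> Id_on (carrier K)"
    "\<And>\<beta> \<gamma>. congruence K \<beta> \<Longrightarrow> congruence K \<gamma> \<Longrightarrow> extend \<mu> = congruence_gen K (\<beta> \<union> \<gamma>) \<Longrightarrow>
      extend \<mu> = \<beta> \<or> extend \<mu> = \<gamma>"
    using assms(1) unfolding K.join_irreducible_Con_iff m(2) by blast+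
  have "\<mu> \<noteq> Id_on (carrier L)"
  proof
    assume \<mu>_Id: "\<mu> = Id_on (carrier L)"
    have "\<mu> \<subseteq> restrict (Id_on (carrier K))"
      using e_closed by (auto simp: restrict_def \<mu>_Id)
    then have "extend \<mu> \<subseteq> Id_on (carrier K)"
      using extend_subset_iff[OF m(1) K.congruence_Id] by blast
    then show False
      using ji(1) K.Id_on_subset[OF congruence_extend[OF m(1)]] by blast
  qed
  moreover have "\<mu> = \<beta> \<or> \<mu> = \<gamma>"
    if *: "congruence L \<beta>" "congruence L \<gamma>" "\<mu> = congruence_gen L (\<beta> \<union> \<gamma>)" for \<beta> \<gamma>
  proof -
    have "extend \<mu> = extend \<beta> \<or> extend \<mu> = extend \<gamma>"
      using ji(2)[of "extend \<beta>" "extend \<gamma>"] extend_join[OF *(1,2)] congruence_extend * by simp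
    moreover have "\<beta> \<subseteq> \<mu>" "\<gamma> \<subseteq> \<mu>"
      using congruence_gen_superset[of "\<beta> \<union> \<gamma>" L] *(3) by auto
    moreover have "\<delta> = \<mu>" if "extend \<mu> = extend \<delta>" "congruence L \<delta>" "\<delta> \<subseteq> \<mu>" for \<delta>
    proof -
      have "P \<delta>"
        using that m(2) by (simp add: P_def)
      then show ?thesis
        using card_seteq[OF fin that(3)] \<mu>(2) by blast
    qed
    ultimately show ?thesis
      using *(1,2) by blast
  qed
  ultimately have "join_irreducible (Con L) \<mu>"
    unfolding L.join_irreducible_Con_iff using m(1) by blast
  then show ?thesis
    using that m(2) by blast
qed

end

section \<open>Separating the new congruence from the old ones\<close>

text \<open>Since \<open>l x \<le> l i < l c\<close>, the first coordinate of \<open>x\<close> is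
  absorbed by \<open>c\<close>, and only the second one can matter.\<close>

lemma (in grid_lattice) outer_join_mono:
  assumes "x \<in> carrier L" "x' \<in> carrier L" "c \<in> carrier L" "i \<in> carrier L" "x \<sqsubseteq> i"
    and "l i < l c" "r x \<le> r x'"
  shows "x \<squnion> c \<sqsubseteq> x' \<squnion> c"
proof (rule join_le)
  have le: "c \<sqsubseteq> x' \<squnion> c" "x' \<sqsubseteq> x' \<squnion> c" and car: "x' \<squnion> c \<in> carrier L"
    using assms join_left join_right by auto
  show "c \<sqsubseteq> x' \<squnion> c"
    using le by simp
  have "l x \<le> l i" "l c \<le> l (x' \<squnion> c)" "r x' \<le> r (x' \<squnion> c)"
    using assms le car le_iff by blast+
  then show "x \<sqsubseteq> x' \<squnion> c"
    using assms car by (simp add: le_iff)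
qed (use assms in auto)

context grid_lattice
begin

text \<open>If \<open>r d \<le> r p\<close>, both meets have the same second coordinate
  \<open>r d\<close>. Otherwise \<open>p \<sqinter> d\<close> keeps that of \<open>p\<close>, and
  \<open>(q \<sqinter> d) \<squnion> c\<close> is squeezed below
  \<open>q \<squnion> c = p \<squnion> c\<close>.\<close>

lemma outer_join_meet_aux:
  assumes c: "p \<in> carrier L" "q \<in> carrier L" "c \<in> carrier L" "d \<in> carrier L" "i \<in> carrier L"
    and le: "p \<sqsubseteq> i" "q \<sqsubseteq> i" and ic: "l i < l c" and eq: "p \<squnion> c = q \<squnion> c" and pq: "r p \<le> r q"
  shows "(p \<sqinter> d) \<squnion> c = (q \<sqinter> d) \<squnion> c"
proof -
  have pd: "p \<sqinter> d \<sqsubseteq> i" and qd: "q \<sqinter> d \<sqsubseteq> i"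
    using le_trans[OF meet_left[OF c(1,4)] le(1)] le_trans[OF meet_left[OF c(2,4)] le(2)] c by auto
  note mono = outer_join_mono[OF _ _ c(3,5) _ ic]
  have car: "p \<sqinter> d \<in> carrier L" "q \<sqinter> d \<in> carrier L"
    using c by auto
  have 1: "(p \<sqinter> d) \<squnion> c \<sqsubseteq> (q \<sqinter> d) \<squnion> c"
    using pq by (intro mono car pd) (simp add: r_meet c)
  have 2: "(q \<sqinter> d) \<squnion> c \<sqsubseteq> (p \<sqinter> d) \<squnion> c"
  proof (cases "r d \<le> r p")
    case True
    then show ?thesis
      using pq by (intro mono car qd) (simp add: r_meet c)
  next
    case False
    have "(q \<sqinter> d) \<squnion> c \<sqsubseteq> p \<squnion> c"
      unfolding eq by (intro mono car qd c) (simp add: r_meet c)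
    moreover have "p \<squnion> c \<sqsubseteq> (p \<sqinter> d) \<squnion> c"
      using False by (intro mono car le c) (simp add: r_meet c)
    ultimately show ?thesis
      using c car le_trans by (meson join_closed)
  qed
  show ?thesis
    using antisym[OF 1 2] c by simp
qed

lemma outer_join_meet:
  assumes c: "p \<in> carrier L" "q \<in> carrier L" "c \<in> carrier L" "d \<in> carrier L" "i \<in> carrier L"
    and le: "p \<sqsubseteq> i" "q \<sqsubseteq> i" and ic: "\<not> c \<sqsubseteq> i" and eq: "p \<squnion> c = q \<squnion> c"
  shows "(p \<sqinter> d) \<squnion> c = (q \<sqinter> d) \<squnion> c"
proof -
  interpret swap: grid_lattice L r l
    by (rule grid_swap)
  consider "l i < l c" | "r i < r c"
    using ic le_iff[OF c(3,5)] by linarith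
  then show ?thesis
  proof cases
    case 1
    then show ?thesis
      using outer_join_meet_aux[OF c le 1 eq]
        outer_join_meet_aux[OF c(2,1,3-5) le(2,1) 1 eq[symmetric]]
      by (cases "r p \<le> r q") auto
  next
    case 2
    then show ?thesis
      using swap.outer_join_meet_aux[OF c le 2 eq]
        swap.outer_join_meet_aux[OF c(2,1,3-5) le(2,1) 2 eq[symmetric]]
      by (cases "l p \<le> l q") auto
  qed
qed

end

text \<open>The separation uses only the position of \<open>t\<close> under \<open>i\<close>. For
  the fork, \<open>a\<close> and \<open>b\<close> are the lower covers \<open>al\<close> and
  \<open>ar\<close> of \<open>i\<close> in the old lattice. \<open>X_b\<close> and
  \<open>Y_a\<close> express their ideals by a threshold on one coordinate; since meets are minima,
  these ideals are prime below \<open>i\<close>.\<close>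

locale tight_top = grid_lattice K X Y for K :: "'b gorder" (structure) and X Y +
  fixes a b t i
  assumes closed: "a \<in> carrier K" "b \<in> carrier K" "t \<in> carrier K" "i \<in> carrier K"
    and below_i: "a \<sqsubseteq> i" "b \<sqsubseteq> i" "t \<sqsubseteq> i" and t_ne_i: "t \<noteq> i"
    and lower: "p \<in> carrier K \<Longrightarrow> p \<sqsubseteq> i \<Longrightarrow> p = i \<or> p = t \<or> p \<sqsubseteq> a \<or> p \<sqsubseteq> b"
    and upper: "p \<in> carrier K \<Longrightarrow> t \<sqsubseteq> p \<Longrightarrow> p = t \<or> i \<sqsubseteq> p"
    and X_b: "p \<in> carrier K \<Longrightarrow> p \<sqsubseteq> i \<Longrightarrow> p \<sqsubseteq> b \<longleftrightarrow> X p \<le> X b"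
    and Y_a: "p \<in> carrier K \<Longrightarrow> p \<sqsubseteq> i \<Longrightarrow> p \<sqsubseteq> a \<longleftrightarrow> Y p \<le> Y a"
    and lt: "X b < X t" "Y a < Y t"
begin

text \<open>The principal ideals of \<open>a\<close> and \<open>b\<close> are prime in that of \<open>i\<close>; the relation \<open>coarse\<close> collapses their four
  Boolean combinations, and \<open>refined\<close> splits \<open>{t, i}\<close> again.\<close>

definition coarse :: "'b \<Rightarrow> 'b \<Rightarrow> bool"
  where "coarse p q \<longleftrightarrow> p = q \<or>
    p \<sqsubseteq> i \<and> q \<sqsubseteq> i \<and> (p \<sqsubseteq> a \<longleftrightarrow> q \<sqsubseteq> a) \<and> (p \<sqsubseteq> b \<longleftrightarrow> q \<sqsubseteq> b)"

definition refined :: "'b \<Rightarrow> 'b \<Rightarrow> bool"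
  where "refined p q \<longleftrightarrow> coarse p q \<and> (p = i \<longleftrightarrow> q = i)"

text \<open>For an equivalence \<open>R\<close> this is the largest join-compatible relation inside
  it; compatibility with meets has to be proved separately.\<close>

definition collapse :: "('b \<Rightarrow> 'b \<Rightarrow> bool) \<Rightarrow> 'b rel"
  where "collapse R = {(p, q). p \<in> carrier K \<and> q \<in> carrier K \<and> (\<forall>c\<in>carrier K. R (p \<squnion> c) (q \<squnion> c))}"

lemma collapseD:
  assumes "(p, q) \<in> collapse R"
  shows "p \<in> carrier K" "q \<in> carrier K" "c \<in> carrier K \<Longrightarrow> R (p \<squnion> c) (q \<squnion> c)" "R p q"
proof -
  show pq: "p \<in> carrier K" "q \<in> carrier K" "c \<in> carrier K \<Longrightarrow> R (p \<squnion> c) (q \<squnion> c)" for c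
    using assms by (auto simp: collapse_def)
  \<comment> \<open>Joining with \<open>p \<sqinter> q\<close> leaves both elements fixed, so the
    tests include \<open>R p q\<close> itself.\<close>
  have "p \<squnion> (p \<sqinter> q) = p" "q \<squnion> (p \<sqinter> q) = q"
    using pq meet_left[of p q] meet_right[of p q] by (simp_all add: join_absorb)
  then show "R p q"
    using pq(3)[of "p \<sqinter> q"] pq(1,2) by simp
qed

lemma join_le_iff: "p \<in> carrier K \<Longrightarrow> q \<in> carrier K \<Longrightarrow> s \<in> carrier K \<Longrightarrow> p \<squnion> q \<sqsubseteq> s \<longleftrightarrow> p \<sqsubseteq> s \<and> q \<sqsubseteq> s"
  using join_le join_left join_right le_trans by (meson join_closed)

text \<open>Distinct related elements lie below \<open>i\<close>. If the testing element
  \<open>c\<close> does not, neither do the joins with it, so \<open>coarse\<close> makes them equal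
  and \<open>outer_join_meet\<close> carries the equality over to the meets. What remains is the
  case inside the ideal of \<open>i\<close>.\<close>

lemma congruence_collapse:
  assumes refl: "\<And>p. R p p" and sym: "\<And>p q. R p q \<Longrightarrow> R q p"
    and trans: "\<And>p q s. R p q \<Longrightarrow> R q s \<Longrightarrow> R p s" and coarse: "\<And>p q. R p q \<Longrightarrow> coarse p q"
    and inner: "\<And>p q c d. (p, q) \<in> collapse R \<Longrightarrow> p \<sqsubseteq> i \<Longrightarrow> q \<sqsubseteq> i \<Longrightarrow> c \<in> carrier K \<Longrightarrow> c \<sqsubseteq> i \<Longrightarrow>
      d \<in> carrier K \<Longrightarrow> R ((p \<sqinter> d) \<squnion> c) ((q \<sqinter> d) \<squnion> c)"
  shows "congruence K (collapse R)"
proof (rule congruenceI)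
  show "collapse R \<subseteq> carrier K \<times> carrier K"
    by (auto simp: collapse_def)
  show "(p, p) \<in> collapse R" if "p \<in> carrier K" for p
    using that refl by (simp add: collapse_def)
  show "(q, p) \<in> collapse R" if "(p, q) \<in> collapse R" for p q
    using collapseD[OF that] sym by (simp add: collapse_def)
  show "(p, s) \<in> collapse R" if "(p, q) \<in> collapse R" "(q, s) \<in> collapse R" for p q s
    using collapseD(1-3)[OF that(1)] collapseD(1-3)[OF that(2)] trans unfolding collapse_def by blast
  show "(p \<squnion> c, q \<squnion> c) \<in> collapse R" if pq: "(p, q) \<in> collapse R" and c: "c \<in> carrier K" for p q c
  proof -
    have "R ((p \<squnion> c) \<squnion> d) ((q \<squnion> c) \<squnion> d)" if d: "d \<in> carrier K" for d
    proof -
      have "(p \<squnion> c) \<squnion> d = p \<squnion> (c \<squnion> d)" "(q \<squnion> c) \<squnion> d = q \<squnion> (c \<squnion> d)"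
        using weak_join_assoc[of _ c d] collapseD[OF pq] c d eq_is_equal by auto
      then show ?thesis
        using collapseD(3)[OF pq, of "c \<squnion> d"] c d by simp
    qed
    then show ?thesis
      using collapseD[OF pq] c by (simp add: collapse_def)
  qed
  show "(p \<sqinter> d, q \<sqinter> d) \<in> collapse R" if pq: "(p, q) \<in> collapse R" and d: "d \<in> carrier K" for p q d
  proof (cases "p = q")
    case True
    then show ?thesis
      using collapseD(1)[OF pq] d refl by (simp add: collapse_def)
  next
    case False
    note car = collapseD(1,2)[OF pq]
    have le: "p \<sqsubseteq> i" "q \<sqsubseteq> i"
      using coarse[OF collapseD(4)[OF pq]] False by (auto simp: coarse_def)
    have "R ((p \<sqinter> d) \<squnion> c) ((q \<sqinter> d) \<squnion> c)" if c: "c \<in> carrier K" for c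
    proof (cases "c \<sqsubseteq> i")
      case True
      then show ?thesis
        using inner pq le c d by blast
    next
      case False
      then have "p \<squnion> c = q \<squnion> c"
        using coarse[OF collapseD(3)[OF pq c]] car c closed by (simp add: coarse_def join_le_iff)
      then show ?thesis
        using outer_join_meet[OF car c d closed(4) le False] refl by simp
    qed
    then show ?thesis
      using car d by (simp add: collapse_def)
  qed
qed

text \<open>By primeness \<open>x \<sqinter> d\<close> is below \<open>a\<close> iff
  \<open>x\<close> is or \<open>d\<close> meets the threshold, so the answer depends only on the
  cell of \<open>x\<close>. The condition on \<open>d\<close> is stated by coordinates because
  \<open>d\<close> may lie outside the ideal of \<open>i\<close>.\<close>

lemma coarse_inner:
  assumes "coarse p q" "p \<in> carrier K" "q \<in> carrier K" "p \<sqsubseteq> i" "q \<sqsubseteq> i"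
    and "c \<in> carrier K" "c \<sqsubseteq> i" "d \<in> carrier K"
  shows "coarse ((p \<sqinter> d) \<squnion> c) ((q \<sqinter> d) \<squnion> c)"
proof -
  have le: "p \<sqinter> d \<sqsubseteq> i" "q \<sqinter> d \<sqsubseteq> i"
    using assms closed meet_left le_trans by (meson meet_closed)+
  have eq: "p \<sqsubseteq> a \<longleftrightarrow> q \<sqsubseteq> a" "p \<sqsubseteq> b \<longleftrightarrow> q \<sqsubseteq> b"
    using assms(1) by (auto simp: coarse_def)
  have "x \<sqinter> d \<sqsubseteq> a \<longleftrightarrow> x \<sqsubseteq> a \<or> Y d \<le> Y a" "x \<sqinter> d \<sqsubseteq> b \<longleftrightarrow> x \<sqsubseteq> b \<or> X d \<le> X b"
    if "x \<in> carrier K" "x \<sqsubseteq> i" "x \<sqinter> d \<sqsubseteq> i" for x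
    using that assms X_b[of x] X_b[of "x \<sqinter> d"] Y_a[of x] Y_a[of "x \<sqinter> d"]
    by (auto simp: l_meet r_meet)
  then have "p \<sqinter> d \<sqsubseteq> a \<longleftrightarrow> q \<sqinter> d \<sqsubseteq> a" "p \<sqinter> d \<sqsubseteq> b \<longleftrightarrow> q \<sqinter> d \<sqsubseteq> b"
    using assms le eq by auto
  then show ?thesis
    using assms le closed by (auto simp: coarse_def join_le_iff)
qed

lemma t_not_below: "\<not> t \<sqsubseteq> a" "\<not> t \<sqsubseteq> b" "\<not> i \<sqsubseteq> a" "\<not> i \<sqsubseteq> b"
proof -
  show t: "\<not> t \<sqsubseteq> a" "\<not> t \<sqsubseteq> b"
    using lt closed le_iff by auto
  then show "\<not> i \<sqsubseteq> a" "\<not> i \<sqsubseteq> b"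
    using below_i closed le_trans by blast+
qed

lemma coarse_equiv:
  "coarse p p" "coarse p q \<Longrightarrow> coarse q p" "coarse p q \<Longrightarrow> coarse q s \<Longrightarrow> coarse p s"
  by (auto simp: coarse_def)

lemma refined_equiv:
  "refined p p" "refined p q \<Longrightarrow> refined q p" "refined p q \<Longrightarrow> refined q s \<Longrightarrow> refined p s"
  using coarse_equiv(1)[of p] coarse_equiv(2)[of p q] coarse_equiv(3)[of p q s]
  by (simp_all add: refined_def)

lemma congruence_coarse: "congruence K (collapse coarse)"
proof (rule congruence_collapse)
  show "coarse p s" if "coarse p q" "coarse q s" for p q s
    using that by (rule coarse_equiv(3))
  show "coarse ((p \<sqinter> d) \<squnion> c) ((q \<sqinter> d) \<squnion> c)"
    if "(p, q) \<in> collapse coarse" "p \<sqsubseteq> i" "q \<sqsubseteq> i" "c \<in> carrier K" "c \<sqsubseteq> i" "d \<in> carrier K" for p q c d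
    using that coarse_inner[of p q c d] collapseD(1,2,4)[OF that(1)] by simp
qed (auto intro: coarse_equiv(1,2))

lemma t_join: "c \<in> carrier K \<Longrightarrow> \<not> c \<sqsubseteq> t \<Longrightarrow> i \<sqsubseteq> t \<squnion> c"
  using upper[of "t \<squnion> c"] join_left[of t c] join_right[of t c] closed by auto

lemma t_join_below:
  assumes "c \<in> carrier K" "c \<sqsubseteq> i" "\<not> c \<sqsubseteq> t"
  shows "c \<squnion> t = i" "t \<squnion> c = i"
proof -
  show "t \<squnion> c = i"
    using t_join[OF assms(1,3)] assms join_le[OF below_i(3) assms(2)] closed by (intro antisym) auto
  then show "c \<squnion> t = i"
    by (simp add: join_comm)
qed

text \<open>If joining with \<open>c\<close> gave \<open>t\<close> instead of \<open>i\<close> on the left, then \<open>q \<sqinter> d\<close> would lie below \<open>a\<close> or \<open>b\<close>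
  but not below \<open>t\<close>.  So one coordinate of \<open>q\<close>, \<open>d\<close> and also \<open>p\<close> exceeds that of \<open>t\<close>, contrary to
  \<open>p \<sqinter> d \<sqsubseteq> t\<close>.\<close>

lemma refined_inner_aux:
  assumes pq: "(p, q) \<in> collapse refined" and le: "p \<sqsubseteq> i" "q \<sqsubseteq> i"
    and c: "c \<in> carrier K" "c \<sqsubseteq> i" "d \<in> carrier K" and i: "(q \<sqinter> d) \<squnion> c = i"
  shows "(p \<sqinter> d) \<squnion> c = i"
proof (rule ccontr)
  assume n: "(p \<sqinter> d) \<squnion> c \<noteq> i"
  note car = collapseD(1,2)[OF pq]
  have f: "refined p q" "refined (p \<squnion> t) (q \<squnion> t)"
    using collapseD(3,4)[OF pq] closed by auto
  have co: "coarse ((p \<sqinter> d) \<squnion> c) i"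
    using coarse_inner[of p q c d] f(1) car le c i by (simp add: refined_def)
  let ?m = "(p \<sqinter> d) \<squnion> c"
  have m: "?m \<in> carrier K" "?m \<sqsubseteq> i" "\<not> ?m \<sqsubseteq> a" "\<not> ?m \<sqsubseteq> b"
    using co n t_not_below car c by (auto simp: coarse_def)
  \<comment> \<open>The cell outside both ideals contains nothing but \<open>t\<close> and
    \<open>i\<close>.\<close>
  have "?m = t"
    using lower[OF m(1,2)] m n by blast
  then have ct: "c \<sqsubseteq> t" and pdt: "p \<sqinter> d \<sqsubseteq> t"
    using join_left[of "p \<sqinter> d" c] join_right[of "p \<sqinter> d" c] car c by auto
  have e: "q \<sqinter> d \<in> carrier K" "q \<sqinter> d \<sqsubseteq> q" "q \<sqinter> d \<sqsubseteq> d" "q \<sqinter> d \<sqsubseteq> i"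
    using car c meet_left meet_right le closed le_trans[of "q \<sqinter> d" q i] by auto
  have nt: "\<not> q \<sqinter> d \<sqsubseteq> t"
  proof
    assume "q \<sqinter> d \<sqsubseteq> t"
    then have "i \<sqsubseteq> t"
      using i ct join_le[of "q \<sqinter> d" t c] e c closed by auto
    then show False
      using below_i t_ne_i antisym closed by blast
  qed
  have qi: "q \<noteq> i" and "p \<noteq> i"
  proof -
    show "q \<noteq> i"
    proof
      assume "q = i"
      then have "p = i"
        using f(1) by (simp add: refined_def)
      then show False
        using n i \<open>q = i\<close> by simp
    qed
    then show "p \<noteq> i"
      using f(1) by (simp add: refined_def)
  qed
  have nqt: "\<not> q \<sqsubseteq> t"
    using nt e le_trans car closed by meson
  \<comment> \<open>Testing the pair with \<open>t\<close> transfers this to \<open>p\<close>: if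
    \<open>p\<close> were below \<open>t\<close>, its join with \<open>t\<close> would be
    \<open>t\<close>, which \<open>refined\<close> keeps apart from \<open>i\<close>.\<close>
  then have "q \<squnion> t = i"
    using t_join_below car le by blast
  then have "p \<squnion> t = i"
    using f(2) by (simp add: refined_def)
  then have npt: "\<not> p \<sqsubseteq> t"
    using join_absorb(1)[of p t] car closed t_ne_i by auto
  have "q \<sqsubseteq> a \<or> q \<sqsubseteq> b"
    using lower[OF car(2) le(2)] qi nqt closed by auto
  then show False
  proof
    assume qa: "q \<sqsubseteq> a"
    then have pa: "p \<sqsubseteq> a"
      using f(1) by (auto simp: refined_def coarse_def)
    have "Y q \<le> Y t" "Y p \<le> Y t"
      using qa pa Y_a car le lt by fastforce+
    then have "X t < X p" "Y (q \<sqinter> d) \<le> Y t"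
      using npt car c closed le_iff[of p t] by (auto simp: r_meet)
    moreover have "X t < X (q \<sqinter> d)"
      using nt calculation le_iff[OF e(1) closed(3)] by auto
    ultimately have "X t < X (p \<sqinter> d)"
      using car c by (simp add: l_meet)
    then show False
      using pdt le_iff[of "p \<sqinter> d" t] car c closed by auto
  next
    assume qb: "q \<sqsubseteq> b"
    then have pb: "p \<sqsubseteq> b"
      using f(1) by (auto simp: refined_def coarse_def)
    have "X q \<le> X t" "X p \<le> X t"
      using qb pb X_b car le lt by fastforce+
    then have "Y t < Y p" "X (q \<sqinter> d) \<le> X t"
      using npt car c closed le_iff[of p t] by (auto simp: l_meet)
    moreover have "Y t < Y (q \<sqinter> d)"
      using nt calculation le_iff[OF e(1) closed(3)] by auto
    ultimately have "Y t < Y (p \<sqinter> d)"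
      using car c by (simp add: r_meet)
    then show False
      using pdt le_iff[of "p \<sqinter> d" t] car c closed by auto
  qed
qed

lemma congruence_refined: "congruence K (collapse refined)"
proof (rule congruence_collapse)
  fix p q c d
  assume *: "(p, q) \<in> collapse refined" "p \<sqsubseteq> i" "q \<sqsubseteq> i" "c \<in> carrier K" "c \<sqsubseteq> i" "d \<in> carrier K"
  have "(q, p) \<in> collapse refined"
    using *(1) refined_equiv(2) by (auto simp: collapse_def)
  then show "refined ((p \<sqinter> d) \<squnion> c) ((q \<sqinter> d) \<squnion> c)"
    using refined_inner_aux[of p q c d] refined_inner_aux[of q p c d] * collapseD(1,2,4)[OF *(1)]
      coarse_inner[of p q c d] by (auto simp: refined_def)
next
  show "refined p s" if "refined p q" "refined q s" for p q s
    using that by (rule refined_equiv(3))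
  show "coarse p q" if "refined p q" for p q
    using that by (simp add: refined_def)
qed (auto intro: refined_equiv(1,2))

text \<open>A join with \<open>c \<sqsubseteq> t\<close> leaves both elements in their common cell;
  any other join with \<open>t\<close> is already above \<open>i\<close>, so the two joins
  agree.\<close>

lemma t_i_coarse: "(t, i) \<in> collapse coarse"
proof -
  have "coarse (t \<squnion> c) (i \<squnion> c)" if c: "c \<in> carrier K" for c
  proof (cases "c \<sqsubseteq> t")
    case True
    moreover have "c \<sqsubseteq> i"
      using le_trans[OF True below_i(3)] c closed by blast
    ultimately show ?thesis
      using c closed below_i t_not_below by (simp add: join_absorb coarse_def)
  next
    case False
    have "t \<squnion> c = i \<squnion> c"
      using t_join[OF c False] join_right[of t c] join_left[of i c] join_right[of i c] c closed
        le_trans[OF below_i(3) join_left[of i c]]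
      by (intro antisym join_le) auto
    then show ?thesis
      by (simp add: coarse_def)
  qed
  then show ?thesis
    using closed by (simp add: collapse_def)
qed

text \<open>The finer test could fail only if one join is \<open>i\<close> and the other is
  \<open>t\<close>. Then the element on the side of \<open>t\<close> lies below \<open>t\<close>,
  hence by \<open>S\<close> below \<open>a\<close> and \<open>b\<close>. The other one is in the
  same cell, so it is below \<open>t\<close> too, and its join with \<open>c \<sqsubseteq> t\<close>
  cannot be \<open>i\<close>.\<close>

lemma coarse_refined:
  assumes uw: "(u, w) \<in> collapse coarse" and S: "u \<sqsubseteq> t \<Longrightarrow> u \<sqsubseteq> a \<and> u \<sqsubseteq> b" "w \<sqsubseteq> t \<Longrightarrow> w \<sqsubseteq> a \<and> w \<sqsubseteq> b"
  shows "(u, w) \<in> collapse refined"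
proof (cases "u = w")
  case True
  then show ?thesis
    using collapseD(1)[OF uw] refined_equiv(1) by (simp add: collapse_def)
next
  case False
  have main: "w \<squnion> c \<noteq> i \<or> u \<squnion> c = i"
    if uw: "(u, w) \<in> collapse coarse" "u \<noteq> w" and S: "u \<sqsubseteq> t \<Longrightarrow> u \<sqsubseteq> a \<and> u \<sqsubseteq> b" and c: "c \<in> carrier K"
    for u w c
  proof (rule ccontr)
    assume n: "\<not> ?thesis"
    note car = collapseD(1,2)[OF uw(1)]
    have co: "coarse (u \<squnion> c) i" "coarse u w"
      using collapseD(3)[OF uw(1) c] collapseD(4)[OF uw(1)] n by auto
    let ?m = "u \<squnion> c"
    have m: "?m \<in> carrier K" "?m \<sqsubseteq> i" "\<not> ?m \<sqsubseteq> a" "\<not> ?m \<sqsubseteq> b"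
      using co n t_not_below car c by (auto simp: coarse_def)
    have mt: "?m = t"
      using lower[OF m(1,2)] m n by blast
    then have "u \<sqsubseteq> t" and ct: "c \<sqsubseteq> t"
      using join_left[of u c] join_right[of u c] car c by auto
    then have "w \<sqsubseteq> a" "w \<sqsubseteq> b"
      using S co(2) uw(2) by (auto simp: coarse_def)
    \<comment> \<open>\<open>lt\<close> gives both coordinates: being below \<open>b\<close> bounds
      \<open>X w\<close>, being below \<open>a\<close> bounds \<open>Y w\<close>.\<close>
    then have "w \<sqsubseteq> t"
      using le_iff car closed lt by fastforce
    then have "w \<squnion> c \<sqsubseteq> t"
      using ct join_le car c closed by blast
    then show False
      using n below_i t_ne_i antisym closed by metis
  qed
  have "refined (u \<squnion> c) (w \<squnion> c)" if c: "c \<in> carrier K" for c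
  proof -
    have "(w, u) \<in> collapse coarse"
      using uw coarse_equiv(2) by (auto simp: collapse_def)
    then show ?thesis
      using main[OF uw False S(1) c] main[of w u c] S(2) False c collapseD(3)[OF uw c]
      by (auto simp: refined_def)
  qed
  then show ?thesis
    using collapseD(1,2)[OF uw] by (simp add: collapse_def)
qed

lemma t_i_not_refined: "(t, i) \<notin> collapse refined"
  using collapseD(4)[of t i refined] t_ne_i by (auto simp: refined_def)

text \<open>The second assumption stands for generators that are old: such an element below
  \<open>t\<close> is below the meet of \<open>a\<close> and \<open>b\<close>.\<close>

lemma con_not_generated:
  assumes "A \<subseteq> con K t i"
    and "\<And>u w. (u, w) \<in> A \<Longrightarrow> (u \<sqsubseteq> t \<longrightarrow> u \<sqsubseteq> a \<and> u \<sqsubseteq> b) \<and> (w \<sqsubseteq> t \<longrightarrow> w \<sqsubseteq> a \<and> w \<sqsubseteq> b)"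
  shows "con K t i \<noteq> congruence_gen K A"
proof
  assume eq: "con K t i = congruence_gen K A"
  have "con K t i \<subseteq> collapse coarse"
    by (rule con_least[OF congruence_coarse t_i_coarse])
  then have sub: "A \<subseteq> collapse coarse"
    using assms(1) by simp
  have "A \<subseteq> collapse refined"
  proof safe
    fix u w
    assume uw: "(u, w) \<in> A"
    show "(u, w) \<in> collapse refined"
      using coarse_refined[OF subsetD[OF sub uw]] assms(2)[OF uw] by simp
  qed
  then have "congruence_gen K A \<subseteq> collapse refined"
    by (rule congruence_gen_least[OF congruence_refined])
  then show False
    using t_i_not_refined con_contains[of t i K] eq by blast
qed

end

section \<open>Joins and congruences of the fork\<close>

context forked
begin

text \<open>Each new element has a greatest old element below it, \<open>v\<close> for
  \<open>t\<close> and \<open>y_k\<close> for \<open>z_k\<close>. A new upper bound of two old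
  elements therefore lies above an old upper bound.\<close>

lemma K_join_old:
  assumes "x \<in> carrier L" "y \<in> carrier L"
  shows "Old (x \<squnion> y) = Old x \<squnion>\<^bsub>K\<^esub> Old y"
proof (rule K.antisym)
  have car: "Old x \<in> carrier K" "Old y \<in> carrier K"
    using assms by auto
  let ?j = "Old x \<squnion>\<^bsub>K\<^esub> Old y"
  have j: "?j \<in> carrier K" "Old x \<sqsubseteq>\<^bsub>K\<^esub> ?j" "Old y \<sqsubseteq>\<^bsub>K\<^esub> ?j"
    using car K.join_left K.join_right by auto
  show "?j \<sqsubseteq>\<^bsub>K\<^esub> Old (x \<squnion> y)"
    using assms join_left[of x y] join_right[of x y] by (intro K.join_le) (auto simp: K_le le_iff)
  have up: "x \<squnion> y \<sqsubseteq> z" if "z \<in> carrier L" "x \<sqsubseteq> z" "y \<sqsubseteq> z" for z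
    using that assms join_le by blast
  from j(1) show "Old (x \<squnion> y) \<sqsubseteq>\<^bsub>K\<^esub> ?j"
  proof (cases rule: carrier_K_cases)
    case (Old z)
    then show ?thesis
      using j assms up[of z] by (simp add: K_le le_iff)
  next
    case t
    then show ?thesis
      using j assms up[OF square_closed(1)] square_closed by (simp add: K_le le_iff)
  next
    case (zl k)
    then show ?thesis
      using j assms up[of "yl k"] left.index_props[of k] by (simp add: K_le le_iff)
  next
    case (zr k)
    then show ?thesis
      using j assms up[of "yr k"] right.index_props[of k] by (simp add: K_le le_iff)
  qed
qed (use assms in auto)

lemma K_meet_old:
  assumes "x \<in> carrier L" "y \<in> carrier L"
  shows "Old (x \<sqinter> y) = Old x \<sqinter>\<^bsub>K\<^esub> Old y"
  using assms by (intro K.eqI) (auto simp: K.l_meet K.r_meet l_meet r_meet)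

sublocale embedding: lattice_embedding L K Old
  by unfold_locales (auto simp: K_join_old K_meet_old)

lemma minimal_extension_eq: "minimal_extension L v al ar i \<alpha> = embedding.extend \<alpha>"
  by (simp add: minimal_extension_def embedding.extend_def)

text \<open>All new elements lie below \<open>t\<close> or equal it, and the old elements below
  \<open>t\<close> are those below \<open>v\<close>.\<close>

lemma above_old:
  assumes "q \<in> carrier L" "\<not> q \<sqsubseteq> v" "p \<in> carrier K" "Old q \<sqsubseteq>\<^bsub>K\<^esub> p"
  obtains x where "p = Old x" "x \<in> carrier L" "q \<sqsubseteq> x"
proof -
  have q: "l v < l q \<or> r v < r q"
    using assms square_closed le_iff by auto
  from assms(3) show ?thesis
  proof (cases rule: carrier_K_cases)
    case (Old x)
    then show ?thesis
      using that assms by (simp add: K_le le_iff)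
  next
    case t
    then show ?thesis
      using q assms by (simp add: K_le)
  next
    case (zl k)
    then show ?thesis
      using q assms left.index_bounds[of k] by (simp add: K_le)
  next
    case (zr k)
    then show ?thesis
      using q assms right.index_bounds[of k] by (simp add: K_le)
  qed
qed

text \<open>A join with an old element not below \<open>v\<close> is old by
  \<open>above_old\<close>, so it cannot distinguish \<open>n\<close> from the least old element
  \<open>x\<close> above \<open>n\<close>.\<close>

lemma new_join_old:
  assumes n: "n \<in> carrier K" "x \<in> carrier L" "n \<sqsubseteq>\<^bsub>K\<^esub> Old x"
    and least: "\<And>y. y \<in> carrier L \<Longrightarrow> n \<sqsubseteq>\<^bsub>K\<^esub> Old y \<Longrightarrow> x \<sqsubseteq> y"
    and q: "q \<in> carrier L" "\<not> q \<sqsubseteq> v"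
  shows "n \<squnion>\<^bsub>K\<^esub> Old q = Old (x \<squnion> q)"
proof (rule K.antisym)
  let ?j = "n \<squnion>\<^bsub>K\<^esub> Old q"
  have j: "?j \<in> carrier K" "n \<sqsubseteq>\<^bsub>K\<^esub> ?j" "Old q \<sqsubseteq>\<^bsub>K\<^esub> ?j"
    using n q K.join_left K.join_right by auto
  have xq: "Old (x \<squnion> q) = Old x \<squnion>\<^bsub>K\<^esub> Old q"
    using n q K_join_old by blast
  have "n \<sqsubseteq>\<^bsub>K\<^esub> Old (x \<squnion> q)" "Old q \<sqsubseteq>\<^bsub>K\<^esub> Old (x \<squnion> q)"
    using n q K.le_trans[OF n(3) K.join_left[of "Old x" "Old q"]] K.join_right[of "Old x" "Old q"]
    unfolding xq by auto
  then show "?j \<sqsubseteq>\<^bsub>K\<^esub> Old (x \<squnion> q)"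
    using n q by (intro K.join_le) auto
  obtain y where y: "?j = Old y" "y \<in> carrier L" "q \<sqsubseteq> y"
    using above_old[OF q j(1,3)] by metis
  have "x \<squnion> q \<sqsubseteq> y"
    using least[of y] j y n q join_le by simp
  then show "Old (x \<squnion> q) \<sqsubseteq>\<^bsub>K\<^esub> ?j"
    using y n q by (simp add: K_le le_iff)
qed (use n q in auto)

lemma zl_join_old:
  assumes "k \<in> Nl" "q \<in> carrier L" "\<not> q \<sqsubseteq> v"
  shows "New_zl k \<squnion>\<^bsub>K\<^esub> Old q = Old (xl k \<squnion> q)"
proof (rule new_join_old)
  show "New_zl k \<sqsubseteq>\<^bsub>K\<^esub> Old (xl k)"
    using left.index_props[OF assms(1)] assms by (simp add: K_le)
  show "xl k \<sqsubseteq> y" if "y \<in> carrier L" "New_zl k \<sqsubseteq>\<^bsub>K\<^esub> Old y" for y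
    using left.above_new[OF assms(1) that(1)] that assms by (simp add: K_le)
qed (use assms left.index_props in auto)

lemma zr_join_old:
  assumes "k \<in> Nr" "q \<in> carrier L" "\<not> q \<sqsubseteq> v"
  shows "New_zr k \<squnion>\<^bsub>K\<^esub> Old q = Old (xr k \<squnion> q)"
proof (rule new_join_old)
  show "New_zr k \<sqsubseteq>\<^bsub>K\<^esub> Old (xr k)"
    using right.index_props[OF assms(1)] assms by (simp add: K_le)
  show "xr k \<sqsubseteq> y" if "y \<in> carrier L" "New_zr k \<sqsubseteq>\<^bsub>K\<^esub> Old y" for y
    using right.above_new[OF assms(1) that(1)] that assms by (simp add: K_le)
qed (use assms right.index_props in auto)

lemma t_join_old:
  assumes "q \<in> carrier L" "\<not> q \<sqsubseteq> v"
  shows "New_t \<squnion>\<^bsub>K\<^esub> Old q = Old (i \<squnion> q)"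
proof (rule new_join_old)
  show "New_t \<sqsubseteq>\<^bsub>K\<^esub> Old i"
    using square_lr square_closed by (simp add: K_le)
  show "i \<sqsubseteq> y" if "y \<in> carrier L" "New_t \<sqsubseteq>\<^bsub>K\<^esub> Old y" for y
    using new_below_i[OF that(1)] that by (simp add: K_le)
qed (use assms square_closed in auto)

lemma not_below_v:
  "k \<in> Nl \<Longrightarrow> \<not> xl k \<sqsubseteq> v" "k \<in> Nr \<Longrightarrow> \<not> xr k \<sqsubseteq> v" "\<not> al \<sqsubseteq> v" "\<not> ar \<sqsubseteq> v"
  using left.index_props[of k] right.index_props[of k] square_closed square_lr by (auto simp: le_iff)

lemma join_eq_i:
  assumes "x \<in> carrier L" "x \<sqsubseteq> i" "y \<in> carrier L" "y \<sqsubseteq> i" "l v < l x" "r v < r y"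
  shows "x \<squnion> y = i"
proof (rule antisym)
  have j: "x \<squnion> y \<in> carrier L" "x \<sqsubseteq> x \<squnion> y" "y \<sqsubseteq> x \<squnion> y"
    using assms join_left join_right by auto
  then have "l v < l (x \<squnion> y)" "r v < r (x \<squnion> y)"
    using assms le_iff by fastforce+
  then show "i \<sqsubseteq> x \<squnion> y"
    using new_below_i j by blast
  show "x \<squnion> y \<sqsubseteq> i"
    using assms join_le square_closed by blast
qed (use assms square_closed in auto)

lemma xl_below_i: "k \<in> Nl \<Longrightarrow> xl k \<sqsubseteq> i" and xr_below_i: "k \<in> Nr \<Longrightarrow> xr k \<sqsubseteq> i"
  and al_below_i: "al \<sqsubseteq> i" and ar_below_i: "ar \<sqsubseteq> i"
proof -
  show le: "al \<sqsubseteq> i" "ar \<sqsubseteq> i"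
    using square coversD unfolding covering_square_def by blast+
  show "k \<in> Nl \<Longrightarrow> xl k \<sqsubseteq> i"
    using left.index_props(6,8)[of k] le square_closed le_trans by blast
  show "k \<in> Nr \<Longrightarrow> xr k \<sqsubseteq> i"
    using right.index_props(6,8)[of k] le square_closed le_trans by blast
qed

text \<open>A join with a suitable \<open>c\<close> moves a pair that involves new elements to old elements or to
  \<open>(t, i)\<close>, and the meet with \<open>q\<close> moves it back.\<close>

lemma transfer:
  assumes "congruence K \<beta>" "congruence K \<beta>'" "(p, q) \<in> \<beta>" "c \<in> carrier K"
    and "(p \<squnion>\<^bsub>K\<^esub> c, q \<squnion>\<^bsub>K\<^esub> c) \<in> \<beta> \<Longrightarrow> (p \<squnion>\<^bsub>K\<^esub> c, q \<squnion>\<^bsub>K\<^esub> c) \<in> \<beta>'"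
    and "(p \<squnion>\<^bsub>K\<^esub> c) \<sqinter>\<^bsub>K\<^esub> q = p"
  shows "(p, q) \<in> \<beta>'"
proof -
  note D = congruenceD[OF assms(1)] and D' = congruenceD[OF assms(2)]
  have car: "p \<in> carrier K" "q \<in> carrier K"
    using D(1,2) assms(3) by auto
  have "(p \<squnion>\<^bsub>K\<^esub> c, q \<squnion>\<^bsub>K\<^esub> c) \<in> \<beta>'"
    using assms(5) D(6)[OF assms(3) D(3)[OF assms(4)]] by blast
  then have "((p \<squnion>\<^bsub>K\<^esub> c) \<sqinter>\<^bsub>K\<^esub> q, (q \<squnion>\<^bsub>K\<^esub> c) \<sqinter>\<^bsub>K\<^esub> q) \<in> \<beta>'"
    using D'(7)[OF _ D'(3)[OF car(2)]] by blast
  moreover have "(q \<squnion>\<^bsub>K\<^esub> c) \<sqinter>\<^bsub>K\<^esub> q = q"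
    using car assms(4) K.join_left by (intro K.meet_absorb) auto
  ultimately show ?thesis
    using assms(6) by simp
qed

text \<open>A comparable pair factors through steps of the kinds old-old, \<open>y_k < z_k\<close>,
  \<open>z_j < z_k\<close>, \<open>z_1 < t\<close>, \<open>z_k < x_k\<close> and
  \<open>t < i\<close>. Convexity puts every step into \<open>\<beta>\<close>, and each step is then
  derived in \<open>\<beta>'\<close>. Only the last two kinds use the pair
  \<open>(t, i)\<close>.\<close>

lemma congruence_generated:
  assumes \<beta>: "congruence K \<beta>" and \<beta>': "congruence K \<beta>'"
    and old: "\<And>x y. (Old x, Old y) \<in> \<beta> \<Longrightarrow> (Old x, Old y) \<in> \<beta>'"
    and new: "(New_t, Old i) \<in> \<beta> \<Longrightarrow> (New_t, Old i) \<in> \<beta>'"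
  shows "\<beta> \<subseteq> \<beta>'"
proof (rule K.congruence_subsetI[OF \<beta> \<beta>'])
  note tr = congruenceD(5)[OF \<beta>'] and rf = congruenceD(3)[OF \<beta>']
  note tf = transfer[OF \<beta> \<beta>']
  \<comment> \<open>Convexity of congruence classes, phrased in coordinates.\<close>
  have conv: "(x, y) \<in> \<beta>" if "(p, q) \<in> \<beta>" "x \<in> carrier K" "y \<in> carrier K"
      "X p \<le> X x" "Y p \<le> Y x" "X x \<le> X y" "Y x \<le> Y y" "X y \<le> X q" "Y y \<le> Y q" for p q x y
    using K.congruence_interval[OF \<beta> that(1) _ _ _ that(2,3)] that congruenceD(1,2)[OF \<beta> that(1)]
    by (simp add: K_le)
  have bl: "l v < l (xl k)" "r (xl k) \<le> r v" "r (yl k) = r (xl k)" "l (yl k) = l v" "xl k \<in> carrier L"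
      "yl k \<in> carrier L" "r (xl k) \<le> r (xl 1)" if "k \<in> Nl" for k
    using left.index_props[OF that] left.index_bounds[OF that] left.start_index r_v by auto
  have br: "r v < r (xr k)" "l (xr k) \<le> l v" "l (yr k) = l (xr k)" "r (yr k) = r v" "xr k \<in> carrier L"
      "yr k \<in> carrier L" "l (xr k) \<le> l (xr 1)" if "k \<in> Nr" for k
    using right.index_props[OF that] right.index_bounds[OF that] right.start_index l_v by auto
  note sq = square_closed square_lr r_v l_v al_below_i ar_below_i
  note start = left.start_index right.start_index
  \<comment> \<open>Joining with \<open>xl j\<close> gives the old pair \<open>xl j\<close>,
    \<open>xl k\<close>; it has the same rows as \<open>New_zl j\<close>, \<open>New_zl k\<close>,
    so the meet with \<open>New_zl k\<close> restores the original pair.\<close>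
  have zl_zl: "(New_zl j, New_zl k) \<in> \<beta>'" if "(New_zl j, New_zl k) \<in> \<beta>" "j \<in> Nl" "k \<in> Nl" "k \<le> j" for j k
  proof (rule tf[OF that(1), of "Old (xl j)"])
    note b = bl[OF that(2)] bl[OF that(3)] not_below_v(1)[OF that(2)]
    have le: "xl j \<sqsubseteq> xl k" "r (xl j) \<le> r (xl k)"
      using left.index_order[OF that(2,3)] that(4) by auto
    have eq: "New_zl j \<squnion>\<^bsub>K\<^esub> Old (xl j) = Old (xl j)" "New_zl k \<squnion>\<^bsub>K\<^esub> Old (xl j) = Old (xl k)"
      using zl_join_old that b le by (simp_all add: join_absorb)
    show "(New_zl j \<squnion>\<^bsub>K\<^esub> Old (xl j)) \<sqinter>\<^bsub>K\<^esub> New_zl k = New_zl j"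
      unfolding eq using that b le by (intro K.eqI) (auto simp: K.l_meet K.r_meet)
    show "(New_zl j \<squnion>\<^bsub>K\<^esub> Old (xl j), New_zl k \<squnion>\<^bsub>K\<^esub> Old (xl j)) \<in> \<beta>'"
      if "(New_zl j \<squnion>\<^bsub>K\<^esub> Old (xl j), New_zl k \<squnion>\<^bsub>K\<^esub> Old (xl j)) \<in> \<beta>"
      using that old unfolding eq by blast
    show "Old (xl j) \<in> carrier K"
      using b by simp
  qed
  have zr_zr: "(New_zr j, New_zr k) \<in> \<beta>'" if "(New_zr j, New_zr k) \<in> \<beta>" "j \<in> Nr" "k \<in> Nr" "k \<le> j" for j k
  proof (rule tf[OF that(1), of "Old (xr j)"])
    note b = br[OF that(2)] br[OF that(3)] not_below_v(2)[OF that(2)]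
    have le: "xr j \<sqsubseteq> xr k" "l (xr j) \<le> l (xr k)"
      using right.index_order[OF that(2,3)] that(4) by auto
    have eq: "New_zr j \<squnion>\<^bsub>K\<^esub> Old (xr j) = Old (xr j)" "New_zr k \<squnion>\<^bsub>K\<^esub> Old (xr j) = Old (xr k)"
      using zr_join_old that b le by (simp_all add: join_absorb)
    show "(New_zr j \<squnion>\<^bsub>K\<^esub> Old (xr j)) \<sqinter>\<^bsub>K\<^esub> New_zr k = New_zr j"
      unfolding eq using that b le by (intro K.eqI) (auto simp: K.l_meet K.r_meet)
    show "(New_zr j \<squnion>\<^bsub>K\<^esub> Old (xr j), New_zr k \<squnion>\<^bsub>K\<^esub> Old (xr j)) \<in> \<beta>'"
      if "(New_zr j \<squnion>\<^bsub>K\<^esub> Old (xr j), New_zr k \<squnion>\<^bsub>K\<^esub> Old (xr j)) \<in> \<beta>"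
      using that old unfolding eq by blast
    show "Old (xr j) \<in> carrier K"
      using b by simp
  qed
  \<comment> \<open>The element \<open>ar\<close> from the opposite side is above
    \<open>yl k\<close> and joins with \<open>New_zl k\<close> to \<open>i\<close>; meeting with
    \<open>New_zl k\<close> leads back.\<close>
  have y_zl: "(Old (yl k), New_zl k) \<in> \<beta>'" if "(Old (yl k), New_zl k) \<in> \<beta>" "k \<in> Nl" for k
  proof (rule tf[OF that(1), of "Old ar"])
    note b = bl[OF that(2)]
    have "yl k \<sqsubseteq> ar"
      using b sq by (simp add: le_iff)
    moreover have "xl k \<squnion> ar = i"
      using join_eq_i[of "xl k" ar] b sq xl_below_i[OF that(2)] by simp
    ultimately have eq: "Old (yl k) \<squnion>\<^bsub>K\<^esub> Old ar = Old ar" "New_zl k \<squnion>\<^bsub>K\<^esub> Old ar = Old i"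
      using zl_join_old[OF that(2), of ar] b sq not_below_v(4) by (simp_all add: K_join_old[symmetric] join_absorb)
    show "(Old (yl k) \<squnion>\<^bsub>K\<^esub> Old ar) \<sqinter>\<^bsub>K\<^esub> New_zl k = Old (yl k)"
      unfolding eq using that b sq by (intro K.eqI) (auto simp: K.l_meet K.r_meet)
    show "(Old (yl k) \<squnion>\<^bsub>K\<^esub> Old ar, New_zl k \<squnion>\<^bsub>K\<^esub> Old ar) \<in> \<beta>'"
      if "(Old (yl k) \<squnion>\<^bsub>K\<^esub> Old ar, New_zl k \<squnion>\<^bsub>K\<^esub> Old ar) \<in> \<beta>"
      using that old unfolding eq by blast
  qed (use sq in simp)
  have y_zr: "(Old (yr k), New_zr k) \<in> \<beta>'" if "(Old (yr k), New_zr k) \<in> \<beta>" "k \<in> Nr" for k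
  proof (rule tf[OF that(1), of "Old al"])
    note b = br[OF that(2)]
    have "yr k \<sqsubseteq> al"
      using b sq by (simp add: le_iff)
    moreover have "xr k \<squnion> al = i"
      using join_eq_i[of al "xr k"] b sq xr_below_i[OF that(2)] join_comm[of L al "xr k"] by simp
    ultimately have eq: "Old (yr k) \<squnion>\<^bsub>K\<^esub> Old al = Old al" "New_zr k \<squnion>\<^bsub>K\<^esub> Old al = Old i"
      using zr_join_old[OF that(2), of al] b sq not_below_v(3) by (simp_all add: K_join_old[symmetric] join_absorb)
    show "(Old (yr k) \<squnion>\<^bsub>K\<^esub> Old al) \<sqinter>\<^bsub>K\<^esub> New_zr k = Old (yr k)"
      unfolding eq using that b sq by (intro K.eqI) (auto simp: K.l_meet K.r_meet)
    show "(Old (yr k) \<squnion>\<^bsub>K\<^esub> Old al, New_zr k \<squnion>\<^bsub>K\<^esub> Old al) \<in> \<beta>'"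
      if "(Old (yr k) \<squnion>\<^bsub>K\<^esub> Old al, New_zr k \<squnion>\<^bsub>K\<^esub> Old al) \<in> \<beta>"
      using that old unfolding eq by blast
  qed (use sq in simp)
  \<comment> \<open>Since \<open>al\<close> is \<open>xl 1\<close>, it absorbs
    \<open>New_zl 1\<close> and joins with \<open>t\<close> to \<open>i\<close>.\<close>
  have zl_t: "(New_zl 1, New_t) \<in> \<beta>'" if "(New_zl 1, New_t) \<in> \<beta>"
  proof (rule tf[OF that, of "Old al"])
    have eq: "New_zl 1 \<squnion>\<^bsub>K\<^esub> Old al = Old al" "New_t \<squnion>\<^bsub>K\<^esub> Old al = Old i"
      using zl_join_old[of 1 al] t_join_old[of al] sq start not_below_v(3) by (simp_all add: join_absorb)
    show "(New_zl 1 \<squnion>\<^bsub>K\<^esub> Old al) \<sqinter>\<^bsub>K\<^esub> New_t = New_zl 1"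
      unfolding eq using sq start by (intro K.eqI) (auto simp: K.l_meet K.r_meet)
    show "(New_zl 1 \<squnion>\<^bsub>K\<^esub> Old al, New_t \<squnion>\<^bsub>K\<^esub> Old al) \<in> \<beta>'"
      if "(New_zl 1 \<squnion>\<^bsub>K\<^esub> Old al, New_t \<squnion>\<^bsub>K\<^esub> Old al) \<in> \<beta>"
      using that old unfolding eq by blast
  qed (use sq in simp)
  have zr_t: "(New_zr 1, New_t) \<in> \<beta>'" if "(New_zr 1, New_t) \<in> \<beta>"
  proof (rule tf[OF that, of "Old ar"])
    have eq: "New_zr 1 \<squnion>\<^bsub>K\<^esub> Old ar = Old ar" "New_t \<squnion>\<^bsub>K\<^esub> Old ar = Old i"
      using zr_join_old[of 1 ar] t_join_old[of ar] sq start not_below_v(4) by (simp_all add: join_absorb)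
    show "(New_zr 1 \<squnion>\<^bsub>K\<^esub> Old ar) \<sqinter>\<^bsub>K\<^esub> New_t = New_zr 1"
      unfolding eq using sq start by (intro K.eqI) (auto simp: K.l_meet K.r_meet)
    show "(New_zr 1 \<squnion>\<^bsub>K\<^esub> Old ar, New_t \<squnion>\<^bsub>K\<^esub> Old ar) \<in> \<beta>'"
      if "(New_zr 1 \<squnion>\<^bsub>K\<^esub> Old ar, New_t \<squnion>\<^bsub>K\<^esub> Old ar) \<in> \<beta>"
      using that old unfolding eq by blast
  qed (use sq in simp)
  \<comment> \<open>Here the translation is by \<open>t\<close> itself: \<open>New_zl k\<close> lies
    below \<open>t\<close>, and \<open>xl k\<close> joins with \<open>t\<close> to
    \<open>i\<close>.\<close>
  have zl_x: "(New_zl k, Old (xl k)) \<in> \<beta>'" if "(New_zl k, Old (xl k)) \<in> \<beta>" "k \<in> Nl" for k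
  proof (rule tf[OF that(1), of New_t])
    note b = bl[OF that(2)]
    have le: "New_zl k \<sqsubseteq>\<^bsub>K\<^esub> New_t"
      using that b by (simp add: K_le)
    have eq: "New_zl k \<squnion>\<^bsub>K\<^esub> New_t = New_t" "Old (xl k) \<squnion>\<^bsub>K\<^esub> New_t = Old i"
      using K.join_absorb(1)[OF _ _ le] t_join_old[of "xl k"] that b sq not_below_v(1)[OF that(2)]
        xl_below_i[OF that(2)] by (simp_all add: join_absorb join_comm[of K "Old (xl k)"])
    show "(New_zl k \<squnion>\<^bsub>K\<^esub> New_t) \<sqinter>\<^bsub>K\<^esub> Old (xl k) = New_zl k"
      unfolding eq using that b sq by (intro K.eqI) (auto simp: K.l_meet K.r_meet)
    show "(New_zl k \<squnion>\<^bsub>K\<^esub> New_t, Old (xl k) \<squnion>\<^bsub>K\<^esub> New_t) \<in> \<beta>'"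
      if "(New_zl k \<squnion>\<^bsub>K\<^esub> New_t, Old (xl k) \<squnion>\<^bsub>K\<^esub> New_t) \<in> \<beta>"
      using that new unfolding eq by blast
  qed simp
  have zr_x: "(New_zr k, Old (xr k)) \<in> \<beta>'" if "(New_zr k, Old (xr k)) \<in> \<beta>" "k \<in> Nr" for k
  proof (rule tf[OF that(1), of New_t])
    note b = br[OF that(2)]
    have le: "New_zr k \<sqsubseteq>\<^bsub>K\<^esub> New_t"
      using that b by (simp add: K_le)
    have eq: "New_zr k \<squnion>\<^bsub>K\<^esub> New_t = New_t" "Old (xr k) \<squnion>\<^bsub>K\<^esub> New_t = Old i"
      using K.join_absorb(1)[OF _ _ le] t_join_old[of "xr k"] that b sq not_below_v(2)[OF that(2)]
        xr_below_i[OF that(2)] by (simp_all add: join_absorb join_comm[of K "Old (xr k)"])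
    show "(New_zr k \<squnion>\<^bsub>K\<^esub> New_t) \<sqinter>\<^bsub>K\<^esub> Old (xr k) = New_zr k"
      unfolding eq using that b sq by (intro K.eqI) (auto simp: K.l_meet K.r_meet)
    show "(New_zr k \<squnion>\<^bsub>K\<^esub> New_t, Old (xr k) \<squnion>\<^bsub>K\<^esub> New_t) \<in> \<beta>'"
      if "(New_zr k \<squnion>\<^bsub>K\<^esub> New_t, Old (xr k) \<squnion>\<^bsub>K\<^esub> New_t) \<in> \<beta>"
      using that new unfolding eq by blast
  qed simp
  have half: "2 * (a::nat) \<le> 2 * b + 1 \<longleftrightarrow> a \<le> b" "2 * a + 1 \<le> 2 * b \<longleftrightarrow> a < b" for a b
    by presburger+
  fix p q
  assume pq: "(p, q) \<in> \<beta>" and le: "p \<sqsubseteq>\<^bsub>K\<^esub> q"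
  have car: "p \<in> carrier K" "q \<in> carrier K"
    using congruenceD(1,2)[OF \<beta> pq] by auto
  have XY: "X p \<le> X q" "Y p \<le> Y q"
    using le car by (simp_all add: K_le)
  note conv = conv[OF pq]
  have zl_t': "(New_zl k, New_t) \<in> \<beta>'" if p: "p = New_zl k" "k \<in> Nl" "q = New_t" for k
  proof (rule tr)
    show "(New_zl k, New_zl 1) \<in> \<beta>'"
      using p start bl[OF p(2)] left.index_props(1)[OF p(2)] r_v
      by (intro zl_zl conv) (auto simp del: One_nat_def)
    show "(New_zl 1, New_t) \<in> \<beta>'"
      using p start bl[OF p(2)] sq by (intro zl_t conv) (auto simp del: One_nat_def)
  qed
  have zr_t': "(New_zr k, New_t) \<in> \<beta>'" if p: "p = New_zr k" "k \<in> Nr" "q = New_t" for k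
  proof (rule tr)
    show "(New_zr k, New_zr 1) \<in> \<beta>'"
      using p start br[OF p(2)] right.index_props(1)[OF p(2)] l_v
      by (intro zr_zr conv) (auto simp del: One_nat_def)
    show "(New_zr 1, New_t) \<in> \<beta>'"
      using p start br[OF p(2)] sq by (intro zr_t conv) (auto simp del: One_nat_def)
  qed
  show "(p, q) \<in> \<beta>'"
  proof (cases rule: carrier_K_cases[OF car(1)]; cases rule: carrier_K_cases[OF car(2)])
    fix x y assume "p = Old x" "x \<in> carrier L" "q = Old y" "y \<in> carrier L"
    then show ?thesis
      using pq old by simp
  next
    fix x assume p: "p = Old x" "x \<in> carrier L" "q = New_t"
    have x: "l x \<le> l v" "r x \<le> r v"
      using XY p half by auto
    have 1: "(Old x, Old (yl 1)) \<in> \<beta>'"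
      using p x start sq by (intro old conv) (auto simp del: One_nat_def)
    have 2: "(Old (yl 1), New_zl 1) \<in> \<beta>'"
      using p x start sq by (intro y_zl conv) (auto simp del: One_nat_def)
    have 3: "(New_zl 1, New_t) \<in> \<beta>'"
      using p x start sq by (intro zl_t conv) (auto simp del: One_nat_def)
    show ?thesis
      using tr[OF tr[OF 1 2] 3] p by simp
  next
    fix x k assume p: "p = Old x" "x \<in> carrier L" "q = New_zl k" "k \<in> Nl"
    note b = bl[OF p(4)]
    have x: "l x \<le> l v" "r x \<le> r (xl k)"
      using XY p half by auto
    have 1: "(Old x, Old (yl k)) \<in> \<beta>'"
      using p x b by (intro old conv) auto
    have 2: "(Old (yl k), New_zl k) \<in> \<beta>'"
      using p x b by (intro y_zl conv) auto
    show ?thesis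
      using tr[OF 1 2] p by simp
  next
    fix x k assume p: "p = Old x" "x \<in> carrier L" "q = New_zr k" "k \<in> Nr"
    note b = br[OF p(4)]
    have x: "l x \<le> l (xr k)" "r x \<le> r v"
      using XY p half by auto
    have 1: "(Old x, Old (yr k)) \<in> \<beta>'"
      using p x b by (intro old conv) auto
    have 2: "(Old (yr k), New_zr k) \<in> \<beta>'"
      using p x b by (intro y_zr conv) auto
    show ?thesis
      using tr[OF 1 2] p by simp
  next
    fix x assume p: "p = New_t" "q = Old x" "x \<in> carrier L"
    have x: "l v < l x" "r v < r x"
      using XY p half by auto
    have ix: "l i \<le> l x" "r i \<le> r x"
      using new_below_i[OF p(3) x] p sq by (auto simp: le_iff)
    have 1: "(New_t, Old i) \<in> \<beta>'"
      using p x ix sq by (intro new conv) auto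
    have 2: "(Old i, Old x) \<in> \<beta>'"
      using p x ix sq by (intro old conv) auto
    show ?thesis
      using tr[OF 1 2] p by simp
  next
    fix x k assume p: "p = New_zl k" "k \<in> Nl" "q = Old x" "x \<in> carrier L"
    note b = bl[OF p(2)]
    have x: "l v < l x" "r (xl k) \<le> r x"
      using XY p half by auto
    have ix: "l (xl k) \<le> l x"
      using left.above_new[OF p(2,4) x] p b by (auto simp: le_iff)
    have 1: "(New_zl k, Old (xl k)) \<in> \<beta>'"
      using p x ix b by (intro zl_x conv) auto
    have 2: "(Old (xl k), Old x) \<in> \<beta>'"
      using p x ix b by (intro old conv) auto
    show ?thesis
      using tr[OF 1 2] p by simp
  next
    fix x k assume p: "p = New_zr k" "k \<in> Nr" "q = Old x" "x \<in> carrier L"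
    note b = br[OF p(2)]
    have x: "r v < r x" "l (xr k) \<le> l x"
      using XY p half by auto
    have ix: "r (xr k) \<le> r x"
      using right.above_new[OF p(2,4) x] p b by (auto simp: le_iff)
    have 1: "(New_zr k, Old (xr k)) \<in> \<beta>'"
      using p x ix b by (intro zr_x conv) auto
    have 2: "(Old (xr k), Old x) \<in> \<beta>'"
      using p x ix b by (intro old conv) auto
    show ?thesis
      using tr[OF 1 2] p by simp
  next
    fix j k assume p: "p = New_zl j" "j \<in> Nl" "q = New_zl k" "k \<in> Nl"
    then show ?thesis
      using XY pq zl_zl left.index_order(1)[OF p(2,4)] by simp
  next
    fix j k assume p: "p = New_zr j" "j \<in> Nr" "q = New_zr k" "k \<in> Nr"
    then show ?thesis
      using XY pq zr_zr right.index_order(1)[OF p(2,4)] by simp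
  next
    fix j k assume "p = New_zl j" "j \<in> Nl" "q = New_zr k" "k \<in> Nr"
    then show ?thesis
      using XY br(2)[of k] by simp
  next
    fix j k assume "p = New_zr j" "j \<in> Nr" "q = New_zl k" "k \<in> Nl"
    then show ?thesis
      using XY bl(2)[of k] by simp
  next
    fix k assume "p = New_t" "q = New_zl k" "k \<in> Nl"
    then show ?thesis
      using XY bl(2)[of k] by simp
  next
    fix k assume "p = New_t" "q = New_zr k" "k \<in> Nr"
    then show ?thesis
      using XY br(2)[of k] by simp
  next
    assume "p = New_t" "q = New_t"
    then show ?thesis
      using rf car by simp
  qed (use zl_t' zr_t' in simp_all)
qed

lemma join_irreducible_cases:
  assumes "join_irreducible (Con K) \<beta>"
  shows "\<beta> = con K New_t (Old i) \<or>
    (\<exists>\<alpha>. join_irreducible (Con L) \<alpha> \<and> \<beta> = minimal_extension L v al ar i \<alpha>)"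
proof -
  have \<beta>: "congruence K \<beta>"
    "\<And>\<gamma> \<delta>. congruence K \<gamma> \<Longrightarrow> congruence K \<delta> \<Longrightarrow> \<beta> = congruence_gen K (\<gamma> \<union> \<delta>) \<Longrightarrow> \<beta> = \<gamma> \<or> \<beta> = \<delta>"
    using assms unfolding K.join_irreducible_Con_iff by blast+
  define \<alpha> where "\<alpha> = embedding.restrict \<beta>"
  have \<alpha>: "congruence L \<alpha>"
    unfolding \<alpha>_def using embedding.congruence_restrict[OF \<beta>(1)] .
  note ext = embedding.congruence_extend[OF \<alpha>]
  have le: "embedding.extend \<alpha> \<subseteq> \<beta>"
    using embedding.extend_subset_iff[OF \<alpha> \<beta>(1)] by (simp add: \<alpha>_def)
  have old: "(Old x, Old y) \<in> embedding.extend \<alpha>" if "(Old x, Old y) \<in> \<beta>" for x y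
  proof -
    have "(x, y) \<in> \<alpha>"
      using that congruenceD(1,2)[OF \<beta>(1) that] by (simp add: \<alpha>_def embedding.restrict_def)
    then have "(Old x, Old y) \<in> map_prod Old Old ` \<alpha>"
      by force
    then show ?thesis
      unfolding embedding.extend_def using congruence_gen_superset by blast
  qed
  have "\<beta> = embedding.extend \<alpha> \<or> \<beta> = con K New_t (Old i)"
  proof (cases "(New_t, Old i) \<in> \<beta>")
    case True
    let ?c = "con K New_t (Old i)" and ?g = "congruence_gen K (embedding.extend \<alpha> \<union> con K New_t (Old i))"
    have c: "congruence K ?c"
      using K.congruence_con square_closed by simp
    have g: "congruence K ?g"
      using K.congruence_subset[OF ext] K.congruence_subset[OF c]
      by (intro K.congruence_congruence_gen) auto
    have sup: "embedding.extend \<alpha> \<union> ?c \<subseteq> ?g"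
      by (rule congruence_gen_superset)
    have "\<beta> \<subseteq> ?g"
      using sup old con_contains[of New_t "Old i" K] by (intro congruence_generated[OF \<beta>(1) g]) auto
    moreover have "?g \<subseteq> \<beta>"
      using le con_least[OF \<beta>(1) True] by (intro congruence_gen_least[OF \<beta>(1)]) auto
    ultimately show ?thesis
      \<comment> \<open>\<open>\<beta>\<close> is the join of the extended restriction and con(t,
        i), so join-irreducibility selects one of them.\<close>
      using \<beta>(2)[OF ext c] by blast
  next
    case False
    have "\<beta> \<subseteq> embedding.extend \<alpha>"
      using False old by (intro congruence_generated[OF \<beta>(1) ext]) auto
    then show ?thesis
      using le by blast
  qed
  then show ?thesis
  proof
    assume eq: "\<beta> = embedding.extend \<alpha>"
    \<comment> \<open>The restriction is replaced by a join-irreducible congruence with the same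
      extension.\<close>
    then obtain \<alpha>' where "join_irreducible (Con L) \<alpha>'" "embedding.extend \<alpha>' = \<beta>"
      using embedding.join_irreducible_extend[OF _ \<alpha>] assms by metis
    then show ?thesis
      unfolding minimal_extension_eq by blast
  qed blast
qed

lemma above_t:
  assumes "p \<in> carrier K" "New_t \<sqsubseteq>\<^bsub>K\<^esub> p"
  shows "p = New_t \<or> Old i \<sqsubseteq>\<^bsub>K\<^esub> p"
  using assms(1)
proof (cases rule: carrier_K_cases)
  case (Old x)
  then have "i \<sqsubseteq> x"
    using assms by (intro new_below_i) (simp_all add: K_le)
  then show ?thesis
    using Old square_closed by (simp add: K_le le_iff)
next
  case (zl k)
  then show ?thesis
    using assms left.index_bounds[of k] by (simp add: K_le)
next
  case (zr k)
  then show ?thesis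
    using assms right.index_bounds[of k] by (simp add: K_le)
qed simp

lemma t_covered_by_i: "New_t \<prec>\<^bsub>K\<^esub> Old i"
  unfolding K.covers_iff
proof (intro conjI ballI impI)
  show "New_t \<sqsubseteq>\<^bsub>K\<^esub> Old i"
    using square_lr square_closed by (simp add: K_le)
  fix p
  assume "p \<in> carrier K" "New_t \<sqsubseteq>\<^bsub>K\<^esub> p \<and> p \<sqsubseteq>\<^bsub>K\<^esub> Old i"
  then show "p = New_t \<or> p = Old i"
    using above_t[of p] K.antisym[of p "Old i"] square_closed by auto
qed (use square_closed in auto)

end

section \<open>Tight squares\<close>

locale tight_forked = forked +
  assumes tight: "{x. x \<prec> i} = {al, ar}"
begin

lemma below_i_cases:
  assumes "x \<in> carrier L" "x \<sqsubseteq> i" "x \<noteq> i"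
  shows "x \<sqsubseteq> al \<or> x \<sqsubseteq> ar"
proof -
  obtain z where "x \<sqsubseteq> z" "z \<prec> i"
    using cover_below[OF assms(1) square_closed(4) assms(2,3)] .
  then show ?thesis
    using tight by auto
qed

text \<open>Tightness puts every old \<open>x \<noteq> i\<close> below \<open>i\<close> under
  \<open>al\<close> or \<open>ar\<close>. If it is under \<open>al\<close> and also
  \<open>l x \<le> l ar\<close>, then \<open>r x \<le> r al = r v \<le> r ar\<close> puts it under
  \<open>ar\<close> as well; this gives the threshold description of the ideal of \<open>ar\<close>,
  and symmetrically of \<open>al\<close>. The new elements are sorted by their odd
  coordinates.\<close>

lemma tight_top_K: "tight_top K X Y (Old al) (Old ar) New_t (Old i)"
proof
  note sq = square_closed square_lr r_v l_v
  show "Old al \<sqsubseteq>\<^bsub>K\<^esub> Old i" "Old ar \<sqsubseteq>\<^bsub>K\<^esub> Old i" "New_t \<sqsubseteq>\<^bsub>K\<^esub> Old i"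
    using sq by (simp_all add: K_le)
  have zl_le: "New_zl k \<sqsubseteq>\<^bsub>K\<^esub> Old al" if "k \<in> Nl" for k
    using sq left.index_bounds[OF that] that by (simp add: K_le)
  have zr_le: "New_zr k \<sqsubseteq>\<^bsub>K\<^esub> Old ar" if "k \<in> Nr" for k
    using sq right.index_bounds[OF that] that by (simp add: K_le)
  have low: "l x \<le> l al \<and> r x \<le> r al \<or> l x \<le> l ar \<and> r x \<le> r ar" if "x \<in> carrier L" "Old x \<sqsubseteq>\<^bsub>K\<^esub> Old i" "x \<noteq> i" for x
    using below_i_cases[of x] that sq by (simp add: K_le le_iff)
  fix p
  assume p: "p \<in> carrier K"
  show "p = New_t \<or> Old i \<sqsubseteq>\<^bsub>K\<^esub> p" if "New_t \<sqsubseteq>\<^bsub>K\<^esub> p"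
    using above_t p that .
  assume pi: "p \<sqsubseteq>\<^bsub>K\<^esub> Old i"
  show "p = Old i \<or> p = New_t \<or> p \<sqsubseteq>\<^bsub>K\<^esub> Old al \<or> p \<sqsubseteq>\<^bsub>K\<^esub> Old ar"
    using p
  proof (cases rule: carrier_K_cases)
    case (Old x)
    then show ?thesis
      using low[of x] pi sq by (auto simp: K_le)
  qed (use zl_le zr_le in auto)
  show "p \<sqsubseteq>\<^bsub>K\<^esub> Old ar \<longleftrightarrow> X p \<le> X (Old ar)"
    using p
  proof (cases rule: carrier_K_cases)
    case (Old x)
    then show ?thesis
      using low[of x] pi sq by (cases "x = i") (auto simp: K_le)
  next
    case (zr k)
    then show ?thesis
      using zr_le[of k] p sq by (auto simp: K_le)
  qed (use sq p in \<open>auto simp: K_le\<close>)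
  show "p \<sqsubseteq>\<^bsub>K\<^esub> Old al \<longleftrightarrow> Y p \<le> Y (Old al)"
    using p
  proof (cases rule: carrier_K_cases)
    case (Old x)
    then show ?thesis
      using low[of x] pi sq by (cases "x = i") (auto simp: K_le)
  next
    case (zl k)
    then show ?thesis
      using zl_le[of k] p sq by (auto simp: K_le)
  qed (use sq p in \<open>auto simp: K_le\<close>)
qed (use square_closed r_v l_v in auto)

lemma con_not_minimal_extension:
  assumes "congruence L \<alpha>"
  shows "con K New_t (Old i) \<noteq> minimal_extension L v al ar i \<alpha>"
proof
  assume eq: "con K New_t (Old i) = minimal_extension L v al ar i \<alpha>"
  have v_le: "l v \<le> l al" "r v \<le> r ar"
    using square_lr by auto
  \<comment> \<open>The odd coordinates of \<open>t\<close> are just above the even ones of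
    \<open>v\<close>, so an old element below \<open>t\<close> is below \<open>v\<close>.\<close>
  have small: "Old x \<sqsubseteq>\<^bsub>K\<^esub> Old al \<and> Old x \<sqsubseteq>\<^bsub>K\<^esub> Old ar" if "x \<in> carrier L" "Old x \<sqsubseteq>\<^bsub>K\<^esub> New_t" for x
    using that v_le square_closed r_v l_v by (auto simp: K_le)
  let ?A = "map_prod Old Old ` \<alpha>"
  have gen: "con K New_t (Old i) = congruence_gen K ?A"
    using eq by (simp add: minimal_extension_def)
  have sub: "?A \<subseteq> con K New_t (Old i)"
    unfolding gen by (rule congruence_gen_superset)
  have "(p \<sqsubseteq>\<^bsub>K\<^esub> New_t \<longrightarrow> p \<sqsubseteq>\<^bsub>K\<^esub> Old al \<and> p \<sqsubseteq>\<^bsub>K\<^esub> Old ar) \<and> (q \<sqsubseteq>\<^bsub>K\<^esub> New_t \<longrightarrow> q \<sqsubseteq>\<^bsub>K\<^esub> Old al \<and> q \<sqsubseteq>\<^bsub>K\<^esub> Old ar)"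
    if pq: "(p, q) \<in> ?A" for p q
  proof -
    obtain x y where xy: "(x, y) \<in> \<alpha>" "p = Old x" "q = Old y"
      using pq by auto
    then show ?thesis
      using small congruenceD(1,2)[OF assms xy(1)] by simp
  qed
  then show False
    using tight_top.con_not_generated[OF tight_top_K sub] gen by blast
qed

theorem new_join_irreducibles:
  "{\<beta>. join_irreducible (Con K) \<beta> \<and>
      \<not> (\<exists>\<alpha>. join_irreducible (Con L) \<alpha> \<and> \<beta> = minimal_extension L v al ar i \<alpha>)}
    = {con K New_t (Old i)}"
proof -
  have "congruence L \<alpha>" if "join_irreducible (Con L) \<alpha>" for \<alpha>
    using that unfolding join_irreducible_Con_iff by blast
  then show ?thesis
    using join_irreducible_cases K.join_irreducible_con[OF t_covered_by_i] con_not_minimal_extension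
    by blast
qed

end

text \<open>The coordinates come without orientation. As \<open>v\<close> is the coordinatewise
  minimum of the incomparable \<open>al\<close> and \<open>ar\<close>, it shares one coordinate with
  each; exchanging \<open>l\<close> and \<open>r\<close> if necessary yields the required
  equations.\<close>

lemma tight_forkedI:
  assumes "grid_lattice L l r" "semimodular L" "tight_square L v al ar i"
  shows "tight_forked L l r v al ar i \<or> tight_forked L r l v al ar i"
proof -
  interpret grid_lattice L l r
    by (rule assms)
  interpret semimodular_lattice L
    by unfold_locales (rule assms)
  interpret semimodular_grid L l r ..
  have sq: "covering_square L v al ar i" "{x. x \<prec>\<^bsub>L\<^esub> i} = {al, ar}"
    using assms(3) by (auto simp: tight_square_def)
  then have c: "v \<prec>\<^bsub>L\<^esub> al" "v \<prec>\<^bsub>L\<^esub> ar" "al \<noteq> ar" "v = al \<sqinter>\<^bsub>L\<^esub> ar"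
    by (auto simp: covering_square_def)
  have car: "al \<in> carrier L" "ar \<in> carrier L"
    using c coversD by blast+
  have v: "l v = min (l al) (l ar)" "r v = min (r al) (r ar)"
    using c(4) car l_meet r_meet by simp_all
  have "\<not> al \<sqsubseteq>\<^bsub>L\<^esub> ar" "\<not> ar \<sqsubseteq>\<^bsub>L\<^esub> al"
    using covers_incomparable(1) c by metis+
  then consider "l ar < l al" "r al < r ar" | "l al < l ar" "r ar < r al"
    using car le_iff by fastforce
  then show ?thesis
  proof cases
    case 1
    then have "tight_forked L l r v al ar i"
      using v sq by unfold_locales auto
    then show ?thesis ..
  next
    case 2
    then have "tight_forked L r l v al ar i"
      using v sq swap by (intro tight_forked.intro forked.intro forked_axioms.intro tight_forked_axioms.intro) auto
    then show ?thesis ..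
  qed
qed

theorem theorem3:
  fixes L :: "'a gorder" and pos :: "'a \<Rightarrow> real \<times> real" and v al ar i :: 'a
  assumes "sps_lattice L"
    and "planar_diagram L pos"
    and "tight_square L v al ar i"
    and "left_above pos v al ar"
  shows "{\<beta>. join_irreducible (Con (fork L v al ar i)) \<beta> \<and>
            \<not> (\<exists>\<alpha>. join_irreducible (Con L) \<alpha> \<and> \<beta> = minimal_extension L v al ar i \<alpha>)}
         = {con (fork L v al ar i) New_t (Old i)}"
proof -
  have L: "lattice L" "finite (carrier L)" "slim L" "semimodular L"
    using assms(1) by (auto simp: sps_lattice_def)
  have "carrier L \<noteq> {}"
    using assms(3) by (auto simp: tight_square_def covering_square_def covers_def)
  then have "sps L pos"
    using L assms(2)
    by (intro sps.intro planar_lattice.intro planar_lattice_axioms.intro semimodular_lattice.intro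
        semimodular_lattice_axioms.intro sps_axioms.intro finite_lattice.intro finite_lattice_axioms.intro)
  then obtain l r where "grid_lattice L l r"
    using sps.coordinates by blast
  then have "tight_forked L l r v al ar i \<or> tight_forked L r l v al ar i"
    by (rule tight_forkedI[OF _ L(4) assms(3)])
  \<comment> \<open>The fork and the claim do not mention the coordinates, so both orientations
    prove the same equation.\<close>
  then show ?thesis
    by (elim disjE) (rule tight_forked.new_join_irreducibles, assumption)+
qed

end
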